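(* Let $f$ be an exact symplectic $C^1$ twist map of $\mathbb{A}$ and let $M$ be an irrational Aubry-Mather set of $f$. The two following assertions are equivalent: (i) for all $x\in M$, $M$ is not $C^1$-regular at $x$; (ii) the set $M$ is uniformly hyperbolic (for $f$).
   Context: $\mathbb{T}=\mathbb{R}/\mathbb{Z}$, $\mathbb{A}=\mathbb{T}\times\mathbb{R}$ with coordinates $(\theta,r)$, symplectic form $d\theta\wedge dr$ and its usual Riemannian metric. $\pi:\mathbb{A}\to\mathbb{T}$ is the first projection, $\tilde\pi:\mathbb{R}^2\to\mathbb{R}$ its lift, $p:\mathbb{R}^2\to\mathbb{A}$ the universal covering. A $C^1$ diffeomorphism $f:\mathbb{A}\to\mathbb{A}$ isotopic to the identity is a positive twist map if, for any lift $\tilde f:\mathbb{R}^2\to\mathbb{R}^2$ and every $\tilde\theta\in\mathbb{R}$, the maps $r\mapsto\tilde\pi\circ\tilde f(\tilde\theta,r)$ and $r\mapsto\tilde\pi\circ\tilde f^{-1}(\tilde\theta,r)$ are both diffeomorphisms (of $\mathbb{R}$), the first increasing and the second decreasing. If $f$ is a positive twist map, $f^{-1}$ is a negative twist map. A twist map may be positive or negative. $f$ is exact symplectic if the 1-form $f^*(r\,d\theta)-r\,d\theta$ is exact. A non-empty set $M\subset\mathbb{A}$ is $f$-ordered if it is compact, $f$-invariant, and for all $z,z'\in p^{-1}(M)$: $\tilde\pi(z)<\tilde\pi(z')\Leftrightarrow\tilde\pi(\tilde f(z))<\tilde\pi(\tilde f(z'))$. An Aubry-Mather set of $f$ is a minimal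 (for inclusion) $f$-ordered set. For an Aubry-Mather set $M$ there is a bi-Lipschitz orientation preserving homeomorphism $h$ of $\mathbb{T}$ with $\pi\circ f(\theta,r)=h(\theta)$ for all $(\theta,r)\in M$; the rotation number $\rho(M,\tilde f)$ is that of a lift $\tilde h$ of $h$ with $\tilde h(\tilde\theta)=\tilde\pi\circ\tilde f(\tilde\theta,r)$ on $p^{-1}(M)$. $M$ is irrational if $\rho(M,\tilde f)$ is irrational. For $M\subset\mathbb{A}$ and $x\in M$, the paratingent cone $P_M(x)\subset T_x\mathbb{A}$ is the set of limits $v=\lim_{n\to\infty}\frac{x_n-y_n}{t_n}$ where $(x_n),(y_n)$ are sequences in $M$ converging to $x$, $(t_n)$ is a sequence of positive reals converging to $0$, and $x_n-y_n$ denotes the lift in $[-\frac12,\frac12[^2\subset\mathbb{R}^2$. $M$ is $C^1$-regular at $x$ if there is a line $D$ of $T_x\mathbb{A}$ with $P_M(x)\subset D$. A compact $f$-invariant set is uniformly hyperbolic if it is a hyperbolic set in the usual sense: there is a $Df$-invariant continuous splitting $T_x\mathbb{A}=E^s(x)\oplus E^u(x)$ over it with $Df^n|_{E^s}$ and $Df^{-n}|_{E^u}$ ($n\ge0$) uniformly exponentially contracting. *)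

theory Defs
  imports "HOL-Analysis.Analysis"
begin

section \<open>The circle \<open>\<real>/\<int>\<close> and the annulus\<close>

quotient_type circle = real / "\<lambda>x y :: real. x - y \<in> \<int>"
  morphisms rep_circle circle_proj
proof (rule equivpI)
  show "reflp (\<lambda>x y :: real. x - y \<in> \<int>)"
    by (simp add: reflp_def)
  show "symp (\<lambda>x y :: real. x - y \<in> \<int>)"
  proof (rule sympI)
    fix x y :: real assume "x - y \<in> \<int>"
    then have "- (x - y) \<in> \<int>" by (simp only: minus_in_Ints_iff)
    then show "y - x \<in> \<int>" by simp
  qed
  show "transp (\<lambda>x y :: real. x - y \<in> \<int>)"
  proof (rule transpI)
    fix x y z :: real assume "x - y \<in> \<int>" "y - z \<in> \<int>"
    then have "(x - y) + (y - z) \<in> \<int>" by (rule Ints_add)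
    then show "x - z \<in> \<int>" by simp
  qed
qed

lemma circle_proj_eq_iff: "circle_proj x = circle_proj y \<longleftrightarrow> x - y \<in> \<int>"
  by (rule circle.abs_eq_iff)

lemma circle_proj_surj: obtains x where "circle_proj x = a"
  using Quotient3_abs_rep[OF Quotient3_circle] by blast

instantiation circle :: metric_space
begin

definition dist_circle :: "circle \<Rightarrow> circle \<Rightarrow> real" where
  "dist_circle a b = (INF z \<in> circle_proj -` {a} \<times> circle_proj -` {b}. \<bar>fst z - snd z\<bar>)"

definition uniformity_circle :: "(circle \<times> circle) filter" where
  "uniformity_circle = (INF e\<in>{0<..}. principal {(x, y). dist x y < e})"

definition open_circle :: "circle set \<Rightarrow> bool" where
  "open_circle U = (\<forall>x\<in>U. eventually (\<lambda>(x', y). x' = x \<longrightarrow> y \<in> U) uniformity)"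

lemma dist_circle_le: "dist (circle_proj x) (circle_proj y) \<le> \<bar>x - y\<bar>"
  unfolding dist_circle_def by (rule cINF_lower2[where x = "(x, y)"]) (auto intro!: bdd_belowI2[where m = 0])

lemma dist_circle_proj: "dist (circle_proj x) (circle_proj y) = \<bar>x - y - of_int (round (x - y))\<bar>"
proof (rule antisym)
  have "circle_proj (y + of_int (round (x - y))) = circle_proj y"
    by (simp add: circle_proj_eq_iff)
  then show "dist (circle_proj x) (circle_proj y) \<le> \<bar>x - y - of_int (round (x - y))\<bar>"
    by (metis dist_circle_le diff_diff_eq)
  have "\<bar>x - y - of_int (round (x - y))\<bar> \<le> \<bar>u - v\<bar>"
    if "circle_proj u = circle_proj x" "circle_proj v = circle_proj y" for u v
  proof -
    have "u - x \<in> \<int>" "v - y \<in> \<int>"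
      using that by (simp_all add: circle_proj_eq_iff)
    then obtain k l :: int where "u - x = of_int k" "v - y = of_int l"
      by (elim Ints_cases)
    then have "u - v = x - y - of_int (l - k)" by simp
    then show ?thesis by (metis round_diff_minimal)
  qed
  then show "\<bar>x - y - of_int (round (x - y))\<bar> \<le> dist (circle_proj x) (circle_proj y)"
    unfolding dist_circle_def by (intro cINF_greatest) auto
qed

lemma dist_circle_attained:
  obtains y' where "circle_proj y' = circle_proj y" "dist (circle_proj x) (circle_proj y) = \<bar>x - y'\<bar>"
proof (rule that)
  show "circle_proj (y + of_int (round (x - y))) = circle_proj y"
    by (simp add: circle_proj_eq_iff)
  show "dist (circle_proj x) (circle_proj y) = \<bar>x - (y + of_int (round (x - y)))\<bar>"
    by (simp add: dist_circle_proj algebra_simps)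
qed

lemma dist_circle_commute: "dist a b = dist b (a :: circle)"
proof -
  have "dist a b \<le> dist b a" for a b :: circle
  proof -
    obtain x where x: "circle_proj x = a" by (rule circle_proj_surj)
    obtain y where y: "circle_proj y = b" by (rule circle_proj_surj)
    obtain x' where "circle_proj x' = a" "dist b a = \<bar>y - x'\<bar>"
      using dist_circle_attained[where y = x and x = y] x y by metis
    then show ?thesis using dist_circle_le[of x' y] y by simp
  qed
  then show ?thesis by (simp add: antisym)
qed

instance
proof
  show "uniformity = (INF e\<in>{0<..}. principal {(x, y :: circle). dist x y < e})"
    by (rule uniformity_circle_def)
  show "open U = (\<forall>x\<in>U. eventually (\<lambda>(x', y). x' = x \<longrightarrow> y \<in> U) uniformity)" for U :: "circle set"
    by (rule open_circle_def)
  fix a b c :: circle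
  obtain x where x: "circle_proj x = a" by (rule circle_proj_surj)
  obtain y where y: "circle_proj y = b" by (rule circle_proj_surj)
  obtain z where z: "circle_proj z = c" by (rule circle_proj_surj)
  show "dist a b = 0 \<longleftrightarrow> a = b"
  proof
    assume "dist a b = 0"
    moreover obtain y' where "circle_proj y' = b" "dist a b = \<bar>x - y'\<bar>"
      using dist_circle_attained[where x = x and y = y] x y by metis
    ultimately show "a = b" using x by simp
  next
    assume "a = b"
    then show "dist a b = 0"
      using dist_circle_proj[of x x] x by simp
  qed
  obtain x' where x': "circle_proj x' = a" "dist c a = \<bar>z - x'\<bar>"
    using dist_circle_attained[where x = z and y = x] x z by metis
  obtain y' where y': "circle_proj y' = b" "dist c b = \<bar>z - y'\<bar>"
    using dist_circle_attained[where x = z and y = y] y z by metis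
  have "dist a b \<le> \<bar>x' - y'\<bar>"
    using dist_circle_le[of x' y'] x' y' by simp
  then show "dist a b \<le> dist a c + dist b c"
    using x' y' dist_circle_commute[of a c] dist_circle_commute[of b c] by linarith
qed

end

lemma open_circle_iff_quotient: "open U \<longleftrightarrow> open (circle_proj -` U)"
proof
  assume U: "open U"
  have "\<exists>e>0. \<forall>y. dist y x < e \<longrightarrow> y \<in> circle_proj -` U" if "circle_proj x \<in> U" for x
  proof -
    obtain e where "e > 0" and e: "\<And>b. dist b (circle_proj x) < e \<Longrightarrow> b \<in> U"
      using U \<open>circle_proj x \<in> U\<close> unfolding open_dist by metis
    have "circle_proj y \<in> U" if "dist y x < e" for y
      using e dist_circle_le[of y x] that by (simp add: dist_real_def)
    then show ?thesis using \<open>e > 0\<close> by auto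
  qed
  then show "open (circle_proj -` U)" unfolding open_dist by auto
next
  assume U: "open (circle_proj -` U)"
  have "\<exists>e>0. \<forall>b. dist b a < e \<longrightarrow> b \<in> U" if a: "a \<in> U" for a
  proof -
    obtain x where x: "circle_proj x = a" by (rule circle_proj_surj)
    have "x \<in> circle_proj -` U" using a x by simp
    then obtain e where "e > 0" and e: "\<And>y. dist y x < e \<Longrightarrow> circle_proj y \<in> U"
      using U unfolding open_dist by (metis vimageE)
    have "b \<in> U" if "dist b a < e" for b
    proof -
      obtain y where y: "circle_proj y = b" by (rule circle_proj_surj)
      obtain y' where "circle_proj y' = b" "dist a b = \<bar>x - y'\<bar>"
        using dist_circle_attained[where x = x and y = y] x y by metis
      then show ?thesis using e[of y'] that
        by (simp add: dist_real_def dist_commute abs_minus_commute)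
    qed
    then show ?thesis using \<open>e > 0\<close> by auto
  qed
  then show "open U" unfolding open_dist by blast
qed

type_synonym annulus = "circle \<times> real"

text \<open>
  Tangent spaces of the annulus are identified with \<open>real \<times> real\<close> by the coordinates
  \<open>(\<theta>, r)\<close>; the norm of the flat Riemannian metric is then the Euclidean norm.
\<close>

definition ann_proj :: "real \<times> real \<Rightarrow> annulus" where
  "ann_proj z = (circle_proj (fst z), snd z)"

definition is_lift :: "(annulus \<Rightarrow> annulus) \<Rightarrow> (real \<times> real \<Rightarrow> real \<times> real) \<Rightarrow> bool" where
  "is_lift f F \<longleftrightarrow> continuous_on UNIV F \<and> (\<forall>z. ann_proj (F z) = f (ann_proj z))"

definition tangent_map :: "(annulus \<Rightarrow> annulus) \<Rightarrow> annulus \<Rightarrow> real \<times> real \<Rightarrow> real \<times> real" where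
  "tangent_map f x = (THE L. \<exists>F z. is_lift f F \<and> ann_proj z = x \<and> (F has_derivative L) (at z))"

lemma ann_proj_eq_iff:
  "ann_proj z = ann_proj w \<longleftrightarrow> fst z - fst w \<in> \<int> \<and> snd z = snd w"
  by (simp add: ann_proj_def circle_proj_eq_iff)

lemma is_lift_unique:
  assumes "is_lift f F" "is_lift f G"
  obtains k :: int where "\<And>z. G z = F z + (of_int k, 0)"
proof -
  define d where "d z = fst (G z) - fst (F z)" for z
  have d: "d z \<in> \<int>" "snd (G z) = snd (F z)" for z
  proof -
    have "ann_proj (G z) = ann_proj (F z)"
      using assms unfolding is_lift_def by (simp del: split_paired_All)
    then show "d z \<in> \<int>" "snd (G z) = snd (F z)"
      by (simp_all add: ann_proj_eq_iff d_def)
  qed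
  have cont: "continuous_on UNIV d"
    unfolding d_def using assms by (intro continuous_intros) (simp_all add: is_lift_def)
  have "d constant_on UNIV"
  proof (rule continuous_discrete_range_constant[OF _ cont])
    fix z
    have "1 \<le> norm (d y - d z)" if "d y \<noteq> d z" for y
      using d(1)[of y] d(1)[of z] that
      by (metis Ints_diff Ints_nonzero_abs_ge1 eq_iff_diff_eq_0 real_norm_def)
    then show "\<exists>e>0. \<forall>y. y \<in> UNIV \<and> d y \<noteq> d z \<longrightarrow> e \<le> norm (d y - d z)"
      by (auto intro!: exI[of _ 1])
  qed auto
  then obtain c where c: "\<And>z. d z = c" by (auto simp: constant_on_def)
  obtain k where "c = of_int k" using d(1)[of 0] c by (auto elim: Ints_cases)
  then have "G z = F z + (of_int k, 0)" for z
    using c[of z] d(2)[of z] by (simp add: d_def prod_eq_iff)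
  then show thesis by (rule that)
qed

lemma tangent_map_eq:
  assumes F: "is_lift f F" and L: "(F has_derivative L) (at z)"
  shows "tangent_map f (ann_proj z) = L"
  unfolding tangent_map_def
proof (rule the_equality)
  show "\<exists>G w. is_lift f G \<and> ann_proj w = ann_proj z \<and> (G has_derivative L) (at w)"
    using assms by blast
next
  fix L' assume "\<exists>G w. is_lift f G \<and> ann_proj w = ann_proj z \<and> (G has_derivative L') (at w)"
  then obtain G w where G: "is_lift f G" and w: "ann_proj w = ann_proj z"
    and L': "(G has_derivative L') (at w)" by blast
  define e where "e = w - z"
  have e: "fst e \<in> \<int>" "snd e = 0" using w by (auto simp: e_def ann_proj_eq_iff)
  have "is_lift f (\<lambda>y. G (y + e))"
  proof -
    have "ann_proj (y + e) = ann_proj y" for y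
      using e by (simp add: ann_proj_eq_iff)
    then have "\<forall>y. ann_proj (G (y + e)) = f (ann_proj y)"
      using G unfolding is_lift_def by (simp del: split_paired_All)
    moreover have "continuous_on UNIV G" using G unfolding is_lift_def by simp
    then have "continuous_on UNIV (\<lambda>y. G (y + e))"
      by (rule continuous_on_compose2) (intro continuous_intros, simp)
    ultimately show ?thesis unfolding is_lift_def by blast
  qed
  then obtain k :: int where k: "\<And>y. G (y + e) = F y + (of_int k, 0)"
    using is_lift_unique[OF F] by metis
  have "((\<lambda>y. G (y + e)) has_derivative (\<lambda>v. L' v)) (at z)"
  proof -
    have "((\<lambda>y. y + e) has_derivative (\<lambda>v. v)) (at z)"
      by (auto intro!: derivative_eq_intros)
    moreover have "(G has_derivative L') (at (z + e))" using L' by (simp add: e_def)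
    ultimately show ?thesis by (rule has_derivative_compose)
  qed
  then have "((\<lambda>y. F y + (of_int k, 0)) has_derivative L') (at z)" by (simp add: k)
  moreover have "((\<lambda>y. F y + (of_int k, 0)) has_derivative L) (at z)"
    by (rule has_derivative_add_const[OF L])
  ultimately show "L' = L" by (rule has_derivative_unique)
qed


section \<open>Twist maps\<close>

definition C1_map :: "('a :: real_normed_vector \<Rightarrow> 'b :: real_normed_vector) \<Rightarrow> bool" where
  "C1_map g \<longleftrightarrow> (\<exists>g'. (\<forall>x. (g has_derivative blinfun_apply (g' x)) (at x)) \<and> continuous_on UNIV g')"

definition C1_diffeo :: "('a :: real_normed_vector \<Rightarrow> 'b :: real_normed_vector) \<Rightarrow> bool" where
  "C1_diffeo g \<longleftrightarrow> bij g \<and> C1_map g \<and> C1_map (inv g)"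

text \<open>Every continuous self-map of the annulus has a lift, and all its lifts are equally smooth.\<close>

definition ann_C1_map :: "(annulus \<Rightarrow> annulus) \<Rightarrow> bool" where
  "ann_C1_map f \<longleftrightarrow> (\<exists>F. is_lift f F \<and> C1_map F)"

definition ann_C1_diffeo :: "(annulus \<Rightarrow> annulus) \<Rightarrow> bool" where
  "ann_C1_diffeo f \<longleftrightarrow> bij f \<and> ann_C1_map f \<and> ann_C1_map (inv f)"

definition isotopic_to_id :: "(annulus \<Rightarrow> annulus) \<Rightarrow> bool" where
  "isotopic_to_id f \<longleftrightarrow> homotopic_with ann_C1_diffeo euclidean euclidean id f"

definition positive_twist_map :: "(annulus \<Rightarrow> annulus) \<Rightarrow> bool" where
  "positive_twist_map f \<longleftrightarrow> ann_C1_diffeo f \<and> isotopic_to_id f \<and>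
     (\<forall>F \<theta>. is_lift f F \<longrightarrow>
        C1_diffeo (\<lambda>r. fst (F (\<theta>, r))) \<and> monotone (<) (<) (\<lambda>r. fst (F (\<theta>, r))) \<and>
        C1_diffeo (\<lambda>r. fst (inv F (\<theta>, r))) \<and> monotone (<) (>) (\<lambda>r. fst (inv F (\<theta>, r))))"

definition negative_twist_map :: "(annulus \<Rightarrow> annulus) \<Rightarrow> bool" where
  "negative_twist_map f \<longleftrightarrow> (\<exists>g. positive_twist_map g \<and> f = inv g)"

definition twist_map :: "(annulus \<Rightarrow> annulus) \<Rightarrow> bool" where
  "twist_map f \<longleftrightarrow> positive_twist_map f \<or> negative_twist_map f"

type_synonym one_form = "annulus \<Rightarrow> real \<times> real \<Rightarrow> real"

definition liouville_form :: one_form where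
  "liouville_form x v = snd x * fst v"

definition pullback_form :: "(annulus \<Rightarrow> annulus) \<Rightarrow> one_form \<Rightarrow> one_form" where
  "pullback_form f \<omega> x v = \<omega> (f x) (tangent_map f x v)"

text \<open>The primitive is a function on the annulus itself, not merely on its universal cover.\<close>

definition exact_form :: "one_form \<Rightarrow> bool" where
  "exact_form \<omega> \<longleftrightarrow>
     (\<exists>S :: annulus \<Rightarrow> real. \<forall>z. ((\<lambda>w. S (ann_proj w)) has_derivative \<omega> (ann_proj z)) (at z))"

definition exact_symplectic :: "(annulus \<Rightarrow> annulus) \<Rightarrow> bool" where
  "exact_symplectic f \<longleftrightarrow>
     exact_form (\<lambda>x v. pullback_form f liouville_form x v - liouville_form x v)"


section \<open>Aubry-Mather sets and rotation numbers\<close>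

definition f_ordered :: "(annulus \<Rightarrow> annulus) \<Rightarrow> annulus set \<Rightarrow> bool" where
  "f_ordered f M \<longleftrightarrow> M \<noteq> {} \<and> compact M \<and> f ` M = M \<and>
     (\<forall>F. is_lift f F \<longrightarrow>
        (\<forall>z \<in> ann_proj -` M. \<forall>z' \<in> ann_proj -` M. fst z < fst z' \<longleftrightarrow> fst (F z) < fst (F z')))"

definition Aubry_Mather_set :: "(annulus \<Rightarrow> annulus) \<Rightarrow> annulus set \<Rightarrow> bool" where
  "Aubry_Mather_set f M \<longleftrightarrow> f_ordered f M \<and> (\<forall>N. f_ordered f N \<and> N \<subseteq> M \<longrightarrow> N = M)"

definition bi_lipschitz_homeo :: "('a :: metric_space \<Rightarrow> 'b :: metric_space) \<Rightarrow> bool" where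
  "bi_lipschitz_homeo h \<longleftrightarrow>
     bij h \<and> (\<exists>C. C-lipschitz_on UNIV h) \<and> (\<exists>C. C-lipschitz_on UNIV (inv h))"

definition is_circle_lift :: "(circle \<Rightarrow> circle) \<Rightarrow> (real \<Rightarrow> real) \<Rightarrow> bool" where
  "is_circle_lift h H \<longleftrightarrow> continuous_on UNIV H \<and> (\<forall>t. circle_proj (H t) = h (circle_proj t))"

text \<open>For a lift of an orientation preserving circle homeomorphism the limit exists and does
  not depend on the starting point \<open>0\<close>.\<close>

definition lift_rotation_number :: "(real \<Rightarrow> real) \<Rightarrow> real" where
  "lift_rotation_number H = lim (\<lambda>n. (H ^^ n) 0 / real n)"

text \<open>
  Here \<open>F\<close> is a lift of \<open>f\<close>. A lift of a circle homeomorphism is strictly monotone, and it is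
  increasing exactly when the homeomorphism preserves the orientation.
\<close>

definition rotation_number ::
  "(annulus \<Rightarrow> annulus) \<Rightarrow> annulus set \<Rightarrow> (real \<times> real \<Rightarrow> real \<times> real) \<Rightarrow> real" where
  "rotation_number f M F = (THE \<rho>. \<exists>h H.
     bi_lipschitz_homeo h \<and> is_circle_lift h H \<and> strict_mono H \<and>
     (\<forall>x \<in> M. fst (f x) = h (fst x)) \<and>
     (\<forall>z \<in> ann_proj -` M. H (fst z) = fst (F z)) \<and>
     \<rho> = lift_rotation_number H)"

definition irrational_set :: "(annulus \<Rightarrow> annulus) \<Rightarrow> annulus set \<Rightarrow> bool" where
  "irrational_set f M \<longleftrightarrow> (\<forall>F. is_lift f F \<longrightarrow> rotation_number f M F \<notin> \<rat>)"


section \<open>Paratingent cones and regularity\<close>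

definition ann_diff :: "annulus \<Rightarrow> annulus \<Rightarrow> real \<times> real" where
  "ann_diff x y = (THE v. fst v \<in> {-1/2 ..< 1/2} \<and>
     (\<exists>z w. ann_proj z = x \<and> ann_proj w = y \<and> v = z - w))"

definition paratingent_cone :: "annulus set \<Rightarrow> annulus \<Rightarrow> (real \<times> real) set" where
  "paratingent_cone M x = {v. \<exists>(a :: nat \<Rightarrow> annulus) b (t :: nat \<Rightarrow> real).
     (\<forall>n. a n \<in> M) \<and> (\<forall>n. b n \<in> M) \<and> a \<longlonglongrightarrow> x \<and> b \<longlonglongrightarrow> x \<and>
     (\<forall>n. t n > 0) \<and> t \<longlonglongrightarrow> 0 \<and>
     (\<lambda>n. ann_diff (a n) (b n) /\<^sub>R t n) \<longlonglongrightarrow> v}"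

definition C1_regular_at :: "annulus set \<Rightarrow> annulus \<Rightarrow> bool" where
  "C1_regular_at M x \<longleftrightarrow>
     (\<exists>D :: (real \<times> real) set. subspace D \<and> dim D = 1 \<and> paratingent_cone M x \<subseteq> D)"


section \<open>Uniform hyperbolicity\<close>

text \<open>A subbundle is continuous if it has a continuous frame near every point of the base.\<close>

definition continuous_subbundle ::
  "'a :: topological_space set \<Rightarrow> ('a \<Rightarrow> 'b :: real_normed_vector set) \<Rightarrow> bool" where
  "continuous_subbundle M E \<longleftrightarrow> (\<forall>x \<in> M. \<exists>U k. \<exists>b :: nat \<Rightarrow> 'a \<Rightarrow> 'b.
     open U \<and> x \<in> U \<and> (\<forall>i<k. continuous_on (M \<inter> U) (b i)) \<and>
     (\<forall>y \<in> M \<inter> U. inj_on (\<lambda>i. b i y) {..<k} \<and> independent ((\<lambda>i. b i y) ` {..<k}) \<and>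
        E y = span ((\<lambda>i. b i y) ` {..<k})))"

definition uniformly_hyperbolic :: "(annulus \<Rightarrow> annulus) \<Rightarrow> annulus set \<Rightarrow> bool" where
  "uniformly_hyperbolic f M \<longleftrightarrow> compact M \<and> f ` M = M \<and>
     (\<exists>Es Eu. \<exists>C>0. \<exists>\<mu>. 0 < \<mu> \<and> \<mu> < 1 \<and>
        continuous_subbundle M Es \<and> continuous_subbundle M Eu \<and>
        (\<forall>x \<in> M.
           subspace (Es x) \<and> subspace (Eu x) \<and>
           Es x \<inter> Eu x = {0} \<and> {u + v |u v. u \<in> Es x \<and> v \<in> Eu x} = UNIV \<and>
           tangent_map f x ` Es x = Es (f x) \<and> tangent_map f x ` Eu x = Eu (f x) \<and>
           (\<forall>n. \<forall>v \<in> Es x. norm (tangent_map (f ^^ n) x v) \<le> C * \<mu> ^ n * norm v) \<and>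
           (\<forall>n. \<forall>v \<in> Eu x. norm (tangent_map (inv f ^^ n) x v) \<le> C * \<mu> ^ n * norm v)))"

end

theory Submission
  imports Defs
begin

text \<open>
  Everything is done on the lift \<open>A = p\<^sup>-\<^sup>1(M)\<close> in the plane. Because \<open>f\<close> twists and preserves the order
  of \<open>A\<close>, no paratingent cone of \<open>A\<close> contains a vertical vector.

  (i) to (ii): at every point the slopes of the cone form a compact set with minimum \<open>s\<close> strictly below
  the maximum \<open>u\<close>; both directions are invariant, with positive growth factors \<open>g\<^sub>s < g\<^sub>u\<close>. Exactness
  gives \<open>det Df = 1\<close>, that is \<open>g\<^sub>s g\<^sub>u w(f x) = w(x)\<close> for the width \<open>w = u - s\<close>. The width is upper
  semicontinuous, so by the Baire property and minimality it is bounded below. Hence the products of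
  \<open>g\<^sub>s g\<^sub>u\<close> along orbits stay bounded while those of \<open>g\<^sub>u / g\<^sub>s\<close> grow exponentially, which is hyperbolicity.

  (ii) to (i): a hyperbolic set is expansive, so some pair of distinct points of \<open>A\<close> is asymptotic in the
  past or in the future. A point of \<open>A\<close> strictly between them would, by minimality, yield a periodic point,
  which the irrational rotation number excludes; so the pair bounds a gap. The iterates of a gap are disjoint
  modulo translations, hence the pair is asymptotic in both directions. Rescaling the differences at record
  times puts a stable and an unstable vector into every cone, so no cone lies in a line.
\<close>

text \<open>As \<open>f\<close> is only C1, the form whose exactness is assumed is merely continuous
  and cannot be differentiated; area preservation has to be read off from its first order expansion
  at one point. The exponential rate has a concrete source: the growth factor of
  \<open>(1, s)\<close> is affine in \<open>s\<close> with leading coefficient the twist, so the two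
  extreme factors differ by width times twist, while the smaller one is bounded above. This is why
  the width needs a uniform lower bound before any rate appears. The extreme slopes are at first
  only semicontinuous; their continuity comes last, because preservation of area leaves room for one
  contracted direction only. Periodic points need care because \<open>rotation_number\<close> is a
  definite description: on a periodic orbit a bi-Lipschitz homeomorphism must be constructed before
  the value can be computed. Positive and negative twist, future and past are interchanged by
  swapping \<open>F\<close> with \<open>G\<close>, so every notion is kept symmetric in the
  two.\<close>

lemma strict_derivative_sequentially:
  fixes g :: "'a::real_normed_vector \<Rightarrow> 'b::real_normed_vector"
  assumes der: "\<And>z. (g has_derivative blinfun_apply (g' z)) (at z)"
    and cont: "continuous_on UNIV g'"
    and a: "a \<longlonglongrightarrow> z" and b: "b \<longlonglongrightarrow> z"
    and v: "(\<lambda>k. (a k - b k) /\<^sub>R t k) \<longlonglongrightarrow> v"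
  shows "(\<lambda>k. (g (a k) - g (b k)) /\<^sub>R t k) \<longlonglongrightarrow> g' z v"
proof -
  have lim: "(\<lambda>k. blinfun_apply (g' z) ((a k - b k) /\<^sub>R t k)) \<longlonglongrightarrow> g' z v"
    by (intro tendsto_intros v)
  have "(\<lambda>k. (g (a k) - g (b k)) /\<^sub>R t k - g' z ((a k - b k) /\<^sub>R t k)) \<longlonglongrightarrow> 0"
  proof (rule LIMSEQ_I)
    fix e :: real assume "e > 0"
    \<comment> \<open>Chosen so that \<open>c * (norm v + 1)\<close> is \<open>e / 2\<close>; the
      rescaled differences eventually have norm below \<open>norm v + 1\<close>.\<close>
    define c where "c = e / 2 / (norm v + 1)"
    have "c > 0" using \<open>e > 0\<close> by (auto simp: c_def intro!: divide_pos_pos add_nonneg_pos)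
    have "isCont g' z" using cont by (simp add: continuous_on_eq_continuous_at)
    then obtain d where "d > 0" and d: "\<And>y. dist y z < d \<Longrightarrow> dist (g' y) (g' z) < c"
      using \<open>c > 0\<close> unfolding continuous_at_eps_delta by metis
    \<comment> \<open>A C1 map is strictly differentiable: the mean value inequality for
      \<open>g\<close> minus its linear part at \<open>z\<close> lets both points move, where
      differentiability at \<open>z\<close> alone would fix one of them.\<close>
    have bound: "norm (g p - g q - g' z (p - q)) \<le> norm (p - q) * c"
      if "p \<in> ball z d" "q \<in> ball z d" for p q
    proof (rule differentiable_bound_linearization[where S = "ball z d" and f' = "\<lambda>x. blinfun_apply (g' x)"])
      show "q + s *\<^sub>R (p - q) \<in> ball z d" if "s \<in> {0..1}" for s
        using convexD_alt[OF convex_ball \<open>q \<in> ball z d\<close> \<open>p \<in> ball z d\<close>, of s] that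
        by (simp add: algebra_simps)
      show "(g has_derivative blinfun_apply (g' x)) (at x within ball z d)" for x
        using der by (rule has_derivative_at_withinI)
      show "onorm (blinfun_apply (g' x) - blinfun_apply (g' z)) \<le> c" if "x \<in> ball z d" for x
      proof -
        have "onorm (blinfun_apply (g' x - g' z)) \<le> c"
          using d[of x] that by (simp add: norm_blinfun.rep_eq[symmetric] dist_norm dist_commute less_imp_le norm_minus_commute)
        then show ?thesis by (simp add: minus_blinfun.rep_eq fun_diff_def)
      qed
      show "z \<in> ball z d" using \<open>d > 0\<close> by simp
    qed
    have "(\<lambda>k. norm ((a k - b k) /\<^sub>R t k)) \<longlonglongrightarrow> norm v" by (intro tendsto_intros v)
    then have "\<forall>\<^sub>F k in sequentially. norm ((a k - b k) /\<^sub>R t k) < norm v + 1"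
      by (rule order_tendstoD) simp
    moreover have "\<forall>\<^sub>F k in sequentially. a k \<in> ball z d"
      using tendstoD[OF a \<open>d > 0\<close>] by (simp add: dist_commute)
    moreover have "\<forall>\<^sub>F k in sequentially. b k \<in> ball z d"
      using tendstoD[OF b \<open>d > 0\<close>] by (simp add: dist_commute)
    ultimately have "\<forall>\<^sub>F k in sequentially.
        norm ((g (a k) - g (b k)) /\<^sub>R t k - g' z ((a k - b k) /\<^sub>R t k) - 0) < e"
    proof eventually_elim
      case (elim k)
      have "(g (a k) - g (b k)) /\<^sub>R t k - g' z ((a k - b k) /\<^sub>R t k)
          = (g (a k) - g (b k) - g' z (a k - b k)) /\<^sub>R t k"
        unfolding blinfun.scaleR_right by (simp only: scaleR_diff_right)
      then have "norm ((g (a k) - g (b k)) /\<^sub>R t k - g' z ((a k - b k) /\<^sub>R t k))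
          = norm (g (a k) - g (b k) - g' z (a k - b k)) * \<bar>inverse (t k)\<bar>"
        by simp
      also have "\<dots> \<le> (norm (a k - b k) * c) * \<bar>inverse (t k)\<bar>"
        using bound[OF elim(2,3)] by (rule mult_right_mono) simp
      also have "\<dots> = c * norm ((a k - b k) /\<^sub>R t k)" by simp
      also have "\<dots> \<le> c * (norm v + 1)" using elim(1) \<open>c > 0\<close> by simp
      also have "\<dots> = e / 2" 
      proof -
        have "norm v + 1 \<noteq> 0" using norm_ge_zero[of v] by linarith
        then show ?thesis unfolding c_def by (rule nonzero_eq_divide_eq[THEN iffD1]) simp
      qed
      also have "\<dots> < e" using \<open>e > 0\<close> by simp
      finally show ?case by simp
    qed
    then show "\<exists>no. \<forall>k\<ge>no. norm ((g (a k) - g (b k)) /\<^sub>R t k - g' z ((a k - b k) /\<^sub>R t k) - 0) < e"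
      by (simp add: eventually_sequentially)
  qed
  from tendsto_add[OF this lim] show ?thesis by simp
qed

text \<open>
  The form need not be differentiable near \<open>z\<close>; integrating its expansion at \<open>z\<close> along the
  edges of a small triangle already forces the symmetry of the linear part.
\<close>

lemma exact_form_linear_part_symmetric:
  fixes T :: "'a::real_normed_vector \<Rightarrow> real"
  assumes der: "\<And>w. (T has_derivative \<tau> w) (at w)"
    and B: "bilinear B"
    and expansion: "\<And>e. e > 0 \<Longrightarrow>
      \<exists>d>0. \<forall>w. norm (w - z) < d \<longrightarrow> (\<forall>v. \<bar>\<tau> w v - B (w - z) v\<bar> \<le> e * norm (w - z) * norm v)"
  shows "B u v = B v u"
proof -
  define m where "m = norm u + norm v + 1"
  have m: "m > 0" unfolding m_def by (intro add_nonneg_pos add_nonneg_nonneg) auto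
  have Bs: "B (x + y) c = B x c + B y c" "B (r *\<^sub>R x) c = r * B x c"
    "B c (x + y) = B c x + B c y" "B c (r *\<^sub>R x) = r * B c x" 
    "B (x - y) c = B x c - B y c" "B c (x - y) = B c x - B c y" "B 0 c = 0" for x y c r
    using B by (simp_all add: bilinear_ladd bilinear_lmul bilinear_radd bilinear_rmul
        bilinear_lsub bilinear_rsub bilinear_lzero)
  have small: "\<bar>B u v - B v u\<bar> \<le> 6 * m\<^sup>2 * e" if "e > 0" for e
  proof -
    obtain d where "d > 0" and d: "\<And>w v. norm (w - z) < d \<Longrightarrow>
        \<bar>\<tau> w v - B (w - z) v\<bar> \<le> e * norm (w - z) * norm v"
      using expansion[OF \<open>e > 0\<close>] by blast
    \<comment> \<open>The triangle with vertices \<open>0\<close>, \<open>h u\<close>,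
      \<open>h (u + v)\<close>, placed at \<open>z\<close>, then stays within distance
      \<open>d / 2\<close>.\<close>
    define h where "h = d / (2 * m)"
    have h: "h > 0" "h * m < d" using \<open>d > 0\<close> m by (simp_all add: h_def)
    \<comment> \<open>The subtracted term is the integral over \<open>s\<close> in
      \<open>[0, 1]\<close> of \<open>B (h (p + s q)) (h q)\<close>, so the left side is the error
      of replacing \<tau> by its linear part along one edge.\<close>
    have edge: "\<bar>T (z + h *\<^sub>R (p + q)) - T (z + h *\<^sub>R p) - h\<^sup>2 * (B p q + B q q / 2)\<bar> \<le> e * h\<^sup>2 * m\<^sup>2"
      if pq: "\<And>s. s \<in> {0..1} \<Longrightarrow> norm (p + s *\<^sub>R q) \<le> m" "norm q \<le> m" for p q
    proof -
      define \<phi> where "\<phi> s = T (z + h *\<^sub>R (p + s *\<^sub>R q)) - h\<^sup>2 * (s * B p q + s\<^sup>2 * B q q / 2)" for s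
      have "norm (\<phi> 1 - \<phi> 0) \<le> (e * h\<^sup>2 * m\<^sup>2) * norm (1 - 0 :: real)"
      proof (rule differentiable_bound[where S = "{0..1}" and
            f' = "\<lambda>s r. r * (\<tau> (z + h *\<^sub>R (p + s *\<^sub>R q)) (h *\<^sub>R q) - h\<^sup>2 * (B p q + s * B q q))"])
        show "convex {0..1::real}" by (rule convex_real_interval)
        fix s :: real assume s: "s \<in> {0..1}"
        let ?w = "z + h *\<^sub>R (p + s *\<^sub>R q)"
        have lin: "linear (\<tau> ?w)" using der has_derivative_linear by blast
        have "((\<lambda>s. T (z + h *\<^sub>R (p + s *\<^sub>R q))) has_derivative (\<lambda>r. \<tau> ?w (h *\<^sub>R (r *\<^sub>R q)))) (at s within {0..1})"
          by (rule has_derivative_compose[OF _ der]) (auto intro!: derivative_eq_intros)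
        then have "((\<lambda>s. T (z + h *\<^sub>R (p + s *\<^sub>R q))) has_derivative (\<lambda>r. r * \<tau> ?w (h *\<^sub>R q))) (at s within {0..1})"
          by (simp add: linear_scale[OF lin] mult_ac)
        then show "(\<phi> has_derivative (\<lambda>r. r * (\<tau> ?w (h *\<^sub>R q) - h\<^sup>2 * (B p q + s * B q q)))) (at s within {0..1})"
          unfolding \<phi>_def by (auto intro!: derivative_eq_intros simp: algebra_simps)
        have eq: "h\<^sup>2 * (B p q + s * B q q) = B (?w - z) (h *\<^sub>R q)"
          by (simp add: Bs power2_eq_square algebra_simps)
        have nw: "norm (?w - z) \<le> h * m"
          using pq(1)[OF s] h(1) by simp
        have "\<bar>\<tau> ?w (h *\<^sub>R q) - B (?w - z) (h *\<^sub>R q)\<bar> \<le> e * norm (?w - z) * norm (h *\<^sub>R q)"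
          by (rule d) (use nw h in linarith)
        also have "\<dots> \<le> e * (h * m) * (h * m)"
          using nw pq(2) h(1) \<open>e > 0\<close> m by (intro mult_mono) auto
        finally have le: "\<bar>\<tau> ?w (h *\<^sub>R q) - h\<^sup>2 * (B p q + s * B q q)\<bar> \<le> e * h\<^sup>2 * m\<^sup>2"
          unfolding eq by (simp add: power2_eq_square mult_ac)
        show "onorm (\<lambda>r. r * (\<tau> ?w (h *\<^sub>R q) - h\<^sup>2 * (B p q + s * B q q))) \<le> e * h\<^sup>2 * m\<^sup>2"
        proof (rule onorm_bound)
          show "0 \<le> e * h\<^sup>2 * m\<^sup>2" using \<open>e > 0\<close> by simp
          show "norm (r * (\<tau> ?w (h *\<^sub>R q) - h\<^sup>2 * (B p q + s * B q q))) \<le> e * h\<^sup>2 * m\<^sup>2 * norm r" for r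
            using mult_left_mono[OF le, of "\<bar>r\<bar>"] by (simp add: abs_mult mult_ac)
        qed
      qed auto
      then show ?thesis by (simp add: \<phi>_def algebra_simps)
    qed
    have 1: "\<bar>T (z + h *\<^sub>R (0 + u)) - T (z + h *\<^sub>R 0) - h\<^sup>2 * (B 0 u + B u u / 2)\<bar> \<le> e * h\<^sup>2 * m\<^sup>2"
    proof (rule edge)
      show "norm (0 + s *\<^sub>R u) \<le> m" if "s \<in> {0..1}" for s
      proof -
        have "s * norm u \<le> norm u" using that by (simp add: mult_left_le_one_le)
        moreover have "norm u \<le> m" by (simp add: m_def)
        ultimately show ?thesis using that by simp
      qed
    qed (simp add: m_def)
    have 2: "\<bar>T (z + h *\<^sub>R (u + v)) - T (z + h *\<^sub>R u) - h\<^sup>2 * (B u v + B v v / 2)\<bar> \<le> e * h\<^sup>2 * m\<^sup>2"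
    proof (rule edge)
      show "norm (u + s *\<^sub>R v) \<le> m" if "s \<in> {0..1}" for s
        using that mult_left_le_one_le[of "norm v" s] norm_triangle_ineq[of u "s *\<^sub>R v"] by (simp add: m_def)
    qed (simp add: m_def)
    have 3: "\<bar>T (z + h *\<^sub>R (0 + (u + v))) - T (z + h *\<^sub>R 0) - h\<^sup>2 * (B 0 (u + v) + B (u + v) (u + v) / 2)\<bar> \<le> e * h\<^sup>2 * m\<^sup>2"
    proof (rule edge)
      have "norm (u + v) \<le> m" using norm_triangle_ineq[of u v] by (simp add: m_def)
      then show "norm (0 + s *\<^sub>R (u + v)) \<le> m" if "s \<in> {0..1}" for s
        using that mult_left_le_one_le[of "norm (u + v)" s] by simp
      show "norm (u + v) \<le> m" by fact
    qed
    \<comment> \<open>The values of \<open>T\<close> cancel around the triangle, and what the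
      quadratic terms leave is the antisymmetric part of \<open>B\<close>. Both sides scale like
      \<open>h\<^sup>2\<close>, so the bound survives the division.\<close>
    have "h\<^sup>2 * ((B u v - B v u) / 2) = (T (z + h *\<^sub>R (0 + (u + v))) - T (z + h *\<^sub>R 0) - h\<^sup>2 * (B 0 (u + v) + B (u + v) (u + v) / 2))
       - (T (z + h *\<^sub>R (0 + u)) - T (z + h *\<^sub>R 0) - h\<^sup>2 * (B 0 u + B u u / 2))
       - (T (z + h *\<^sub>R (u + v)) - T (z + h *\<^sub>R u) - h\<^sup>2 * (B u v + B v v / 2))"
      by (simp add: Bs field_simps)
    with 1 2 3 have "\<bar>h\<^sup>2 * ((B u v - B v u) / 2)\<bar> \<le> 3 * (e * h\<^sup>2 * m\<^sup>2)" by linarith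
    then have "h\<^sup>2 * (\<bar>B u v - B v u\<bar> / 2) \<le> h\<^sup>2 * (3 * e * m\<^sup>2)" by (simp add: abs_mult mult_ac)
    then have "\<bar>B u v - B v u\<bar> / 2 \<le> 3 * e * m\<^sup>2"
      using h(1) by (simp add: mult_le_cancel_left)
    then show ?thesis by (simp add: mult_ac)
  qed
  have "\<bar>B u v - B v u\<bar> \<le> 0"
  proof (rule field_le_epsilon)
    fix e :: real assume "e > 0"
    have "\<bar>B u v - B v u\<bar> \<le> 6 * m\<^sup>2 * (e / (6 * m\<^sup>2))"
      using small[of "e / (6 * m\<^sup>2)"] \<open>e > 0\<close> m by simp
    then show "\<bar>B u v - B v u\<bar> \<le> 0 + e" using m by simp
  qed
  then show ?thesis by simp
qed

section \<open>Lifts and paratingent cones\<close>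

declare split_paired_All [simp del] split_paired_Ex [simp del]

text \<open>The deck transformations of \<open>ann_proj\<close>.\<close>

definition shift :: "int \<Rightarrow> real \<times> real \<Rightarrow> real \<times> real" where
  "shift m z = z + (of_int m, 0)"

lemma fst_shift [simp]: "fst (shift m z) = fst z + of_int m"
  and snd_shift [simp]: "snd (shift m z) = snd z"
  and shift_shift [simp]: "shift m (shift n z) = shift (m + n) z"
  and shift_0 [simp]: "shift 0 z = z"
  and shift_diff_shift [simp]: "shift m z - shift m w = z - w"
  and dist_shift [simp]: "dist (shift m z) (shift m w) = dist z w"
  by (auto simp: shift_def prod_eq_iff dist_norm)

lemma tendsto_shift [tendsto_intros]: "(f \<longlongrightarrow> l) X \<Longrightarrow> ((\<lambda>x. shift m (f x)) \<longlongrightarrow> shift m l) X"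
  unfolding shift_def by (intro tendsto_intros)

lemma ann_proj_shift [simp]: "ann_proj (shift m z) = ann_proj z"
  by (simp add: ann_proj_eq_iff)

lemma ann_proj_eqE:
  assumes "ann_proj z = ann_proj w" obtains m where "z = shift m w"
proof -
  from assms have "fst z - fst w \<in> \<int>" "snd z = snd w" by (auto simp: ann_proj_eq_iff)
  then obtain m :: int where "fst z - fst w = of_int m" by (auto elim: Ints_cases)
  with \<open>snd z = snd w\<close> have "z = shift m w" by (simp add: prod_eq_iff)
  then show thesis by (rule that)
qed

text \<open>Stated with one \<open>e\<close> for all quantities rather than with sequences, so that
  closedness under limits is a triangle inequality; the next two lemmas give the sequential
  form.\<close>

definition ptg_cone :: "(real \<times> real) set \<Rightarrow> real \<times> real \<Rightarrow> (real \<times> real) set" where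
  "ptg_cone A z = {v. \<forall>e>0. \<exists>a\<in>A. \<exists>b\<in>A. \<exists>t. 0 < t \<and> t < e \<and> dist a z < e \<and> dist b z < e \<and>
     dist ((a - b) /\<^sub>R t) v < e}"

lemma ptg_cone_sequentially:
  assumes "v \<in> ptg_cone A z"
  obtains a b t where "\<And>n::nat. a n \<in> A" "\<And>n. b n \<in> A" "\<And>n. (t n :: real) > 0"
    "a \<longlonglongrightarrow> z" "b \<longlonglongrightarrow> z" "t \<longlonglongrightarrow> 0" "(\<lambda>n. (a n - b n) /\<^sub>R t n) \<longlonglongrightarrow> v"
proof -
  have "\<forall>n. \<exists>a b t. a \<in> A \<and> b \<in> A \<and> 0 < t \<and> t < inverse (Suc n) \<and> dist a z < inverse (Suc n) \<and>
     dist b z < inverse (Suc n) \<and> dist ((a - b) /\<^sub>R t) v < inverse (Suc n)"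
  proof
    fix n
    have "inverse (real (Suc n)) > 0" by simp
    with assms show "\<exists>a b t. a \<in> A \<and> b \<in> A \<and> 0 < t \<and> t < inverse (Suc n) \<and> dist a z < inverse (Suc n) \<and>
       dist b z < inverse (Suc n) \<and> dist ((a - b) /\<^sub>R t) v < inverse (Suc n)"
      unfolding ptg_cone_def by blast
  qed
  then obtain a b t where *: "\<And>n. a n \<in> A" "\<And>n. b n \<in> A" "\<And>n. 0 < t n" 
    "\<And>n. t n < inverse (Suc n)" "\<And>n. dist (a n) z < inverse (Suc n)"
     "\<And>n. dist (b n) z < inverse (Suc n)" "\<And>n. dist ((a n - b n) /\<^sub>R t n) v < inverse (Suc n)"
    by metis
  have inv: "(\<lambda>n. inverse (real (Suc n))) \<longlonglongrightarrow> 0" by (rule LIMSEQ_inverse_real_of_nat)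
  show thesis
  proof (rule that[OF *(1,2,3)])
    show "a \<longlonglongrightarrow> z"
      by (rule tendsto_dist_iff[THEN iffD2], rule tendsto_sandwich[OF _ _ tendsto_const inv])
        (auto intro!: always_eventually less_imp_le * simp del: of_nat_Suc)
    show "b \<longlonglongrightarrow> z"
      by (rule tendsto_dist_iff[THEN iffD2], rule tendsto_sandwich[OF _ _ tendsto_const inv])
        (auto intro!: always_eventually less_imp_le * simp del: of_nat_Suc)
    show "t \<longlonglongrightarrow> 0"
      by (rule tendsto_sandwich[OF _ _ tendsto_const inv])
        (auto intro!: always_eventually less_imp_le * simp del: of_nat_Suc)
    show "(\<lambda>n. (a n - b n) /\<^sub>R t n) \<longlonglongrightarrow> v"
      by (rule tendsto_dist_iff[THEN iffD2], rule tendsto_sandwich[OF _ _ tendsto_const inv])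
        (intro always_eventually allI less_imp_le * zero_le_dist)+
  qed
qed

lemma ptg_cone_limitI:
  assumes "\<And>n::nat. a n \<in> A" "\<And>n. b n \<in> A" "\<And>n. (t n :: real) > 0"
    "a \<longlonglongrightarrow> z" "b \<longlonglongrightarrow> z" "t \<longlonglongrightarrow> 0" "(\<lambda>n. (a n - b n) /\<^sub>R t n) \<longlonglongrightarrow> v"
  shows "v \<in> ptg_cone A z"
  unfolding ptg_cone_def
proof (intro CollectI allI impI)
  fix e :: real assume "e > 0"
  have "\<forall>\<^sub>F n in sequentially. t n < e" using assms(6) \<open>e > 0\<close> by (rule order_tendstoD)
  moreover note tendstoD[OF assms(4) \<open>e > 0\<close>] tendstoD[OF assms(5) \<open>e > 0\<close>] tendstoD[OF assms(7) \<open>e > 0\<close>]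
  ultimately have "\<forall>\<^sub>F n in sequentially. t n < e \<and> dist (a n) z < e \<and> dist (b n) z < e \<and>
     dist ((a n - b n) /\<^sub>R t n) v < e"
    by eventually_elim auto
  then obtain n where "t n < e" "dist (a n) z < e" "dist (b n) z < e"
     "dist ((a n - b n) /\<^sub>R t n) v < e"
    by (auto dest!: eventually_happens)
  with assms(1-3) show "\<exists>a\<in>A. \<exists>b\<in>A. \<exists>t>0. t < e \<and> dist a z < e \<and> dist b z < e \<and> dist ((a - b) /\<^sub>R t) v < e"
    by blast
qed

lemma ptg_cone_closed_graph:
  assumes "\<And>k::nat. v k \<in> ptg_cone A (z k)" "z \<longlonglongrightarrow> z0" "v \<longlonglongrightarrow> v0"
  shows "v0 \<in> ptg_cone A z0"
  unfolding ptg_cone_def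
proof (intro CollectI allI impI)
  fix e :: real assume "e > 0"
  then have e: "e / 2 > 0" by simp
  have "\<forall>\<^sub>F k in sequentially. dist (z k) z0 < e / 2 \<and> dist (v k) v0 < e / 2"
    using tendstoD[OF assms(2) e] tendstoD[OF assms(3) e] by eventually_elim auto
  then obtain k where k: "dist (z k) z0 < e / 2" "dist (v k) v0 < e / 2"
    by (auto dest!: eventually_happens)
  from assms(1)[of k] e obtain a b t where *: "a \<in> A" "b \<in> A" "0 < t" "t < e / 2" 
    "dist a (z k) < e / 2" "dist b (z k) < e / 2" "dist ((a - b) /\<^sub>R t) (v k) < e / 2"
    unfolding ptg_cone_def by blast
  have "dist a z0 < e" "dist b z0 < e" "dist ((a - b) /\<^sub>R t) v0 < e"
    using dist_triangle[of a z0 "z k"] dist_triangle[of b z0 "z k"]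
      dist_triangle[of "(a - b) /\<^sub>R t" v0 "v k"] * k by linarith+
  with * \<open>e > 0\<close> show "\<exists>a\<in>A. \<exists>b\<in>A. \<exists>t>0. t < e \<and> dist a z0 < e \<and> dist b z0 < e \<and> dist ((a - b) /\<^sub>R t) v0 < e"
    by (intro bexI[of _ a] bexI[of _ b] exI[of _ t]) auto
qed

text \<open>Rescaling \<open>t\<close> changes the length, exchanging the two sequences changes the
  sign.\<close>

lemma ptg_cone_scaleR:
  assumes v: "v \<in> ptg_cone A z"
  shows "c *\<^sub>R v \<in> ptg_cone A z"
proof -
  obtain a b t where s: "\<And>n::nat. a n \<in> A" "\<And>n. b n \<in> A" "\<And>n. (t n :: real) > 0"
    "a \<longlonglongrightarrow> z" "b \<longlonglongrightarrow> z" "t \<longlonglongrightarrow> 0" "(\<lambda>n. (a n - b n) /\<^sub>R t n) \<longlonglongrightarrow> v"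
    using v by (rule ptg_cone_sequentially) blast
  have pos: "c *\<^sub>R v \<in> ptg_cone A z" if "c > 0"
    and s: "\<And>n::nat. a n \<in> A" "\<And>n. b n \<in> A" "\<And>n. (t n :: real) > 0"
    "a \<longlonglongrightarrow> z" "b \<longlonglongrightarrow> z" "t \<longlonglongrightarrow> 0" "(\<lambda>n. (a n - b n) /\<^sub>R t n) \<longlonglongrightarrow> v" for a b t v c
  proof (rule ptg_cone_limitI[of a _ b "\<lambda>n. t n / c"])
    have "(\<lambda>n. t n / c) \<longlonglongrightarrow> 0 / c" by (intro tendsto_intros s) (use that in simp)
    then show "(\<lambda>n. t n / c) \<longlonglongrightarrow> 0" by simp
    have "(\<lambda>n. c *\<^sub>R ((a n - b n) /\<^sub>R t n)) \<longlonglongrightarrow> c *\<^sub>R v" by (intro tendsto_intros s)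
    then show "(\<lambda>n. (a n - b n) /\<^sub>R (t n / c)) \<longlonglongrightarrow> c *\<^sub>R v"
      by (simp add: divide_inverse mult.commute)
  qed (use s that in auto)
  consider "c > 0" | "c = 0" | "c < 0" by linarith
  then show ?thesis
  proof cases
    case 1
    then show ?thesis using pos s by blast
  next
    case 2
    have "(\<lambda>n. (a n - a n) /\<^sub>R t n) \<longlonglongrightarrow> 0" by simp
    from ptg_cone_limitI[OF s(1) s(1) s(3) s(4) s(4) s(6) this] 2 show ?thesis by simp
  next
    case 3
    have "(\<lambda>n. - ((a n - b n) /\<^sub>R t n)) \<longlonglongrightarrow> - v" by (intro tendsto_intros s)
    then have *: "(\<lambda>n. (b n - a n) /\<^sub>R t n) \<longlonglongrightarrow> - v" by (simp add: scaleR_diff_right)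
    have "(- c) *\<^sub>R (- v) \<in> ptg_cone A z"
      by (rule pos[OF _ s(2) s(1) s(3) s(5) s(4) s(6) *]) (use 3 in simp)
    then show ?thesis by simp
  qed
qed

section \<open>The derivative cocycle along an orbit\<close>

primrec cocycle :: "('a \<Rightarrow> 'a) \<Rightarrow> ('a \<Rightarrow> 'b::real_normed_vector \<Rightarrow>\<^sub>L 'b) \<Rightarrow> nat \<Rightarrow> 'a \<Rightarrow> 'b \<Rightarrow> 'b" where
  "cocycle F F' 0 z v = v"
| "cocycle F F' (Suc n) z v = F' ((F ^^ n) z) (cocycle F F' n z v)"

lemma cocycle_add:
  "cocycle F F' (m + n) z v = cocycle F F' m ((F ^^ n) z) (cocycle F F' n z v)"
  by (induction m) (simp_all add: funpow_add)

lemma cocycle_Suc': "cocycle F F' (Suc n) z v = cocycle F F' n (F z) (F' z v)"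
  using cocycle_add[of F F' n 1 z v] by simp

lemma cocycle_scaleR: "cocycle F F' n z (c *\<^sub>R v) = c *\<^sub>R cocycle F F' n z v"
  and cocycle_plus: "cocycle F F' n z (v + w) = cocycle F F' n z v + cocycle F F' n z w"
  and cocycle_zero [simp]: "cocycle F F' n z 0 = 0"
  by (induction n) (simp_all add: blinfun.scaleR_right blinfun.add_right)

lemma cocycle_has_derivative:
  assumes "\<And>z. (F has_derivative blinfun_apply (F' z)) (at z)"
  shows "((F ^^ n) has_derivative cocycle F F' n z) (at z)"
proof (induction n)
  case 0
  have "cocycle F F' 0 z = (\<lambda>v. v)" by (simp add: fun_eq_iff)
  then show ?case by (simp add: id_def)
next
  case (Suc n)
  have "((\<lambda>x. F ((F ^^ n) x)) has_derivative (\<lambda>v. F' ((F ^^ n) z) (cocycle F F' n z v))) (at z)"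
    by (rule has_derivative_compose[OF Suc assms])
  moreover have "cocycle F F' (Suc n) z = (\<lambda>v. F' ((F ^^ n) z) (cocycle F F' n z v))"
    by (simp add: fun_eq_iff)
  ultimately show ?case by (simp add: o_def)
qed

lemma cocycle_tendsto:
  assumes "continuous_on UNIV F" "continuous_on UNIV F'" "(z \<longlongrightarrow> z0) X" "(v \<longlongrightarrow> v0) X"
  shows "((\<lambda>k. cocycle F F' n (z k) (v k)) \<longlongrightarrow> cocycle F F' n z0 v0) X"
proof -
  have "((\<lambda>k. (F ^^ n) (z k)) \<longlongrightarrow> (F ^^ n) z0) X" for n
  proof (induction n)
    case (Suc n)
    show ?case using continuous_on_tendsto_compose[OF assms(1) Suc] by simp
  qed (simp add: assms)
  note it = this
  show ?thesis
  proof (induction n)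
    case (Suc n)
    have "((\<lambda>k. F' ((F ^^ n) (z k))) \<longlongrightarrow> F' ((F ^^ n) z0)) X"
      using continuous_on_tendsto_compose[OF assms(2) it] by simp
    from blinfun.tendsto[OF this Suc] show ?case by simp
  qed (simp add: assms)
qed

section \<open>Lifted ordered sets\<close>

text \<open>The Aubry-Mather set seen in the universal cover. Closedness, \<open>A_shift\<close> and
  \<open>A_bounded\<close> together replace compactness; \<open>graph\<close> isolates what the
  twist gives at the level of points; \<open>minimal\<close> is minimality among translation
  invariant sets. The list is symmetric in \<open>F\<close> and \<open>G\<close>, so each later
  result has a time reversed version.\<close>

locale lifted_ordered_set =
  fixes F G :: "real \<times> real \<Rightarrow> real \<times> real"
    and F' G' :: "real \<times> real \<Rightarrow> (real \<times> real) \<Rightarrow>\<^sub>L (real \<times> real)"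
    and A :: "(real \<times> real) set"
  assumes FG [simp]: "F (G z) = z" and GF [simp]: "G (F z) = z"
    and F_deriv: "(F has_derivative blinfun_apply (F' z)) (at z)"
    and G_deriv: "(G has_derivative blinfun_apply (G' z)) (at z)"
    and F'_cont: "continuous_on UNIV F'" and G'_cont: "continuous_on UNIV G'"
    and F_shift: "F (shift m z) = shift m (F z)"
    and A_closed: "closed A" and A_nonempty: "A \<noteq> {}"
    and A_shift: "z \<in> A \<Longrightarrow> shift m z \<in> A"
    and A_bounded: "\<exists>R. \<forall>z\<in>A. \<bar>snd z\<bar> \<le> R"
    and A_inv: "F ` A = A"
    and order: "z \<in> A \<Longrightarrow> w \<in> A \<Longrightarrow> fst (F z) < fst (F w) \<longleftrightarrow> fst z < fst w"
    and graph: "z \<in> A \<Longrightarrow> w \<in> A \<Longrightarrow> fst z = fst w \<Longrightarrow> z = w"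
    and minimal: "B \<subseteq> A \<Longrightarrow> closed B \<Longrightarrow> B \<noteq> {} \<Longrightarrow> (\<And>z m. z \<in> B \<Longrightarrow> shift m z \<in> B) \<Longrightarrow>
      F ` B = B \<Longrightarrow> B = A"
begin

lemma F_mem: "z \<in> A \<Longrightarrow> F z \<in> A" using A_inv by blast

lemma G_mem: "z \<in> A \<Longrightarrow> G z \<in> A" using A_inv by (metis GF imageE)

lemma G_shift: "G (shift m z) = shift m (G z)"
  by (metis FG GF F_shift)

lemma lifted_ordered_set_inverse: "lifted_ordered_set G F G' F' A"
proof
  show "G ` A = A" 
  proof (intro equalityI subsetI)
    fix z assume "z \<in> A"
    then show "z \<in> G ` A" using F_mem[of z] by (intro image_eqI[of _ _ "F z"]) simp_all
  qed (auto simp: G_mem)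
  show "fst (G z) < fst (G w) \<longleftrightarrow> fst z < fst w" if "z \<in> A" "w \<in> A" for z w
    using order[OF G_mem G_mem, of z w] that by simp
  show "B = A" if "B \<subseteq> A" "closed B" "B \<noteq> {}" "\<And>z m. z \<in> B \<Longrightarrow> shift m z \<in> B" "G ` B = B" for B
  proof (rule minimal[OF that(1-4)])
    have "F ` G ` B = B" by (simp add: image_image)
    then show "F ` B = B" by (simp only: that(5))
  qed
qed (simp_all add: F_deriv G_deriv F'_cont G'_cont G_shift A_closed A_nonempty A_shift A_bounded graph)

lemma F_cont: "continuous_on UNIV F"
  by (intro continuous_at_imp_continuous_on ballI has_derivative_continuous[OF F_deriv])

lemma iter_mem: "z \<in> A \<Longrightarrow> (F ^^ n) z \<in> A"
  by (induction n) (auto intro: F_mem)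

lemma iter_shift: "(F ^^ n) (shift m z) = shift m ((F ^^ n) z)"
  by (induction n) (auto simp: F_shift)

lemma iter_order: "z \<in> A \<Longrightarrow> w \<in> A \<Longrightarrow> fst ((F ^^ n) z) < fst ((F ^^ n) w) \<longleftrightarrow> fst z < fst w"
  by (induction n) (auto simp: order iter_mem)

lemma iter_inverse [simp]: "(F ^^ n) ((G ^^ n) z) = z" "(G ^^ n) ((F ^^ n) z) = z"
proof -
  show "(F ^^ n) ((G ^^ n) z) = z"
  proof (induction n arbitrary: z)
    case (Suc n)
    have "(F ^^ Suc n) ((G ^^ Suc n) z) = F ((F ^^ n) ((G ^^ n) (G z)))"
      by (simp add: funpow_swap1[of G n z])
    with Suc show ?case by simp
  qed simp
  show "(G ^^ n) ((F ^^ n) z) = z"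
  proof (induction n arbitrary: z)
    case (Suc n)
    have "(G ^^ Suc n) ((F ^^ Suc n) z) = G ((G ^^ n) ((F ^^ n) (F z)))"
      by (simp add: funpow_swap1[of F n z])
    with Suc show ?case by simp
  qed simp
qed

lemma F'_shift: "F' (shift m z) = F' z"
proof -
  have "((\<lambda>w. F (shift m w)) has_derivative (\<lambda>v. F' (shift m z) v)) (at z)"
    by (rule has_derivative_compose[OF _ F_deriv]) (auto intro!: derivative_eq_intros simp: shift_def)
  then have "((\<lambda>w. shift m (F w)) has_derivative (\<lambda>v. F' (shift m z) v)) (at z)"
    by (simp add: F_shift)
  moreover have "((\<lambda>w. shift m (F w)) has_derivative F' z) (at z)"
    unfolding shift_def by (auto intro!: derivative_eq_intros F_deriv)
  ultimately have "blinfun_apply (F' (shift m z)) = F' z" by (rule has_derivative_unique)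
  then show ?thesis by (simp add: blinfun_apply_inject)
qed

lemma G'_F' [simp]: "G' (F z) (F' z v) = v"
proof -
  have "((\<lambda>w. G (F w)) has_derivative (\<lambda>v. G' (F z) (F' z v))) (at z)"
    by (rule has_derivative_compose[OF F_deriv G_deriv])
  then have "((\<lambda>w. w) has_derivative (\<lambda>v. G' (F z) (F' z v))) (at z)" by simp
  from has_derivative_unique[OF this has_derivative_ident] show ?thesis by (metis)
qed

lemma F'_G' [simp]: "F' (G z) (G' z v) = v"
  using lifted_ordered_set.G'_F'[OF lifted_ordered_set_inverse] .

lemma cocycle_shift: "cocycle F F' n (shift m z) v = cocycle F F' n z v"
  by (induction n) (simp_all add: iter_shift F'_shift)

lemma cocycle_inverse: "cocycle G G' n ((F ^^ n) z) (cocycle F F' n z v) = v"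
proof (induction n)
  case (Suc n)
  have "cocycle G G' (Suc n) ((F ^^ Suc n) z) (cocycle F F' (Suc n) z v) =
    cocycle G G' n (G (F ((F ^^ n) z))) (G' (F ((F ^^ n) z)) (F' ((F ^^ n) z) (cocycle F F' n z v)))"
    by (simp only: cocycle_Suc') (simp add: cocycle_Suc'[symmetric])
  with Suc show ?case by simp
qed simp

text \<open>Every point can be translated into the strip over \<open>[0, 1]\<close>, where
  \<open>A\<close> is compact.\<close>

lemma compactness:
  assumes "\<And>k::nat. z k \<in> A"
  obtains r :: "nat \<Rightarrow> nat" and m :: "nat \<Rightarrow> int" and z0 where "strict_mono r" "z0 \<in> A"
    "(\<lambda>k. shift (m k) (z (r k))) \<longlonglongrightarrow> z0"
proof -
  obtain R where R: "\<And>z. z \<in> A \<Longrightarrow> \<bar>snd z\<bar> \<le> R" using A_bounded by blast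
  define K where "K = A \<inter> cbox (0, -R) (1, R)"
  have "compact K" unfolding K_def using A_closed by (intro closed_Int_compact compact_cbox)
  define w where "w k = shift (- \<lfloor>fst (z k)\<rfloor>) (z k)" for k
  have "w k \<in> K" for k
  proof -
    have "w k \<in> A" unfolding w_def using assms A_shift by blast
    moreover have "0 \<le> fst (w k)" "fst (w k) \<le> 1"
    proof -
      have "fst (w k) = fst (z k) - of_int \<lfloor>fst (z k)\<rfloor>" by (simp add: w_def)
      then show "0 \<le> fst (w k)" "fst (w k) \<le> 1" by linarith+
    qed
    moreover note R[OF \<open>w k \<in> A\<close>]
    ultimately show ?thesis unfolding K_def
      by (cases "w k") (auto simp: mem_box Basis_prod_def inner_prod_def)
  qed
  then obtain z0 r where *: "z0 \<in> K" "strict_mono r" "(w \<circ> r) \<longlonglongrightarrow> z0"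
    using \<open>compact K\<close> unfolding compact_def by metis
  show thesis
    by (rule that[of r z0 "\<lambda>k. - \<lfloor>fst (z (r k))\<rfloor>"]) (use * in \<open>auto simp: K_def w_def o_def\<close>)
qed

lemma F'_bound: obtains L where "L > 0" "\<And>z v. z \<in> A \<Longrightarrow> norm (F' z v) \<le> L * norm v"
proof -
  have "\<exists>L. \<forall>z\<in>A. norm (F' z) \<le> L"
  proof (rule ccontr)
    assume "\<not> ?thesis"
    then have "\<forall>k::nat. \<exists>z\<in>A. norm (F' z) > real k" by (meson not_le)
    then obtain z where z: "\<And>k. z k \<in> A" "\<And>k. norm (F' (z k)) > real k" by metis
    obtain r m z0 where r: "strict_mono r" "(\<lambda>k. shift (m k) (z (r k))) \<longlonglongrightarrow> z0"
      using compactness[of z] z(1) by metis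
    have "(\<lambda>k. F' (shift (m k) (z (r k)))) \<longlonglongrightarrow> F' z0"
      using continuous_on_tendsto_compose[OF F'_cont r(2)] by simp
    then have "(\<lambda>k. norm (F' (z (r k)))) \<longlonglongrightarrow> norm (F' z0)"
      by (intro tendsto_norm) (simp add: F'_shift)
    then have "\<forall>\<^sub>F k in sequentially. norm (F' (z (r k))) < norm (F' z0) + 1"
      by (rule order_tendstoD) simp
    moreover have "\<forall>\<^sub>F k in sequentially. norm (F' z0) + 1 \<le> real k"
      using filterlim_real_sequentially by (simp add: filterlim_at_top)
    ultimately have "\<forall>\<^sub>F k in sequentially. False"
    proof eventually_elim
      case (elim k)
      have "real k \<le> real (r k)" using seq_suble[OF r(1), of k] by simp
      with elim z(2)[of "r k"] show ?case by linarith
    qed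
    then show False by simp
  qed
  then obtain L where L: "\<And>z. z \<in> A \<Longrightarrow> norm (F' z) \<le> L" by blast
  show thesis
  proof (rule that[of "max L 1"])
    fix z v assume "z \<in> A"
    have "norm (F' z v) \<le> norm (F' z) * norm v" by (rule norm_blinfun)
    also have "\<dots> \<le> max L 1 * norm v" using L[OF \<open>z \<in> A\<close>] by (intro mult_right_mono) auto
    finally show "norm (F' z v) \<le> max L 1 * norm v" .
  qed simp
qed

lemma iter_quotient_tendsto:
  assumes "x \<longlonglongrightarrow> z" "y \<longlonglongrightarrow> z" "(\<lambda>k. (x k - y k) /\<^sub>R t k) \<longlonglongrightarrow> v"
  shows "(\<lambda>k. ((F ^^ j) (x k) - (F ^^ j) (y k)) /\<^sub>R t k) \<longlonglongrightarrow> cocycle F F' j z v"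
proof -
  have it: "(\<lambda>k. (F ^^ j) (x k)) \<longlonglongrightarrow> (F ^^ j) z" if "x \<longlonglongrightarrow> z" for j x
  proof (induction j)
    case (Suc j)
    show ?case using continuous_on_tendsto_compose[OF F_cont Suc] by simp
  qed (simp add: that)
  show ?thesis
  proof (induction j)
    case (Suc j)
    show ?case
      using strict_derivative_sequentially[OF F_deriv F'_cont it[OF assms(1)] it[OF assms(2)] Suc] by simp
  qed (simp add: assms)
qed

lemma ptg_cone_shift: "ptg_cone A (shift m z) = ptg_cone A z"
proof -
  have "v \<in> ptg_cone A (shift m z)" if v: "v \<in> ptg_cone A z" for v m z
  proof -
    obtain a b t where s: "\<And>n::nat. a n \<in> A" "\<And>n. b n \<in> A" "\<And>n. (t n :: real) > 0"
      "a \<longlonglongrightarrow> z" "b \<longlonglongrightarrow> z" "t \<longlonglongrightarrow> 0" "(\<lambda>n. (a n - b n) /\<^sub>R t n) \<longlonglongrightarrow> v"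
      using v by (rule ptg_cone_sequentially) blast
    show ?thesis
      by (rule ptg_cone_limitI[of "\<lambda>n. shift m (a n)" _ "\<lambda>n. shift m (b n)" t])
        (use s in \<open>auto intro!: A_shift tendsto_shift\<close>)
  qed
  from this[of _ z m] this[of _ "shift m z" "- m"] show ?thesis by auto
qed

lemma ptg_cone_image: "v \<in> ptg_cone A z \<Longrightarrow> F' z v \<in> ptg_cone A (F z)"
proof -
  assume v: "v \<in> ptg_cone A z"
  obtain a b t where s: "\<And>n::nat. a n \<in> A" "\<And>n. b n \<in> A" "\<And>n. (t n :: real) > 0"
    "a \<longlonglongrightarrow> z" "b \<longlonglongrightarrow> z" "t \<longlonglongrightarrow> 0" "(\<lambda>n. (a n - b n) /\<^sub>R t n) \<longlonglongrightarrow> v"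
    using v by (rule ptg_cone_sequentially) blast
  show ?thesis
    by (rule ptg_cone_limitI[of "\<lambda>n. F (a n)" _ "\<lambda>n. F (b n)" t])
      (use s F_mem continuous_on_tendsto_compose[OF F_cont s(4)] continuous_on_tendsto_compose[OF F_cont s(5)]
       iter_quotient_tendsto[OF s(4,5,7), of 1] in auto)
qed

lemma ptg_cone_cocycle: "v \<in> ptg_cone A z \<Longrightarrow> cocycle F F' n z v \<in> ptg_cone A ((F ^^ n) z)"
  by (induction n) (auto intro: ptg_cone_image)

lemma minimal':
  assumes "B \<subseteq> A" "closed B" "B \<noteq> {}" "\<And>z m. z \<in> B \<Longrightarrow> shift m z \<in> B"
    "\<And>z. z \<in> B \<Longrightarrow> F z \<in> B" "\<And>z. z \<in> B \<Longrightarrow> G z \<in> B"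
  shows "B = A"
proof (rule minimal[OF assms(1-4)])
  show "F ` B = B"
  proof (intro equalityI subsetI)
    fix z assume "z \<in> B"
    then show "z \<in> F ` B" using assms(6)[of z] by (intro image_eqI[of _ _ "G z"]) simp_all
  qed (use assms(5) in auto)
qed

text \<open>The limit points of the orbit of \<open>x\<close> modulo translations form a closed,
  invariant and nonempty set, which by minimality is all of \<open>A\<close>.\<close>

lemma orbit_dense:
  assumes "x \<in> A" "w \<in> A" "e > 0"
  obtains j m where "j \<ge> N" "dist (shift m ((F ^^ j) x)) w < e"
proof -
  \<comment> \<open>Asking for arbitrarily late \<open>j\<close>, rather than taking the closure of
    the orbit, gives invariance under \<open>G\<close> as well: one step back from a time
    \<open>j \<ge> Suc N\<close> is still at time at least \<open>N\<close>.\<close>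
  define B where "B = {w \<in> A. \<forall>e>0. \<forall>N. \<exists>j\<ge>N. \<exists>m. dist (shift m ((F ^^ j) x)) w < e}"
  have "B = A"
  proof (rule minimal')
    show "B \<subseteq> A" by (auto simp: B_def)
    show "closed B" unfolding closed_sequential_limits
    proof (intro allI impI; elim conjE)
      fix w l assume w: "\<forall>n. w n \<in> B" and l: "w \<longlonglongrightarrow> l"
      have "l \<in> A" using w by (intro closed_sequentially[OF A_closed _ l]) (simp add: B_def)
      moreover have "\<exists>j\<ge>N. \<exists>m. dist (shift m ((F ^^ j) x)) l < e" if "e > 0" for e N
      proof -
        have "e / 2 > 0" using that by simp
        from tendstoD[OF l this] obtain n where "dist (w n) l < e / 2"
          by (auto dest!: eventually_happens)
        moreover from w \<open>e / 2 > 0\<close> obtain j m where "j \<ge> N" "dist (shift m ((F ^^ j) x)) (w n) < e / 2"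
          unfolding B_def by blast
        ultimately have "dist (shift m ((F ^^ j) x)) l < e"
          using dist_triangle[of "shift m ((F ^^ j) x)" l "w n"] by linarith
        with \<open>j \<ge> N\<close> show ?thesis by blast
      qed
      ultimately show "l \<in> B" by (simp add: B_def)
    qed
    obtain r m z0 where r: "strict_mono r" "z0 \<in> A" "(\<lambda>k. shift (m k) ((F ^^ r k) x)) \<longlonglongrightarrow> z0"
      by (rule compactness[of "\<lambda>j. (F ^^ j) x", OF iter_mem[OF \<open>x \<in> A\<close>]]) blast
    have "z0 \<in> B" unfolding B_def
    proof (intro CollectI conjI allI impI)
      fix e :: real and N :: nat assume "e > 0"
      from eventually_conj[OF tendstoD[OF r(3) this] eventually_ge_at_top[of N]]
      obtain k where "dist (shift (m k) ((F ^^ r k) x)) z0 < e" "N \<le> k"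
        by (auto dest!: eventually_happens)
      moreover have "k \<le> r k" using r(1) by (rule seq_suble)
      ultimately show "\<exists>j\<ge>N. \<exists>m. dist (shift m ((F ^^ j) x)) z0 < e" by (meson order_trans)
    qed fact
    then show "B \<noteq> {}" by blast
    show "shift n z \<in> B" if "z \<in> B" for z n
    proof -
      have "\<exists>j\<ge>N. \<exists>m. dist (shift m ((F ^^ j) x)) (shift n z) < e" if "e > 0" for e N
      proof -
        obtain j m where "j \<ge> N" "dist (shift m ((F ^^ j) x)) z < e"
          using \<open>z \<in> B\<close> \<open>e > 0\<close> unfolding B_def by blast
        then have "dist (shift (n + m) ((F ^^ j) x)) (shift n z) < e"
          by (metis dist_shift shift_shift)
        with \<open>j \<ge> N\<close> show ?thesis by blast
      qed
      with that show ?thesis by (simp add: B_def A_shift)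
    qed
    show "F z \<in> B" if "z \<in> B" for z
    proof -
      have "\<exists>j\<ge>N. \<exists>m. dist (shift m ((F ^^ j) x)) (F z) < e" if "e > 0" for e N
      proof -
        have "isCont F z" using F_deriv by (rule has_derivative_continuous)
        then obtain d where d: "d > 0" "\<And>y. dist y z < d \<Longrightarrow> dist (F y) (F z) < e"
          using \<open>e > 0\<close> unfolding continuous_at_eps_delta by metis
        obtain j m where j: "j \<ge> N" "dist (shift m ((F ^^ j) x)) z < d"
          using \<open>z \<in> B\<close> \<open>d > 0\<close> unfolding B_def by blast
        then have "dist (shift m ((F ^^ Suc j) x)) (F z) < e"
          using d(2)[OF j(2)] by (simp add: F_shift)
        with \<open>j \<ge> N\<close> show ?thesis by (meson le_SucI)
      qed
      with that show ?thesis by (simp add: B_def F_mem)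
    qed
    show "G z \<in> B" if "z \<in> B" for z
    proof -
      have "\<exists>j\<ge>N. \<exists>m. dist (shift m ((F ^^ j) x)) (G z) < e" if "e > 0" for e N
      proof -
        have "isCont G z" using G_deriv by (rule has_derivative_continuous)
        then obtain d where d: "d > 0" "\<And>y. dist y z < d \<Longrightarrow> dist (G y) (G z) < e"
          using \<open>e > 0\<close> unfolding continuous_at_eps_delta by metis
        obtain j m where j: "j \<ge> Suc N" "dist (shift m ((F ^^ j) x)) z < d"
          using \<open>z \<in> B\<close> \<open>d > 0\<close> unfolding B_def by blast
        then obtain i where i: "j = Suc i" "i \<ge> N" by (cases j) auto
        then have "dist (shift m ((F ^^ i) x)) (G z) < e"
          using d(2)[OF j(2)] by (simp add: G_shift)
        with i show ?thesis by blast
      qed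
      with that show ?thesis by (simp add: B_def G_mem)
    qed
  qed
  with assms have "w \<in> B" by simp
  then obtain j m where "j \<ge> N" "dist (shift m ((F ^^ j) x)) w < e"
    using \<open>e > 0\<close> unfolding B_def by blast
  then show thesis by (rule that)
qed

end

section \<open>Pairs of points: limits, blow-up and gaps\<close>

context lifted_ordered_set
begin

text \<open>One translation has to serve both points, since their differences are compared later. It
  is chosen for \<open>p\<close>, and the bounded distance keeps \<open>q\<close> in a bounded
  region.\<close>

lemma pair_compactness:
  assumes A: "\<And>k::nat. p k \<in> A" "\<And>k. q k \<in> A" and bound: "\<And>k. dist (p k) (q k) \<le> e"
  obtains r :: "nat \<Rightarrow> nat" and m :: "nat \<Rightarrow> int" and z w where "strict_mono r" "z \<in> A" "w \<in> A"
    "(\<lambda>k. shift (m k) (p (r k))) \<longlonglongrightarrow> z" "(\<lambda>k. shift (m k) (q (r k))) \<longlonglongrightarrow> w"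
proof -
  obtain r1 :: "nat \<Rightarrow> nat" and m1 z where r1: "strict_mono r1" "z \<in> A" "(\<lambda>k. shift (m1 k) (p (r1 k))) \<longlonglongrightarrow> z"
    using A(1) by (rule compactness)
  define q1 where "q1 k = shift (m1 k) (q (r1 k))" for k
  have "bounded (range (\<lambda>k. shift (m1 k) (p (r1 k))))"
    using r1(3) by (rule convergent_imp_bounded)
  then obtain B c where B: "\<And>k. dist c (shift (m1 k) (p (r1 k))) \<le> B"
    unfolding bounded_def by auto
  have "dist c (q1 k) \<le> B + e" for k
    using dist_triangle[of c "q1 k" "shift (m1 k) (p (r1 k))"] B[of k] bound[of "r1 k"]
    unfolding q1_def by simp
  then have "bounded (range q1)" unfolding bounded_def by blast
  then obtain w r2 where r2: "strict_mono r2" "(q1 \<circ> r2) \<longlonglongrightarrow> w"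
    using bounded_imp_convergent_subsequence by blast
  have "w \<in> A"
    by (rule closed_sequentially[OF A_closed _ r2(2)]) (simp add: q1_def A_shift A(2))
  show thesis
  proof (rule that)
    show "strict_mono (r1 \<circ> r2)" using r1(1) r2(1) by (rule strict_mono_o)
    show "(\<lambda>k. shift ((m1 \<circ> r2) k) (p ((r1 \<circ> r2) k))) \<longlonglongrightarrow> z"
      using LIMSEQ_subseq_LIMSEQ[OF r1(3) r2(1)] by (simp add: o_def)
    show "(\<lambda>k. shift ((m1 \<circ> r2) k) (q ((r1 \<circ> r2) k))) \<longlonglongrightarrow> w"
      using r2(2) by (simp add: o_def q1_def)
  qed fact+
qed

lemma iter_tendsto: "x \<longlonglongrightarrow> z \<Longrightarrow> (\<lambda>k. (F ^^ j) (x k)) \<longlonglongrightarrow> (F ^^ j) z"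
proof (induction j)
  case (Suc j)
  show ?case using continuous_on_tendsto_compose[OF F_cont Suc.IH[OF Suc.prems]] by simp
qed simp

lemma iter_dist_tendsto:
  assumes "(\<lambda>k. shift (m k) (p k)) \<longlonglongrightarrow> z" "(\<lambda>k. shift (m k) (q k)) \<longlonglongrightarrow> w"
  shows "(\<lambda>k. dist ((F ^^ j) (p k)) ((F ^^ j) (q k))) \<longlonglongrightarrow> dist ((F ^^ j) z) ((F ^^ j) w)"
  using tendsto_dist[OF iter_tendsto[OF assms(1), of j] iter_tendsto[OF assms(2), of j]]
  by (simp add: iter_shift)

text \<open>This passes from pairs of points to the derivative: the unit vectors along the
  differences subconverge, and strict differentiability then makes the rescaled differences of all
  forward and backward iterates converge along the same subsequence.\<close>

lemma blowup:
  assumes A: "\<And>k::nat. x k \<in> A" "\<And>k. y k \<in> A" "\<And>k. x k \<noteq> y k"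
    and lim: "(\<lambda>k. x k - y k) \<longlonglongrightarrow> 0"
  obtains r :: "nat \<Rightarrow> nat" and z v where "strict_mono r" "z \<in> A" "norm v = 1" "v \<in> ptg_cone A z"
    "\<And>j. (\<lambda>k. ((F ^^ j) (x (r k)) - (F ^^ j) (y (r k))) /\<^sub>R norm (x (r k) - y (r k))) \<longlonglongrightarrow> cocycle F F' j z v"
    "\<And>j. (\<lambda>k. ((G ^^ j) (x (r k)) - (G ^^ j) (y (r k))) /\<^sub>R norm (x (r k) - y (r k))) \<longlonglongrightarrow> cocycle G G' j z v"
proof -
  interpret inv: lifted_ordered_set G F G' F' A by (rule lifted_ordered_set_inverse)
  obtain r1 :: "nat \<Rightarrow> nat" and m1 z where r1: "strict_mono r1" "z \<in> A" "(\<lambda>k. shift (m1 k) (x (r1 k))) \<longlonglongrightarrow> z"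
    using A(1) by (rule compactness)
  define u where "u k = (x (r1 k) - y (r1 k)) /\<^sub>R norm (x (r1 k) - y (r1 k))" for k
  have "u k \<in> sphere 0 1" for k using A(3) by (simp add: u_def)
  then obtain v r2 where v: "v \<in> sphere 0 1" "strict_mono r2" "(u \<circ> r2) \<longlonglongrightarrow> v"
    using compact_sphere[of "0 :: real \<times> real" 1] unfolding compact_def by blast
  define r where "r = r1 \<circ> r2"
  define m where "m = m1 \<circ> r2"
  have r: "strict_mono r" unfolding r_def using r1(1) v(2) by (rule strict_mono_o)
  have X: "(\<lambda>k. shift (m k) (x (r k))) \<longlonglongrightarrow> z"
    using LIMSEQ_subseq_LIMSEQ[OF r1(3) v(2)] by (simp add: o_def r_def m_def)
  have d0: "(\<lambda>k. x (r k) - y (r k)) \<longlonglongrightarrow> 0"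
    using LIMSEQ_subseq_LIMSEQ[OF lim r] by (simp add: o_def)
  have Y: "(\<lambda>k. shift (m k) (y (r k))) \<longlonglongrightarrow> z"
  proof -
    have "(\<lambda>k. shift (m k) (x (r k)) - (x (r k) - y (r k))) \<longlonglongrightarrow> z - 0"
      by (intro tendsto_diff X d0)
    moreover have "shift (m k) (x (r k)) - (x (r k) - y (r k)) = shift (m k) (y (r k))" for k
      by (simp add: shift_def)
    ultimately show ?thesis by simp
  qed
  have V: "(\<lambda>k. (shift (m k) (x (r k)) - shift (m k) (y (r k))) /\<^sub>R norm (x (r k) - y (r k))) \<longlonglongrightarrow> v"
    using v(3) by (simp add: o_def u_def r_def)
  show thesis
  proof (rule that[OF r \<open>z \<in> A\<close>])
    show "norm v = 1" using v(1) by simp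
    show "v \<in> ptg_cone A z"
      by (rule ptg_cone_limitI[OF _ _ _ X Y tendsto_norm_zero[OF d0] V]) (use A in \<open>simp_all add: A_shift\<close>)
    show "(\<lambda>k. ((F ^^ j) (x (r k)) - (F ^^ j) (y (r k))) /\<^sub>R norm (x (r k) - y (r k))) \<longlonglongrightarrow> cocycle F F' j z v" for j
      using iter_quotient_tendsto[OF X Y V, of j] by (simp add: iter_shift)
    show "(\<lambda>k. ((G ^^ j) (x (r k)) - (G ^^ j) (y (r k))) /\<^sub>R norm (x (r k) - y (r k))) \<longlonglongrightarrow> cocycle G G' j z v" for j
      using inv.iter_quotient_tendsto[OF X Y V, of j] by (simp add: inv.iter_shift)
  qed
qed

lemma iter_uniformly_continuous:
  assumes "e > 0"
  obtains d where "d > 0"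
    "\<And>x y j. x \<in> A \<Longrightarrow> y \<in> A \<Longrightarrow> dist x y < d \<Longrightarrow> j \<le> N \<Longrightarrow> dist ((F ^^ j) x) ((F ^^ j) y) < e"
proof -
  have "\<exists>d>0. \<forall>x\<in>A. \<forall>y\<in>A. dist x y < d \<longrightarrow> dist ((F ^^ j) x) ((F ^^ j) y) < e" for j
  proof (rule ccontr)
    assume neg: "\<not> ?thesis"
    have "\<forall>k. \<exists>x\<in>A. \<exists>y\<in>A. dist x y < inverse (real (Suc k)) \<and> dist ((F ^^ j) x) ((F ^^ j) y) \<ge> e"
    proof
      fix k
      have "inverse (real (Suc k)) > 0" by simp
      with neg show "\<exists>x\<in>A. \<exists>y\<in>A. dist x y < inverse (real (Suc k)) \<and> dist ((F ^^ j) x) ((F ^^ j) y) \<ge> e"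
        by (meson not_less)
    qed
    then obtain x y where xy: "\<And>k. x k \<in> A" "\<And>k. y k \<in> A" "\<And>k. dist (x k) (y k) < inverse (real (Suc k))"
      "\<And>k. dist ((F ^^ j) (x k)) ((F ^^ j) (y k)) \<ge> e" by metis
    have one: "dist (x k) (y k) \<le> 1" for k
    proof -
      have "inverse (real (Suc k)) \<le> 1" by (simp add: field_simps)
      with xy(3)[of k] show ?thesis by linarith
    qed
    obtain r :: "nat \<Rightarrow> nat" and m z w where r: "strict_mono r" "z \<in> A" "w \<in> A"
      "(\<lambda>k. shift (m k) (x (r k))) \<longlonglongrightarrow> z" "(\<lambda>k. shift (m k) (y (r k))) \<longlonglongrightarrow> w"
      using xy(1,2) one by (rule pair_compactness)
    have "(\<lambda>k. dist (x (r k)) (y (r k))) \<longlonglongrightarrow> dist z w"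
      using iter_dist_tendsto[OF r(4,5), of 0] by simp
    moreover have "(\<lambda>k. dist (x (r k)) (y (r k))) \<longlonglongrightarrow> 0"
    proof -
      have "(\<lambda>k. dist (x k) (y k)) \<longlonglongrightarrow> 0"
        by (rule tendsto_sandwich[OF _ _ tendsto_const LIMSEQ_inverse_real_of_nat])
          (intro always_eventually allI zero_le_dist less_imp_le xy)+
      from LIMSEQ_subseq_LIMSEQ[OF this r(1)] show ?thesis by (simp add: o_def)
    qed
    ultimately have "z = w" using LIMSEQ_unique by fastforce
    then have "(\<lambda>k. dist ((F ^^ j) (x (r k))) ((F ^^ j) (y (r k)))) \<longlonglongrightarrow> 0"
      using iter_dist_tendsto[OF r(4,5), of j] by simp
    then have "e \<le> 0" by (rule LIMSEQ_le_const) (use xy(4) in auto)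
    with \<open>e > 0\<close> show False by simp
  qed
  then obtain d where d: "\<And>j. d j > 0"
    "\<And>j x y. x \<in> A \<Longrightarrow> y \<in> A \<Longrightarrow> dist x y < d j \<Longrightarrow> dist ((F ^^ j) x) ((F ^^ j) y) < e" by metis
  show thesis
  proof (rule that[of "Min (d ` {..N})"])
    show "Min (d ` {..N}) > 0" using d(1) by (subst Min_gr_iff) auto
    show "dist ((F ^^ j) x) ((F ^^ j) y) < e" if "x \<in> A" "y \<in> A" "dist x y < Min (d ` {..N})" "j \<le> N" for x y j
      using that by (intro d(2)) auto
  qed
qed

text \<open>Translated images of the gap are pairwise equal or disjoint, as no point of
  \<open>A\<close> lies inside them. If their size did not tend to 0, infinitely many could be
  translated so as to contain a common point, and two at different times would coincide, making
  \<open>z\<close> periodic modulo translations.\<close>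

lemma gap_asymptotic:
  assumes zw: "z \<in> A" "w \<in> A" "fst z < fst w"
    and gap: "\<And>a. a \<in> A \<Longrightarrow> \<not> (fst z < fst a \<and> fst a < fst w)"
    and aperiodic: "\<And>j m. j > 0 \<Longrightarrow> (F ^^ j) z \<noteq> shift m z"
  shows "(\<lambda>j. dist ((F ^^ j) z) ((F ^^ j) w)) \<longlonglongrightarrow> 0"
proof (rule ccontr)
  interpret inv: lifted_ordered_set G F G' F' A by (rule lifted_ordered_set_inverse)
  assume "\<not> ?thesis"
  then obtain e where e: "e > 0" "\<And>N. \<exists>j\<ge>N. dist ((F ^^ j) z) ((F ^^ j) w) \<ge> e"
    unfolding LIMSEQ_iff by (auto simp: not_less)
  then obtain J where J: "\<And>N. J N \<ge> N" "\<And>N. dist ((F ^^ J N) z) ((F ^^ J N) w) \<ge> e" by metis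
  have gap': "\<not> (fst (shift m ((F ^^ j) z)) < fst a \<and> fst a < fst (shift m ((F ^^ j) w)))" if "a \<in> A" for a j m
  proof
    assume asm: "fst (shift m ((F ^^ j) z)) < fst a \<and> fst a < fst (shift m ((F ^^ j) w))"
    define b where "b = (G ^^ j) (shift (- m) a)"
    have b: "b \<in> A" unfolding b_def using that by (intro inv.iter_mem A_shift)
    have "fst ((F ^^ j) z) < fst ((F ^^ j) b)" "fst ((F ^^ j) b) < fst ((F ^^ j) w)"
      using asm by (simp_all add: b_def)
    then have "fst z < fst b" "fst b < fst w" using iter_order zw b by blast+
    with gap[OF b] show False by simp
  qed
  have mono: "fst ((F ^^ j) z) < fst ((F ^^ j) w)" for j using iter_order zw by blast
  obtain R where R: "\<And>z. z \<in> A \<Longrightarrow> \<bar>snd z\<bar> \<le> R" using A_bounded by blast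
  have bound: "dist ((F ^^ j) z) ((F ^^ j) w) \<le> 1 + 2 * R" for j
  proof -
    \<comment> \<open>The translate by 1 of the left end belongs to \<open>A\<close> and cannot lie
      inside the gap, so no image of the gap is wider than 1.\<close>
    have "shift 1 ((F ^^ j) z) \<in> A" using zw iter_mem A_shift by blast
    from gap'[OF this, of 0 j] have 1: "fst ((F ^^ j) w) \<le> fst ((F ^^ j) z) + 1"
      by simp
    have "dist ((F ^^ j) z) ((F ^^ j) w) \<le> \<bar>fst ((F ^^ j) z) - fst ((F ^^ j) w)\<bar> + \<bar>snd ((F ^^ j) z) - snd ((F ^^ j) w)\<bar>"
      using sqrt_sum_squares_le_sum_abs by (simp add: dist_prod_def dist_real_def)
    with 1 mono[of j] R[OF iter_mem[OF zw(1)], of j] R[OF iter_mem[OF zw(2)], of j] show ?thesis by linarith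
  qed
  obtain r :: "nat \<Rightarrow> nat" and m u v where r: "strict_mono r" "u \<in> A" "v \<in> A"
    "(\<lambda>k. shift (m k) ((F ^^ J (r k)) z)) \<longlonglongrightarrow> u" "(\<lambda>k. shift (m k) ((F ^^ J (r k)) w)) \<longlonglongrightarrow> v"
    by (rule pair_compactness[of "\<lambda>k. (F ^^ J k) z" "\<lambda>k. (F ^^ J k) w"]) (use zw iter_mem bound in auto)
  have "(\<lambda>k. dist ((F ^^ J (r k)) z) ((F ^^ J (r k)) w)) \<longlonglongrightarrow> dist u v"
    using tendsto_dist[OF r(4,5)] by simp
  then have "e \<le> dist u v" by (rule LIMSEQ_le_const) (use J in auto)
  with e(1) have "fst u \<noteq> fst v" using graph[OF r(2,3)] by auto
  moreover have "fst u \<le> fst v"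
    by (rule LIMSEQ_le[OF tendsto_fst[OF r(4)] tendsto_fst[OF r(5)]]) (auto intro!: less_imp_le mono)
  ultimately have uv: "fst u < fst v" by simp
  \<comment> \<open>Late gaps start within \<open>d\<close> of \<open>fst u\<close>, hence to the
    left of the midpoint \<open>c\<close>, and end to its right.\<close>
  define c where "c = (fst u + fst v) / 2"
  define d where "d = (fst v - fst u) / 2"
  define p where "p k = fst (shift (m k) ((F ^^ J (r k)) z))" for k
  have "d > 0" using uv by (simp add: d_def)
  have "\<forall>\<^sub>F k in sequentially. \<bar>p k - fst u\<bar> < d"
    using tendstoD[OF tendsto_fst[OF r(4)] \<open>d > 0\<close>] by (simp add: p_def dist_real_def)
  moreover have "\<forall>\<^sub>F k in sequentially. c < fst (shift (m k) ((F ^^ J (r k)) w))"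
    by (rule order_tendstoD(1)[OF tendsto_fst[OF r(5)]]) (use uv in \<open>simp add: c_def\<close>)
  ultimately have "\<forall>\<^sub>F k in sequentially. \<bar>p k - fst u\<bar> < d \<and> c < fst (shift (m k) ((F ^^ J (r k)) w))"
    by eventually_elim auto
  then obtain N where N: "\<And>k. k \<ge> N \<Longrightarrow> \<bar>p k - fst u\<bar> < d"
    "\<And>k. k \<ge> N \<Longrightarrow> c < fst (shift (m k) ((F ^^ J (r k)) w))"
    unfolding eventually_sequentially by blast
  \<comment> \<open>Two gaps around \<open>c\<close> share their left end, otherwise the larger left
    end would lie inside the other gap.\<close>
  have eq: "p k = p l" if "k \<ge> N" "l \<ge> N" for k l
  proof -
    have "p l \<le> p k" if "k \<ge> N" "l \<ge> N" for k l
    proof (rule ccontr)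
      assume "\<not> p l \<le> p k"
      moreover have "p l < c" using N(1)[OF that(2)] unfolding abs_less_iff c_def d_def by (simp add: field_simps)
      moreover have "shift (m l) ((F ^^ J (r l)) z) \<in> A" using zw iter_mem A_shift by blast
      ultimately show False
        using gap'[of "shift (m l) ((F ^^ J (r l)) z)" "m k" "J (r k)"] N(2)[OF that(1)] by (simp add: p_def)
    qed
    from this[OF that] this[OF that(2,1)] show ?thesis by simp
  qed
  \<comment> \<open>Makes the second time strictly later, since
    \<open>J (r l) \<ge> r l \<ge> l > J (r N)\<close>.\<close>
  define l where "l = N + J (r N) + 1"
  have lt: "J (r N) < J (r l)"
    using J(1)[of "r l"] seq_suble[OF r(1), of l] by (simp add: l_def)
  have "p N = p l" by (rule eq) (simp_all add: l_def)
  then have "shift (m N) ((F ^^ J (r N)) z) = shift (m l) ((F ^^ J (r l)) z)"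
    unfolding p_def by (intro graph) (use zw iter_mem A_shift in auto)
  then have "(F ^^ J (r N)) z = shift (m l - m N) ((F ^^ J (r l)) z)"
    by (simp add: prod_eq_iff algebra_simps)
  moreover have "(F ^^ J (r l)) z = (F ^^ J (r N)) ((F ^^ (J (r l) - J (r N))) z)"
    using lt by (metis add_diff_inverse_nat comp_apply funpow_add order_less_imp_not_less)
  ultimately have "(G ^^ J (r N)) ((F ^^ J (r N)) z) = shift (m l - m N) ((F ^^ (J (r l) - J (r N))) z)"
    by (simp add: inv.iter_shift)
  then have "(F ^^ (J (r l) - J (r N))) z = shift (m N - m l) z"
    by (simp add: prod_eq_iff algebra_simps)
  with aperiodic[of "J (r l) - J (r N)" "m N - m l"] lt show False by simp
qed

end

section \<open>Quasi-hyperbolic ordered sets\<close>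

text \<open>On a hyperbolic set this is the stable space for \<open>F\<close> and the unstable one
  for \<open>G\<close>, described without reference to a splitting.\<close>

definition bounded_orbit :: "('a \<Rightarrow> 'a) \<Rightarrow> ('a \<Rightarrow> 'b::real_normed_vector \<Rightarrow>\<^sub>L 'b) \<Rightarrow> 'a \<Rightarrow> 'b set" where
  "bounded_orbit F F' z = {v. \<exists>B. \<forall>n. norm (cocycle F F' n z v) \<le> B}"

lemma norm_divideR_le: "n > 0 \<Longrightarrow> norm a \<le> B * n \<Longrightarrow> norm (a /\<^sub>R n) \<le> B"
  by (simp add: field_simps)

lemma bounded_orbitI: "(\<And>n. norm (cocycle F F' n z v) \<le> B) \<Longrightarrow> v \<in> bounded_orbit F F' z"
  unfolding bounded_orbit_def by blast

lemma bounded_orbit_scaleR: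
  assumes "v \<in> bounded_orbit F F' z" shows "c *\<^sub>R v \<in> bounded_orbit F F' z"
proof -
  obtain B where "\<And>n. norm (cocycle F F' n z v) \<le> B" using assms unfolding bounded_orbit_def by blast
  then have "norm (cocycle F F' n z (c *\<^sub>R v)) \<le> \<bar>c\<bar> * B" for n
    by (simp add: cocycle_scaleR mult_left_mono)
  then show ?thesis by (rule bounded_orbitI)
qed

lemma bounded_orbit_cocycle:
  assumes "v \<in> bounded_orbit F F' z" shows "cocycle F F' m z v \<in> bounded_orbit F F' ((F ^^ m) z)"
proof -
  obtain B where "\<And>n. norm (cocycle F F' n z v) \<le> B" using assms unfolding bounded_orbit_def by blast
  then have "norm (cocycle F F' n ((F ^^ m) z) (cocycle F F' m z v)) \<le> B" for n
    by (simp flip: cocycle_add)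
  then show ?thesis by (rule bounded_orbitI)
qed

definition int_iter :: "('a \<Rightarrow> 'a) \<Rightarrow> ('a \<Rightarrow> 'a) \<Rightarrow> int \<Rightarrow> 'a \<Rightarrow> 'a" where
  "int_iter F G i = (if i \<ge> 0 then F ^^ nat i else G ^^ nat (- i))"

lemma int_iter_of_nat [simp]: "int_iter F G (int n) = F ^^ n" "int_iter F G (- int n) = G ^^ n"
  by (auto simp: int_iter_def)

text \<open>What is kept of hyperbolicity once the splitting is forgotten. The constant
  \<open>C\<close> is uniform over \<open>A\<close>, which lets bounded vectors pass to limits of
  base points; \<open>aperiodic\<close> is the contribution of the irrational rotation
  number.\<close>

locale quasi_hyperbolic_set = lifted_ordered_set +
  fixes C :: real
  assumes aperiodic: "z \<in> A \<Longrightarrow> j > 0 \<Longrightarrow> (F ^^ j) z \<noteq> shift m z"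
    and forward: "z \<in> A \<Longrightarrow> v \<in> bounded_orbit F F' z \<Longrightarrow> norm (cocycle F F' n z v) \<le> C * norm v"
    and backward: "z \<in> A \<Longrightarrow> v \<in> bounded_orbit G G' z \<Longrightarrow> norm (cocycle G G' n z v) \<le> C * norm v"
    and transverse: "z \<in> A \<Longrightarrow> v \<in> bounded_orbit F F' z \<Longrightarrow> v \<in> bounded_orbit G G' z \<Longrightarrow> v = 0"
begin

lemma quasi_hyperbolic_set_inverse: "quasi_hyperbolic_set G F G' F' A C"
proof -
  interpret inv: lifted_ordered_set G F G' F' A by (rule lifted_ordered_set_inverse)
  show ?thesis
  proof
    show "(G ^^ j) z \<noteq> shift m z" if "z \<in> A" "j > 0" for z j m
    proof
      assume "(G ^^ j) z = shift m z"
      then have "(F ^^ j) ((G ^^ j) z) = shift m ((F ^^ j) z)" by (simp add: iter_shift)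
      then have "(F ^^ j) z = shift (- m) z" by (simp add: prod_eq_iff)
      with aperiodic that show False by blast
    qed
  qed (auto intro: forward backward transverse)
qed

lemma int_iter_add: "int_iter F G (i + j) z = int_iter F G i (int_iter F G j z)"
proof -
  have 1: "int_iter F G (i + 1) z = F (int_iter F G i z)" for i z
  proof (cases "i \<ge> 0")
    case True
    then show ?thesis by (simp add: int_iter_def nat_add_distrib)
  next
    case False
    then have "nat (- i) = Suc (nat (- (i + 1)))" by simp
    then have "F (int_iter F G i z) = (G ^^ nat (- (i + 1))) z" using False by (simp add: int_iter_def)
    with False show ?thesis by (auto simp: int_iter_def)
  qed
  have 2: "int_iter F G (i - 1) z = G (int_iter F G i z)" for i z
    using 1[of "i - 1" z] by simp
  show ?thesis
  proof (induction i rule: int_induct[of _ 0])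
    case base
    show ?case by (simp add: int_iter_def)
  next
    case (step1 i)
    have "i + 1 + j = (i + j) + 1" by simp
    with step1 show ?case by (simp only: 1)
  next
    case (step2 i)
    have "i - 1 + j = (i + j) - 1" by simp
    with step2 show ?case by (simp only: 2)
  qed
qed

lemma int_iter_mem: "z \<in> A \<Longrightarrow> int_iter F G i z \<in> A"
  using iter_mem lifted_ordered_set.iter_mem[OF lifted_ordered_set_inverse] by (simp add: int_iter_def)

lemma int_iter_inj: "int_iter F G i z = int_iter F G i w \<Longrightarrow> z = w"
  by (metis add.left_inverse funpow_0 int_iter_add int_iter_of_nat(1) of_nat_0)

text \<open>Otherwise there are distinct pairs that stay as close as desired at all times. Blowing
  up each pair at a time where its distance is nearly largest gives a unit vector with bounded
  forward and backward orbit, which \<open>transverse\<close> excludes.\<close>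

lemma expansive:
  obtains e where "e > 0"
    "\<And>x y. x \<in> A \<Longrightarrow> y \<in> A \<Longrightarrow> (\<And>i. dist (int_iter F G i x) (int_iter F G i y) \<le> e) \<Longrightarrow> x = y"
proof -
  have "\<exists>e>0. \<forall>x\<in>A. \<forall>y\<in>A. (\<forall>i. dist (int_iter F G i x) (int_iter F G i y) \<le> e) \<longrightarrow> x = y"
  proof (rule ccontr)
    assume neg: "\<not> ?thesis"
    have "\<forall>k. \<exists>x\<in>A. \<exists>y\<in>A. x \<noteq> y \<and> (\<forall>i. dist (int_iter F G i x) (int_iter F G i y) \<le> inverse (real (Suc k)))"
    proof
      fix k
      have "inverse (real (Suc k)) > 0" by simp
      with neg show "\<exists>x\<in>A. \<exists>y\<in>A. x \<noteq> y \<and> (\<forall>i. dist (int_iter F G i x) (int_iter F G i y) \<le> inverse (real (Suc k)))"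
        by blast
    qed
    then obtain x y where xy: "\<And>k. x k \<in> A" "\<And>k. y k \<in> A" "\<And>k. x k \<noteq> y k"
      "\<And>k i. dist (int_iter F G i (x k)) (int_iter F G i (y k)) \<le> inverse (real (Suc k))" by metis
    \<comment> \<open>A time at which the distance exceeds half its supremum; the supremum need not
      be attained, hence the factor 2.\<close>
    have "\<exists>n. \<forall>i. dist (int_iter F G i (x k)) (int_iter F G i (y k))
       \<le> 2 * dist (int_iter F G n (x k)) (int_iter F G n (y k))" for k
    proof -
      define D where "D i = dist (int_iter F G i (x k)) (int_iter F G i (y k))" for i
      have bdd: "bdd_above (range D)" unfolding D_def using xy(4) by (intro bdd_aboveI2)
      have "D 0 > 0" using xy(3)[of k] by (simp add: D_def int_iter_def)
      with bdd have pos: "Sup (range D) > 0" by (metis cSUP_upper UNIV_I less_le_trans)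
      then have "Sup (range D) / 2 < Sup (range D)" by simp
      then have "\<exists>d\<in>range D. Sup (range D) / 2 < d" by (intro less_cSupD) auto
      then obtain n where "Sup (range D) / 2 < D n" by blast
      moreover have "D i \<le> Sup (range D)" for i using bdd by (intro cSUP_upper) auto
      ultimately have "\<forall>i. D i \<le> 2 * D n" by (smt (verit) field_sum_of_halves)
      then show ?thesis unfolding D_def by blast
    qed
    then obtain n where n: "\<And>k i. dist (int_iter F G i (x k)) (int_iter F G i (y k))
       \<le> 2 * dist (int_iter F G (n k) (x k)) (int_iter F G (n k) (y k))" by metis
    define p where "p k = int_iter F G (n k) (x k)" for k
    define q where "q k = int_iter F G (n k) (y k)" for k
    have pq: "p k \<in> A" "q k \<in> A" "p k \<noteq> q k" for k
      using xy(1-3) int_iter_mem int_iter_inj unfolding p_def q_def by blast+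
    have "(\<lambda>k. dist (p k) (q k)) \<longlonglongrightarrow> 0"
      unfolding p_def q_def
      by (rule tendsto_sandwich[OF _ _ tendsto_const LIMSEQ_inverse_real_of_nat])
        (intro always_eventually allI zero_le_dist xy)+
    then have "(\<lambda>k. p k - q k) \<longlonglongrightarrow> 0" by (simp add: dist_norm tendsto_norm_zero_iff)
    then obtain r z v where r: "strict_mono (r :: nat \<Rightarrow> nat)" "z \<in> A" "norm v = 1"
      and F: "\<And>j. (\<lambda>k. ((F ^^ j) (p (r k)) - (F ^^ j) (q (r k))) /\<^sub>R norm (p (r k) - q (r k))) \<longlonglongrightarrow> cocycle F F' j z v"
      and G: "\<And>j. (\<lambda>k. ((G ^^ j) (p (r k)) - (G ^^ j) (q (r k))) /\<^sub>R norm (p (r k) - q (r k))) \<longlonglongrightarrow> cocycle G G' j z v"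
      using pq by (rule_tac blowup[of p q]) blast+
    have le: "norm ((int_iter F G i (p k) - int_iter F G i (q k)) /\<^sub>R norm (p k - q k)) \<le> 2" for i k
    proof -
      have "dist (int_iter F G i (p k)) (int_iter F G i (q k)) \<le> 2 * dist (p k) (q k)"
        using n[of "i + n k" k] unfolding p_def q_def by (simp add: int_iter_add)
      then show ?thesis using pq(3)[of k] by (intro norm_divideR_le) (simp_all add: dist_norm)
    qed
    have "norm (cocycle F F' j z v) \<le> 2" for j
      by (rule LIMSEQ_le_const2[OF tendsto_norm[OF F]]) (use le[where i = "int j"] in \<open>auto simp del: norm_scaleR\<close>)
    moreover have "norm (cocycle G G' j z v) \<le> 2" for j
      by (rule LIMSEQ_le_const2[OF tendsto_norm[OF G]]) (use le[where i = "- int j"] in \<open>auto simp del: norm_scaleR\<close>)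
    ultimately have "v = 0" using transverse[OF r(2)] bounded_orbitI by metis
    with r(3) show False by simp
  qed
  then show thesis using that by blast
qed

text \<open>Just before separating for the first time, the pairs have been \<open>e\<close>-close
  for a long past, so their limit is a distinct pair that is \<open>e\<close>-close at all past
  times. Any limit of its backward iterates is \<open>e\<close>-close at all times, hence a single
  point by expansiveness, so the distance tends to 0.\<close>

lemma backward_asymptotic_pair:
  assumes e: "\<And>x y. x \<in> A \<Longrightarrow> y \<in> A \<Longrightarrow> (\<And>i. dist (int_iter F G i x) (int_iter F G i y) \<le> e) \<Longrightarrow> x = y"
    and A: "\<And>k::nat. x k \<in> A" "\<And>k. y k \<in> A"
    and n: "\<And>k. k < n k" "\<And>k. e < dist ((F ^^ n k) (x k)) ((F ^^ n k) (y k))"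
    and small: "\<And>k i. i < n k \<Longrightarrow> dist ((F ^^ i) (x k)) ((F ^^ i) (y k)) \<le> e"
  obtains z w where "z \<in> A" "w \<in> A" "z \<noteq> w" "(\<lambda>j. dist ((G ^^ j) z) ((G ^^ j) w)) \<longlonglongrightarrow> 0"
proof -
  interpret inv: lifted_ordered_set G F G' F' A by (rule lifted_ordered_set_inverse)
  \<comment> \<open>At time \<open>n k - 1\<close> the distance is still at most \<open>e\<close>,
    which gives compactness, while one more step exceeds \<open>e\<close>, which keeps the limit
    points apart.\<close>
  define p where "p k = (F ^^ (n k - 1)) (x k)" for k
  define q where "q k = (F ^^ (n k - 1)) (y k)" for k
  have nk: "n k = Suc (n k - 1)" for k using n(1)[of k] by simp
  have pq: "p k \<in> A" "q k \<in> A" "dist (p k) (q k) \<le> e" "e < dist (F (p k)) (F (q k))" for k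
  proof -
    show "p k \<in> A" "q k \<in> A" using A iter_mem by (auto simp: p_def q_def)
    show "dist (p k) (q k) \<le> e" unfolding p_def q_def by (rule small) (use n(1)[of k] in simp)
    show "e < dist (F (p k)) (F (q k))" using n(2)[of k] by (subst (asm) (1 2) nk) (simp add: p_def q_def)
  qed
  have past: "dist ((G ^^ j) (p k)) ((G ^^ j) (q k)) \<le> e" if "j \<le> k" for j k
  proof -
    have j: "n k - 1 = j + (n k - 1 - j)" using n(1)[of k] that by simp
    have "(G ^^ j) ((F ^^ (n k - 1)) u) = (F ^^ (n k - 1 - j)) u" for u
      by (subst j) (simp only: funpow_add comp_apply iter_inverse)
    then show ?thesis using small[of "n k - 1 - j" k] nk[of k] by (simp add: p_def q_def)
  qed
  obtain r :: "nat \<Rightarrow> nat" and m z w where r: "strict_mono r" "z \<in> A" "w \<in> A"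
    "(\<lambda>k. shift (m k) (p (r k))) \<longlonglongrightarrow> z" "(\<lambda>k. shift (m k) (q (r k))) \<longlonglongrightarrow> w"
    using pq(1-3) by (rule pair_compactness)
  have "e \<le> dist (F z) (F w)"
  proof (rule LIMSEQ_le_const)
    show "(\<lambda>k. dist (F (p (r k))) (F (q (r k)))) \<longlonglongrightarrow> dist (F z) (F w)"
      using iter_dist_tendsto[OF r(4,5), of 1] by simp
  qed (use pq(4) less_imp_le in blast)
  have zw: "dist ((G ^^ j) z) ((G ^^ j) w) \<le> e" for j
  proof (rule LIMSEQ_le_const2[OF inv.iter_dist_tendsto[OF r(4,5)]])
    have "dist ((G ^^ j) (p (r k))) ((G ^^ j) (q (r k))) \<le> e" if "k \<ge> j" for k
      using seq_suble[OF r(1), of k] that by (intro past) simp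
    then show "\<exists>N. \<forall>k\<ge>N. dist ((G ^^ j) (p (r k))) ((G ^^ j) (q (r k))) \<le> e" by blast
  qed
  have "z \<noteq> w"
  proof
    assume "z = w"
    with \<open>e \<le> dist (F z) (F w)\<close> have "e \<le> 0" by simp
    with pq(3)[of 0] zero_le_dist[of "p 0" "q 0"] have "dist (p 0) (q 0) = 0" "e = 0" by linarith+
    with pq(4)[of 0] show False by simp
  qed
  have "(\<lambda>j. dist ((G ^^ j) z) ((G ^^ j) w)) \<longlonglongrightarrow> 0"
  proof (rule ccontr)
    assume "\<not> ?thesis"
    then obtain h where h: "h > 0" "\<And>N. \<exists>j\<ge>N. dist ((G ^^ j) z) ((G ^^ j) w) \<ge> h"
      unfolding LIMSEQ_iff by (auto simp: not_less)
    then obtain J where J: "\<And>N. J N \<ge> N" "\<And>N. dist ((G ^^ J N) z) ((G ^^ J N) w) \<ge> h" by metis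
    obtain s :: "nat \<Rightarrow> nat" and m a b where s: "strict_mono s" "a \<in> A" "b \<in> A"
      "(\<lambda>k. shift (m k) ((G ^^ J (s k)) z)) \<longlonglongrightarrow> a" "(\<lambda>k. shift (m k) ((G ^^ J (s k)) w)) \<longlonglongrightarrow> b"
      by (rule pair_compactness[of "\<lambda>k. (G ^^ J k) z" "\<lambda>k. (G ^^ J k) w" e])
        (use r inv.iter_mem zw in auto)
    have "dist (int_iter F G i a) (int_iter F G i b) \<le> e" for i
    proof (cases "i \<ge> 0")
      case False
      have "dist ((G ^^ j) a) ((G ^^ j) b) \<le> e" for j
        by (rule LIMSEQ_le_const2[OF inv.iter_dist_tendsto[OF s(4,5)]])
          (use zw in \<open>auto simp flip: funpow_add comp_apply[of "_ ^^ _" "_ ^^ _"]\<close>)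
      with False show ?thesis by (simp add: int_iter_def)
    next
      case True
      have "dist ((F ^^ j) a) ((F ^^ j) b) \<le> e" for j
      proof (rule LIMSEQ_le_const2[OF iter_dist_tendsto[OF s(4,5)]])
        \<comment> \<open>Moving \<open>j\<close> steps forward from time \<open>- J (s k)\<close>
          stays in the past as long as \<open>j \<le> J (s k)\<close>, and there the distance is at
          most \<open>e\<close>.\<close>
        have "dist ((F ^^ j) ((G ^^ J (s k)) z)) ((F ^^ j) ((G ^^ J (s k)) w)) \<le> e" if "k \<ge> j" for k
        proof -
          have j: "J (s k) = j + (J (s k) - j)" using seq_suble[OF s(1), of k] that J(1)[of "s k"] by simp
          have "(F ^^ j) ((G ^^ J (s k)) u) = (G ^^ (J (s k) - j)) u" for u
            by (subst j) (simp only: funpow_add comp_apply iter_inverse)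
          then show ?thesis using zw by simp
        qed
        then show "\<exists>N. \<forall>k\<ge>N. dist ((F ^^ j) ((G ^^ J (s k)) z)) ((F ^^ j) ((G ^^ J (s k)) w)) \<le> e" by blast
      qed
      with True show ?thesis by (simp add: int_iter_def)
    qed
    then have "a = b" by (rule e[OF s(2,3)])
    moreover have "h \<le> dist a b"
    proof (rule LIMSEQ_le_const)
      show "(\<lambda>k. dist ((G ^^ J (s k)) z) ((G ^^ J (s k)) w)) \<longlonglongrightarrow> dist a b"
        using inv.iter_dist_tendsto[OF s(4,5), of 0] by simp
    qed (use J(2) in blast)
    ultimately show False using h(1) by simp
  qed
  with r \<open>z \<noteq> w\<close> show thesis by (intro that)
qed

end

section \<open>Asymptotic pairs, gaps and bounded cone vectors\<close>

context quasi_hyperbolic_set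
begin

text \<open>Modulo translations the orbit of a point returns arbitrarily close to it, and
  aperiodicity makes the return a different point.\<close>

lemma close_pair:
  assumes "e > 0"
  obtains x y where "x \<in> A" "y \<in> A" "x \<noteq> y" "dist x y < e"
proof -
  obtain x where x: "x \<in> A" using A_nonempty by blast
  obtain j m where "j \<ge> 1" "dist (shift m ((F ^^ j) x)) x < e"
    using orbit_dense[OF x x \<open>e > 0\<close>] by metis
  moreover have "shift m ((F ^^ j) x) \<noteq> x"
  proof
    assume "shift m ((F ^^ j) x) = x"
    then have "(F ^^ j) x = shift (- m) x" by (simp add: prod_eq_iff)
    with aperiodic[OF x, of j "- m"] \<open>j \<ge> 1\<close> show False by simp
  qed
  ultimately show thesis using x iter_mem A_shift that by blast
qed

text \<open>Very close distinct points stay close for \<open>k\<close> steps in both directions, but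
  expansiveness separates them at some time. If the first separation lies in the future for
  arbitrarily large \<open>k\<close>, the limit pair is asymptotic in the past, otherwise in the
  future.\<close>

lemma asymptotic_pair:
  obtains z w where "z \<in> A" "w \<in> A" "z \<noteq> w"
    "(\<lambda>j. dist ((G ^^ j) z) ((G ^^ j) w)) \<longlonglongrightarrow> 0 \<or> (\<lambda>j. dist ((F ^^ j) z) ((F ^^ j) w)) \<longlonglongrightarrow> 0"
proof -
  interpret inv: quasi_hyperbolic_set G F G' F' A C by (rule quasi_hyperbolic_set_inverse)
  obtain e where "e > 0" and e:
    "\<And>x y. x \<in> A \<Longrightarrow> y \<in> A \<Longrightarrow> (\<And>i. dist (int_iter F G i x) (int_iter F G i y) \<le> e) \<Longrightarrow> x = y"
    by (rule expansive) blast
  have e': "x = y" if "x \<in> A" "y \<in> A" "\<And>i. dist (int_iter G F i x) (int_iter G F i y) \<le> e" for x y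
  proof (rule e[OF that(1,2)])
    fix i
    have "int_iter F G i = int_iter G F (- i)" by (auto simp: int_iter_def)
    with that(3)[of "- i"] show "dist (int_iter F G i x) (int_iter F G i y) \<le> e" by simp
  qed
  define far where "far x y n \<longleftrightarrow> e < dist ((F ^^ n) x) ((F ^^ n) y) \<or> e < dist ((G ^^ n) x) ((G ^^ n) y)" for x y n
  have "\<exists>x\<in>A. \<exists>y\<in>A. \<exists>n>k. far x y n \<and> (\<forall>i<n. \<not> far x y i)" for k
  proof -
    obtain d where d: "d > 0" "\<And>x y j. x \<in> A \<Longrightarrow> y \<in> A \<Longrightarrow> dist x y < d \<Longrightarrow> j \<le> k \<Longrightarrow> dist ((F ^^ j) x) ((F ^^ j) y) < e"
      using iter_uniformly_continuous[OF \<open>e > 0\<close>] by metis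
    obtain d' where d': "d' > 0" "\<And>x y j. x \<in> A \<Longrightarrow> y \<in> A \<Longrightarrow> dist x y < d' \<Longrightarrow> j \<le> k \<Longrightarrow> dist ((G ^^ j) x) ((G ^^ j) y) < e"
      using inv.iter_uniformly_continuous[OF \<open>e > 0\<close>] by metis
    obtain x y where xy: "x \<in> A" "y \<in> A" "x \<noteq> y" "dist x y < min d d'"
      by (rule close_pair[of "min d d'"]) (use d(1) d'(1) in simp_all)
    have "\<exists>n. far x y n"
    proof (rule ccontr)
      assume "\<nexists>n. far x y n"
      then have "dist (int_iter F G i x) (int_iter F G i y) \<le> e" for i
        by (auto simp: far_def int_iter_def not_less)
      with e xy show False by blast
    qed
    then have "far x y (LEAST n. far x y n)" by (rule LeastI_ex)
    moreover have "\<not> far x y i" if "i < (LEAST n. far x y n)" for i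
      using that by (rule not_less_Least)
    moreover have "\<not> far x y i" if "i \<le> k" for i
      using d(2)[OF xy(1,2) _ that] d'(2)[OF xy(1,2) _ that] xy(4) by (auto simp: far_def)
    ultimately show ?thesis using xy by (meson not_le)
  qed
  then have "\<forall>k. \<exists>x y n. x \<in> A \<and> y \<in> A \<and> k < n \<and> far x y n \<and> (\<forall>i<n. \<not> far x y i)" by blast
  then obtain x y n where xyn: "\<And>k. x k \<in> A" "\<And>k. y k \<in> A" "\<And>k. k < n k" "\<And>k. far (x k) (y k) (n k)"
    "\<And>k i. i < n k \<Longrightarrow> \<not> far (x k) (y k) i" by metis
  define K where "K = {k. e < dist ((F ^^ n k) (x k)) ((F ^^ n k) (y k))}"
  \<comment> \<open>Selects indices along which the first separation always happens on the same
    side; \<open>k \<le> s k\<close> keeps the separation times beyond \<open>k\<close>.\<close>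
  have "\<exists>s. (\<forall>k::nat. k \<le> s k) \<and> ((\<forall>k. s k \<in> K) \<or> (\<forall>k. s k \<notin> K))"
  proof (cases "\<forall>k. \<exists>l\<ge>k. l \<in> K")
    case True
    then show ?thesis by metis
  next
    case False
    then obtain k0 where "\<And>l. l \<ge> k0 \<Longrightarrow> l \<notin> K" by blast
    then show ?thesis by (intro exI[of _ "\<lambda>k. k + k0"]) auto
  qed
  then obtain s :: "nat \<Rightarrow> nat" where s: "\<And>k. k \<le> s k" and "(\<forall>k. s k \<in> K) \<or> (\<forall>k. s k \<notin> K)" by blast
  from this(2) show thesis
  proof
    assume sK: "\<forall>k. s k \<in> K"
    show thesis
    proof (rule backward_asymptotic_pair[of e "\<lambda>k. x (s k)" "\<lambda>k. y (s k)" "\<lambda>k. n (s k)"])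
      show "k < n (s k)" for k using s[of k] xyn(3)[of "s k"] by simp
    qed (use e xyn sK that in \<open>auto simp: K_def far_def not_less\<close>)
  next
    assume sK: "\<forall>k. s k \<notin> K"
    show thesis
    proof (rule inv.backward_asymptotic_pair[of e "\<lambda>k. x (s k)" "\<lambda>k. y (s k)" "\<lambda>k. n (s k)"])
      show "k < n (s k)" for k using s[of k] xyn(3)[of "s k"] by simp
      show "e < dist ((G ^^ n (s k)) (x (s k))) ((G ^^ n (s k)) (y (s k)))" for k
        using xyn(4)[of "s k"] sK by (auto simp: K_def far_def)
    qed (use e' xyn that in \<open>auto simp: far_def not_less\<close>)
  qed
qed

text \<open>Were \<open>a\<close> in between, some translated iterate \<Phi> would bring
  \<open>z\<close> close to \<open>a\<close>, and \<open>w\<close> with it because the pair is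
  asymptotic. Then \<Phi> maps the part of \<open>A\<close> between \<open>z\<close> and
  \<open>w\<close> monotonically into itself, so it has a fixed point there, and that point is
  periodic modulo translations.\<close>

lemma asymptotic_imp_gap:
  assumes zw: "z \<in> A" "w \<in> A"
    and asym: "(\<lambda>j. dist ((F ^^ j) z) ((F ^^ j) w)) \<longlonglongrightarrow> 0" and a: "a \<in> A"
  shows "\<not> (fst z < fst a \<and> fst a < fst w)"
proof
  assume between: "fst z < fst a \<and> fst a < fst w"
  \<comment> \<open>The first coordinates of \<open>\<Phi> z\<close> and \<open>\<Phi> w\<close>
    come within \<open>2 * e\<close> of \<open>fst a\<close>, which is at most the distance to
    either end.\<close>
  define e where "e = min (fst a - fst z) (fst w - fst a) / 2"
  have "e > 0" using between by (simp add: e_def)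
  obtain N where N: "\<And>j. j \<ge> N \<Longrightarrow> dist ((F ^^ j) z) ((F ^^ j) w) < e"
    using LIMSEQ_D[OF asym \<open>e > 0\<close>] by auto
  obtain j m where j: "j \<ge> Suc N" "dist (shift m ((F ^^ j) z)) a < e"
    using orbit_dense[OF zw(1) a \<open>e > 0\<close>] by metis
  define \<Phi> where "\<Phi> u = shift m ((F ^^ j) u)" for u
  have \<Phi>_mem: "\<Phi> u \<in> A" if "u \<in> A" for u using that iter_mem A_shift by (simp add: \<Phi>_def)
  have \<Phi>_mono: "fst (\<Phi> u) \<le> fst (\<Phi> v) \<longleftrightarrow> fst u \<le> fst v" if "u \<in> A" "v \<in> A" for u v
    using iter_order[OF that(2,1), of j] by (auto simp: \<Phi>_def not_less[symmetric])
  have dz: "dist (\<Phi> z) a < e" using j(2) by (simp add: \<Phi>_def)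
  have dw: "dist (\<Phi> z) (\<Phi> w) < e" using N[of j] j(1) by (simp add: \<Phi>_def)
  have "\<bar>fst (\<Phi> z) - fst a\<bar> < e" using dz dist_fst_le[of "\<Phi> z" a] by (simp add: dist_real_def)
  moreover have "\<bar>fst (\<Phi> z) - fst (\<Phi> w)\<bar> < e" using dw dist_fst_le[of "\<Phi> z" "\<Phi> w"] by (simp add: dist_real_def)
  moreover have "2 * e \<le> fst a - fst z" "2 * e \<le> fst w - fst a" by (simp_all add: e_def)
  ultimately have z1: "fst z \<le> fst (\<Phi> z)" and w1: "fst (\<Phi> w) \<le> fst w"
    by linarith+
  \<comment> \<open>The fixed point is the rightmost point that \<Phi> does not move to the left:
    its image has the same property, so it cannot move to the right either.\<close>
  define S where "S = {u \<in> A. fst z \<le> fst u \<and> fst u \<le> fst w \<and> fst u \<le> fst (\<Phi> u)}"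
  have "compact S"
  proof -
    obtain R where R: "\<And>z. z \<in> A \<Longrightarrow> \<bar>snd z\<bar> \<le> R" using A_bounded by blast
    have "continuous_on UNIV (F ^^ j)"
      by (rule continuous_at_imp_continuous_on)
        (auto intro: has_derivative_continuous cocycle_has_derivative F_deriv)
    then have "closed {u. fst u \<le> fst (\<Phi> u)}"
      unfolding \<Phi>_def by (intro closed_Collect_le continuous_intros) (simp_all add: shift_def continuous_intros)
    then have "closed S"
      unfolding S_def using A_closed by (simp add: Collect_conj_eq closed_Collect_le continuous_intros closed_Int)
    moreover have "S \<subseteq> cbox (fst z, - R) (fst w, R)"
    proof
      fix u assume "u \<in> S"
      with R[of u] show "u \<in> cbox (fst z, - R) (fst w, R)"
        by (cases u) (auto simp: S_def cbox_Pair_eq)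
    qed
    ultimately show ?thesis by (meson bounded_cbox bounded_subset compact_eq_bounded_closed)
  qed
  moreover have "z \<in> S" using zw z1 between by (auto simp: S_def)
  then have "S \<noteq> {}" by blast
  moreover have "continuous_on S fst" by (intro continuous_intros)
  ultimately obtain u where u: "u \<in> S" "\<And>v. v \<in> S \<Longrightarrow> fst v \<le> fst u"
    using continuous_attains_sup[of S fst] by blast
  have "\<Phi> u \<in> S"
    using u(1) \<Phi>_mono[of u w] \<Phi>_mono[of u "\<Phi> u"] \<Phi>_mem zw w1 by (auto simp: S_def)
  with u have "fst (\<Phi> u) = fst u" by (fastforce simp: S_def)
  then have "\<Phi> u = u" using u(1) \<Phi>_mem graph by (auto simp: S_def)
  then have "(F ^^ j) u = shift (- m) u" by (simp add: \<Phi>_def prod_eq_iff)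
  with aperiodic[of u j] u(1) j(1) show False by (auto simp: S_def)
qed

text \<open>At a record time, when the distance is the largest from then on, forward iteration does
  not enlarge the rescaled difference, so its blow-up is a cone vector with bounded orbit. Density
  of the orbit of its base point and the uniform constant \<open>C\<close> carry such a vector to
  every \<open>a\<close>.\<close>

lemma bounded_cone_vector:
  assumes zw: "z \<in> A" "w \<in> A" "z \<noteq> w"
    and asym: "(\<lambda>j. dist ((F ^^ j) z) ((F ^^ j) w)) \<longlonglongrightarrow> 0" and a: "a \<in> A"
  obtains v where "v \<in> ptg_cone A a" "v \<noteq> 0" "v \<in> bounded_orbit F F' a"
proof -
  define D where "D j = dist ((F ^^ j) z) ((F ^^ j) w)" for j
  have iter_inj: "(F ^^ j) u = (F ^^ j) v \<longleftrightarrow> u = v" for u v j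
    by (metis iter_inverse(2))
  have Dpos: "D j > 0" for j using zw(3) by (simp add: D_def iter_inj)
  \<comment> \<open>The maximum over the infinitely many later times is attained because
    \<open>D\<close> tends to 0: beyond some \<open>M\<close> all values are below
    \<open>D N\<close>.\<close>
  have "\<exists>n\<ge>N. \<forall>j\<ge>N. D j \<le> D n" for N
  proof -
    have "D \<longlonglongrightarrow> 0" unfolding D_def by (rule asym)
    from order_tendstoD(2)[OF this Dpos[of N]]
    obtain M where M: "\<And>j. j \<ge> M \<Longrightarrow> D j < D N" unfolding eventually_sequentially by blast
    have "Max (D ` {N..max N M}) \<in> D ` {N..max N M}" by (rule Max_in) auto
    then obtain n where n: "n \<in> {N..max N M}" "D n = Max (D ` {N..max N M})" by (metis imageE)
    have le: "D j \<le> D n" if "j \<in> {N..max N M}" for j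
      unfolding n(2) using that by (intro Max_ge) auto
    have "D j \<le> D n" if "j \<ge> N" for j
    proof (cases "j \<le> max N M")
      case False
      then have "D j < D N" using M by simp
      also have "D N \<le> D n" by (rule le) simp
      finally show ?thesis by simp
    qed (use le that in simp)
    with n(1) show ?thesis by auto
  qed
  then obtain n where n: "\<And>N. n N \<ge> N" "\<And>N j. j \<ge> N \<Longrightarrow> D j \<le> D (n N)" by metis
  define x where "x k = (F ^^ n k) z" for k
  define y where "y k = (F ^^ n k) w" for k
  have xy: "x k \<in> A" "y k \<in> A" "x k \<noteq> y k" for k
    using zw iter_mem by (auto simp: x_def y_def iter_inj)
  have "(\<lambda>k. dist (x k) (y k)) \<longlonglongrightarrow> 0"
  proof (rule LIMSEQ_I)
    fix r :: real assume "r > 0"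
    obtain M where "\<And>j. j \<ge> M \<Longrightarrow> dist ((F ^^ j) z) ((F ^^ j) w) < r"
      using LIMSEQ_D[OF asym \<open>r > 0\<close>] by auto
    then have "dist (x k) (y k) < r" if "k \<ge> M" for k
      using n(1)[of k] that unfolding x_def y_def by (meson order_trans)
    then show "\<exists>no. \<forall>k\<ge>no. norm (dist (x k) (y k) - 0) < r" by auto
  qed
  then have "(\<lambda>k. x k - y k) \<longlonglongrightarrow> 0" by (simp add: dist_norm tendsto_norm_zero_iff)
  then obtain r u v where r: "strict_mono (r :: nat \<Rightarrow> nat)" "u \<in> A" "norm v = 1" "v \<in> ptg_cone A u"
    and F: "\<And>j. (\<lambda>k. ((F ^^ j) (x (r k)) - (F ^^ j) (y (r k))) /\<^sub>R norm (x (r k) - y (r k))) \<longlonglongrightarrow> cocycle F F' j u v"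
    using xy by (rule_tac blowup[of x y]) blast+
  have v: "v \<in> bounded_orbit F F' u"
  proof (rule bounded_orbitI)
    fix j
    have "norm (((F ^^ j) (x k) - (F ^^ j) (y k)) /\<^sub>R norm (x k - y k)) \<le> 1" for k
    proof -
      have "dist ((F ^^ j) (x k)) ((F ^^ j) (y k)) = D (j + n k)"
        by (simp add: D_def x_def y_def funpow_add)
      also have "\<dots> \<le> D (n k)" by (rule n(2)) (use n(1)[of k] in simp)
      also have "D (n k) = dist (x k) (y k)" by (simp add: D_def x_def y_def)
      finally show ?thesis using xy(3)[of k] by (intro norm_divideR_le) (simp_all add: dist_norm)
    qed
    then show "norm (cocycle F F' j u v) \<le> 1"
      by (intro LIMSEQ_le_const2[OF tendsto_norm[OF F]]) (auto simp del: norm_scaleR)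
  qed
  have "\<forall>k. \<exists>j m. dist (shift m ((F ^^ j) u)) a < inverse (real (Suc k))"
  proof
    fix k
    have "inverse (real (Suc k)) > 0" by simp
    then show "\<exists>j m. dist (shift m ((F ^^ j) u)) a < inverse (real (Suc k))"
      using orbit_dense[OF r(2) a] by metis
  qed
  then obtain j m where jm: "\<And>k. dist (shift (m k) ((F ^^ j k) u)) a < inverse (real (Suc k))" by metis
  define b where "b k = shift (m k) ((F ^^ j k) u)" for k
  \<comment> \<open>Normalised, since the images of \<open>v\<close> may shrink to 0 along the orbit
    and only their direction is wanted in the limit.\<close>
  define c where "c k = cocycle F F' (j k) u v /\<^sub>R norm (cocycle F F' (j k) u v)" for k
  have bA: "b k \<in> A" for k using r(2) iter_mem A_shift by (simp add: b_def)
  have b_lim: "b \<longlonglongrightarrow> a"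
    by (rule tendsto_dist_iff[THEN iffD2], rule tendsto_sandwich[OF _ _ tendsto_const LIMSEQ_inverse_real_of_nat])
      (intro always_eventually allI zero_le_dist less_imp_le jm[folded b_def])+
  have "cocycle F F' (j k) u v \<noteq> 0" for k
    using cocycle_inverse[of "j k" u v] r(3) by (metis cocycle_zero norm_zero zero_neq_one)
  then have c1: "norm (c k) = 1" for k by (simp add: c_def)
  have c_cone: "c k \<in> ptg_cone A (b k)" for k
    unfolding c_def b_def ptg_cone_shift by (intro ptg_cone_scaleR ptg_cone_cocycle r)
  have c_bdd: "c k \<in> bounded_orbit F F' (b k)" for k
  proof -
    have "c k \<in> bounded_orbit F F' ((F ^^ j k) u)"
      unfolding c_def by (intro bounded_orbit_scaleR bounded_orbit_cocycle v)
    then show ?thesis by (simp add: bounded_orbit_def b_def cocycle_shift)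
  qed
  have "c k \<in> sphere 0 1" for k using c1 by simp
  then obtain v' s where s: "v' \<in> sphere 0 1" "strict_mono (s :: nat \<Rightarrow> nat)" "(c \<circ> s) \<longlonglongrightarrow> v'"
    using compact_sphere[of "0 :: real \<times> real" 1] unfolding compact_def by blast
  have bs: "(\<lambda>k. b (s k)) \<longlonglongrightarrow> a" using LIMSEQ_subseq_LIMSEQ[OF b_lim s(2)] by (simp add: o_def)
  have cs: "(\<lambda>k. c (s k)) \<longlonglongrightarrow> v'" using s(3) by (simp add: o_def)
  show thesis
  proof
    show "v' \<noteq> 0" using s(1) by auto
    show "v' \<in> ptg_cone A a" using c_cone bs cs by (rule ptg_cone_closed_graph)
    show "v' \<in> bounded_orbit F F' a"
    proof (rule bounded_orbitI)
      fix i
      \<comment> \<open>Membership in \<open>bounded_orbit\<close> alone would not pass to the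
        limit; the bound \<open>C\<close>, common to all base points, does.\<close>
      have "norm (cocycle F F' i (b (s k)) (c (s k))) \<le> C" for k
        using forward[OF bA c_bdd, of i "s k"] c1 by simp
      then show "norm (cocycle F F' i a v') \<le> C"
        by (intro LIMSEQ_le_const2[OF tendsto_norm[OF cocycle_tendsto[OF F_cont F'_cont bs cs]]]) auto
    qed
  qed
qed

lemma bounded_cone_vectors:
  assumes a: "a \<in> A"
  obtains u v where "u \<in> ptg_cone A a" "u \<noteq> 0" "u \<in> bounded_orbit F F' a"
    "v \<in> ptg_cone A a" "v \<noteq> 0" "v \<in> bounded_orbit G G' a"
proof -
  interpret inv: quasi_hyperbolic_set G F G' F' A C by (rule quasi_hyperbolic_set_inverse)
  obtain z w where zw: "z \<in> A" "w \<in> A" "fst z < fst w"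
    and asym: "(\<lambda>j. dist ((G ^^ j) z) ((G ^^ j) w)) \<longlonglongrightarrow> 0 \<or> (\<lambda>j. dist ((F ^^ j) z) ((F ^^ j) w)) \<longlonglongrightarrow> 0"
  proof -
    obtain z w where zw: "z \<in> A" "w \<in> A" "z \<noteq> w"
      and asym: "(\<lambda>j. dist ((G ^^ j) z) ((G ^^ j) w)) \<longlonglongrightarrow> 0 \<or> (\<lambda>j. dist ((F ^^ j) z) ((F ^^ j) w)) \<longlonglongrightarrow> 0"
      by (rule asymptotic_pair) blast
    have "fst z \<noteq> fst w" using graph[OF zw(1,2)] zw(3) by blast
    then consider "fst z < fst w" | "fst w < fst z" by linarith
    then show thesis
    proof cases
      case 2
      with that[of w z] zw asym show ?thesis by (simp add: dist_commute)
    qed (use that zw asym in blast)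
  qed
  have gap: "\<not> (fst z < fst a \<and> fst a < fst w)" if "a \<in> A" for a
    using asym asymptotic_imp_gap[OF zw(1,2) _ that] inv.asymptotic_imp_gap[OF zw(1,2) _ that] by blast
  have "z \<noteq> w" using zw(3) by auto
  have F: "(\<lambda>j. dist ((F ^^ j) z) ((F ^^ j) w)) \<longlonglongrightarrow> 0"
    using gap aperiodic[OF zw(1)] by (rule gap_asymptotic[OF zw])
  have G: "(\<lambda>j. dist ((G ^^ j) z) ((G ^^ j) w)) \<longlonglongrightarrow> 0"
    using gap inv.aperiodic[OF zw(1)] by (rule inv.gap_asymptotic[OF zw])
  obtain u where u: "u \<in> ptg_cone A a" "u \<noteq> 0" "u \<in> bounded_orbit F F' a"
    using zw(1,2) \<open>z \<noteq> w\<close> F a by (rule bounded_cone_vector)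
  obtain v where v: "v \<in> ptg_cone A a" "v \<noteq> 0" "v \<in> bounded_orbit G G' a"
    using zw(1,2) \<open>z \<noteq> w\<close> G a by (rule inv.bounded_cone_vector)
  from u v show thesis by (rule that)
qed

text \<open>In a line, the forward bounded and the backward bounded cone vector would be
  proportional, hence bounded in both directions.\<close>

lemma ptg_cone_not_in_line:
  assumes a: "a \<in> A" and D: "subspace D" "dim D = 1"
  shows "\<not> ptg_cone A a \<subseteq> D"
proof
  assume sub: "ptg_cone A a \<subseteq> D"
  obtain u v where u: "u \<in> ptg_cone A a" "u \<noteq> 0" "u \<in> bounded_orbit F F' a"
    and v: "v \<in> ptg_cone A a" "v \<noteq> 0" "v \<in> bounded_orbit G G' a"
    using a by (rule bounded_cone_vectors)
  have "D \<subseteq> span {u}"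
    using u sub D by (intro card_ge_dim_independent) auto
  then obtain c where "v = c *\<^sub>R u" using v(1) sub by (auto simp: span_singleton)
  then have "v \<in> bounded_orbit F F' a" using bounded_orbit_scaleR[OF u(3)] by simp
  with transverse[OF a _ v(3)] v(2) show False by blast
qed

end

section \<open>Irregular ordered sets of twist maps\<close>

text \<open>The determinant of the two vectors, that is the form d\<theta> \<and> dr.\<close>

definition area :: "real \<times> real \<Rightarrow> real \<times> real \<Rightarrow> real" where
  "area u v = fst u * snd v - snd u * fst v"

lemma area_scaleR: "area (c *\<^sub>R u) (d *\<^sub>R v) = c * d * area u v"
  by (simp add: area_def algebra_simps)

lemma abs_area_le: "\<bar>area u v\<bar> \<le> 2 * norm u * norm v"
proof -
  have "\<bar>fst u * snd v\<bar> \<le> norm u * norm v" "\<bar>snd u * fst v\<bar> \<le> norm u * norm v"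
    unfolding abs_mult using norm_fst_le[of "fst u" "snd u"] norm_snd_le[of "snd u" "fst u"]
      norm_fst_le[of "fst v" "snd v"] norm_snd_le[of "snd v" "fst v"]
    by (auto intro!: mult_mono)
  then show ?thesis unfolding area_def by linarith
qed

lemma norm_slope_vector: "1 \<le> norm (1 :: real, s :: real)" "norm (1 :: real, s :: real) \<le> 1 + \<bar>s\<bar>"
  using norm_fst_le[of "1::real" s] norm_Pair_le[of "1::real" s] by simp_all

text \<open>Bounded values have convergent subsequences, and the closed graph allows only one limit
  for all of them.\<close>

lemma closed_graph_bounded_imp_continuous_on:
  fixes g :: "'a::metric_space \<Rightarrow> real"
  assumes bound: "\<And>z. z \<in> A \<Longrightarrow> \<bar>g z\<bar> \<le> S"
    and graph: "\<And>x z t. (\<And>k::nat. x k \<in> A) \<Longrightarrow> z \<in> A \<Longrightarrow> x \<longlonglongrightarrow> z \<Longrightarrow> (\<lambda>k. g (x k)) \<longlonglongrightarrow> t \<Longrightarrow> t = g z"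
  shows "continuous_on A g"
proof (rule continuous_on_sequentiallyI)
  fix x z assume x: "\<forall>n::nat. x n \<in> A" "z \<in> A" "x \<longlonglongrightarrow> z"
  show "(\<lambda>n. g (x n)) \<longlonglongrightarrow> g z"
  proof (rule ccontr)
    assume "\<not> ?thesis"
    then obtain e where e: "e > 0" "\<And>N. \<exists>j\<ge>N. dist (g (x j)) (g z) \<ge> e"
      unfolding LIMSEQ_def by (auto simp: not_less)
    then obtain J where J: "\<And>N. J N \<ge> N" "\<And>N. dist (g (x (J N))) (g z) \<ge> e" by metis
    have "bounded (range (\<lambda>n. g (x (J n))))"
      using bound x(1) unfolding bounded_iff by auto
    then obtain t r where r: "strict_mono r" "((\<lambda>n. g (x (J n))) \<circ> r) \<longlonglongrightarrow> t"
      using bounded_imp_convergent_subsequence by blast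
    have "filterlim (\<lambda>k. J (r k)) sequentially sequentially"
      unfolding filterlim_at_top eventually_sequentially
      using J(1) seq_suble[OF r(1)] by (meson order_trans)
    then have "(\<lambda>k. x (J (r k))) \<longlonglongrightarrow> z" by (rule filterlim_compose[OF x(3)])
    then have "t = g z" using x r(2) by (intro graph[of "\<lambda>k. x (J (r k))"]) (auto simp: o_def)
    then have "(\<lambda>k. dist (g (x (J (r k)))) (g z)) \<longlonglongrightarrow> 0"
      using r(2) by (simp add: o_def flip: tendsto_dist_iff)
    then have "e \<le> 0" by (rule LIMSEQ_le_const) (use J in auto)
    with e(1) show False by simp
  qed
qed

text \<open>The splitting in slope coordinates: \<open>(1, s z)\<close> spans the stable line,
  \<open>(1, u z)\<close> the unstable one. Invariance is listed for \<open>F\<close> and for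
  \<open>G\<close>, and the factors \<open>c\<close> carry no sign, so that exchanging
  \<open>F\<close> with \<open>G\<close> and \<open>s\<close> with \<open>u\<close> preserves the
  notion; this transfers the result to negative twist maps.\<close>

definition hyperbolic_slopes ::
  "(real \<times> real \<Rightarrow> real \<times> real) \<Rightarrow> (real \<times> real \<Rightarrow> real \<times> real) \<Rightarrow>
   (real \<times> real \<Rightarrow> (real \<times> real) \<Rightarrow>\<^sub>L (real \<times> real)) \<Rightarrow> (real \<times> real \<Rightarrow> (real \<times> real) \<Rightarrow>\<^sub>L (real \<times> real)) \<Rightarrow>
   (real \<times> real) set \<Rightarrow> (real \<times> real \<Rightarrow> real) \<Rightarrow> (real \<times> real \<Rightarrow> real) \<Rightarrow> real \<Rightarrow> real \<Rightarrow> bool" where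
  "hyperbolic_slopes F G F' G' A s u C \<mu> \<longleftrightarrow> C > 0 \<and> 0 < \<mu> \<and> \<mu> < 1 \<and> continuous_on A s \<and> continuous_on A u \<and>
     (\<forall>z\<in>A. s z \<noteq> u z \<and> (\<forall>m. s (shift m z) = s z \<and> u (shift m z) = u z) \<and>
        (\<exists>c. F' z (1, s z) = c *\<^sub>R (1, s (F z))) \<and> (\<exists>c. F' z (1, u z) = c *\<^sub>R (1, u (F z))) \<and>
        (\<exists>c. G' z (1, s z) = c *\<^sub>R (1, s (G z))) \<and> (\<exists>c. G' z (1, u z) = c *\<^sub>R (1, u (G z))) \<and>
        (\<forall>n. norm (cocycle F F' n z (1, s z)) \<le> C * \<mu> ^ n) \<and>
        (\<forall>n. norm (cocycle G G' n z (1, u z)) \<le> C * \<mu> ^ n))"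

lemma hyperbolic_slopes_inverse:
  "hyperbolic_slopes F G F' G' A s u C \<mu> \<Longrightarrow> hyperbolic_slopes G F G' F' A u s C \<mu>"
  unfolding hyperbolic_slopes_def by metis

text \<open>Positive twist in infinitesimal form; a negative twist map is handled with
  \<open>F\<close> and \<open>G\<close> exchanged.\<close>

locale irregular_twist_set = lifted_ordered_set +
  assumes twist: "fst (F' z (0, 1)) > 0" "fst (G' z (0, 1)) < 0"
    and area_preserving: "area (F' z v) (F' z w) = area v w"
    and irregular: "z \<in> A \<Longrightarrow> subspace D \<Longrightarrow> dim D = 1 \<Longrightarrow> \<not> ptg_cone A z \<subseteq> D"
begin

sublocale inv: lifted_ordered_set G F G' F' A by (rule lifted_ordered_set_inverse)

text \<open>The twist tilts an upward vertical vector to the right under \<open>F\<close> and to the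
  left under \<open>G\<close>. Close pairs with nearly such a difference would have images and
  preimages in opposite order, although both orders agree with that of the pair itself.\<close>

lemma cone_not_vertical:
  assumes v: "v \<in> ptg_cone A z" and "fst v = 0"
  shows "v = 0"
proof -
  have False if v: "v \<in> ptg_cone A z" "fst v = 0" "snd v > 0" for v
  proof -
    obtain a b t where s: "\<And>n::nat. a n \<in> A" "\<And>n. b n \<in> A" "\<And>n. (t n :: real) > 0"
      "a \<longlonglongrightarrow> z" "b \<longlonglongrightarrow> z" "t \<longlonglongrightarrow> 0" "(\<lambda>n. (a n - b n) /\<^sub>R t n) \<longlonglongrightarrow> v"
      using v(1) by (rule ptg_cone_sequentially) blast
    have veq: "v = snd v *\<^sub>R (0, 1)" using v(2) by (simp add: prod_eq_iff)
    have "fst (F' z v) > 0"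
      using twist(1)[of z] v(3) by (subst veq) (simp add: blinfun.scaleR_right del: scaleR_Pair)
    moreover have "(\<lambda>n. fst ((F (a n) - F (b n)) /\<^sub>R t n)) \<longlonglongrightarrow> fst (F' z v)"
      using tendsto_fst[OF iter_quotient_tendsto[OF s(4,5,7), of 1]] by simp
    ultimately have "\<forall>\<^sub>F n in sequentially. 0 < fst ((F (a n) - F (b n)) /\<^sub>R t n)"
      by (rule order_tendstoD(1)[rotated])
    moreover have "\<forall>\<^sub>F n in sequentially. fst ((G (a n) - G (b n)) /\<^sub>R t n) < 0"
    proof (rule order_tendstoD(2))
      show "(\<lambda>n. fst ((G (a n) - G (b n)) /\<^sub>R t n)) \<longlonglongrightarrow> fst (G' z v)"
        using tendsto_fst[OF inv.iter_quotient_tendsto[OF s(4,5,7), of 1]] by simp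
      show "fst (G' z v) < 0"
        using twist(2)[of z] v(3) by (subst veq) (simp add: blinfun.scaleR_right mult_pos_neg del: scaleR_Pair)
    qed
    ultimately have "\<forall>\<^sub>F n in sequentially. False"
    proof eventually_elim
      case (elim n)
      from elim(1) have "fst (F (b n)) < fst (F (a n))" using s(3)[of n] by (simp add: zero_less_mult_iff)
      then have "fst (b n) < fst (a n)" using order s by blast
      moreover from elim(2) have "fst (G (a n)) < fst (G (b n))" using s(3)[of n] by (simp add: mult_less_0_iff)
      then have "fst (a n) < fst (b n)" using inv.order s by blast
      ultimately show ?case by simp
    qed
    then show False by simp
  qed
  from this[OF v] this[OF ptg_cone_scaleR[OF v, of "-1"]] \<open>fst v = 0\<close>
  show ?thesis by (cases "snd v" "0 :: real" rule: linorder_cases) (auto simp: prod_eq_iff)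
qed

text \<open>Order preservation survives the limit only as a weak inequality; equality would make the
  image a vertical cone vector, hence zero, against the injectivity of \<open>F' z\<close>.\<close>

lemma cone_orientation:
  assumes v: "v \<in> ptg_cone A z" and "fst v > 0"
  shows "fst (F' z v) > 0"
proof -
  obtain a b t where s: "\<And>n::nat. a n \<in> A" "\<And>n. b n \<in> A" "\<And>n. (t n :: real) > 0"
    "a \<longlonglongrightarrow> z" "b \<longlonglongrightarrow> z" "t \<longlonglongrightarrow> 0" "(\<lambda>n. (a n - b n) /\<^sub>R t n) \<longlonglongrightarrow> v"
    using v by (rule ptg_cone_sequentially) blast
  have "\<forall>\<^sub>F n in sequentially. 0 < fst ((a n - b n) /\<^sub>R t n)"
    using tendsto_fst[OF s(7)] \<open>fst v > 0\<close> by (rule order_tendstoD)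
  then have ev: "\<forall>\<^sub>F n in sequentially. 0 \<le> fst ((F (a n) - F (b n)) /\<^sub>R t n)"
  proof eventually_elim
    case (elim n)
    then have "fst (b n) < fst (a n)" using s(3)[of n] by (simp add: zero_less_mult_iff)
    then have "fst (F (b n)) < fst (F (a n))" using order s by blast
    then show ?case using s(3)[of n] by (simp add: zero_le_mult_iff)
  qed
  have "(\<lambda>n. fst ((F (a n) - F (b n)) /\<^sub>R t n)) \<longlonglongrightarrow> fst (F' z v)"
    using tendsto_fst[OF iter_quotient_tendsto[OF s(4,5,7), of 1]] by simp
  then have "0 \<le> fst (F' z v)" using ev by (rule tendsto_lowerbound) simp
  moreover have "fst (F' z v) \<noteq> 0"
  proof
    assume "fst (F' z v) = 0"
    with cone_not_vertical[OF ptg_cone_image[OF v]] have "F' z v = 0" by simp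
    then have "v = 0" using G'_F'[of z v] by (simp add: blinfun.zero_right)
    with \<open>fst v > 0\<close> show False by simp
  qed
  ultimately show ?thesis by simp
qed

text \<open>As the cone is closed under scaling and contains no nonzero vertical vector, its nonzero
  vectors are determined by this set.\<close>

definition slopes :: "real \<times> real \<Rightarrow> real set" where
  "slopes z = {s. (1, s) \<in> ptg_cone A z}"

lemma cone_slope: "v \<in> ptg_cone A z \<Longrightarrow> v \<noteq> 0 \<Longrightarrow> fst v \<noteq> 0 \<and> snd v / fst v \<in> slopes z"
proof
  assume v: "v \<in> ptg_cone A z" "v \<noteq> 0"
  then show "fst v \<noteq> 0" using cone_not_vertical by blast
  then have "(1, snd v / fst v) = (1 / fst v) *\<^sub>R v" by (simp add: prod_eq_iff)
  then show "snd v / fst v \<in> slopes z" using v(1) by (simp add: slopes_def ptg_cone_scaleR)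
qed

lemma slopes_shift: "slopes (shift m z) = slopes z"
  by (simp add: slopes_def ptg_cone_shift)

lemma slopes_limit:
  assumes "\<And>k::nat. s k \<in> slopes (z k)" "z \<longlonglongrightarrow> z0" "s \<longlonglongrightarrow> t"
  shows "t \<in> slopes z0"
proof -
  have "(\<lambda>k. (1, s k)) \<longlonglongrightarrow> (1, t)" by (intro tendsto_intros assms)
  with assms(2) have "(1, t) \<in> ptg_cone A z0"
    by (rule ptg_cone_closed_graph[rotated]) (use assms(1) in \<open>simp add: slopes_def\<close>)
  then show ?thesis by (simp add: slopes_def)
qed

text \<open>Unbounded slopes, normalised to unit vectors, would subconverge to a vertical vector in
  some cone.\<close>

lemma slopes_bounded: obtains S where "S > 0" "\<And>z s. z \<in> A \<Longrightarrow> s \<in> slopes z \<Longrightarrow> \<bar>s\<bar> \<le> S"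
proof -
  have "\<exists>S. \<forall>z\<in>A. \<forall>s\<in>slopes z. \<bar>s\<bar> \<le> S"
  proof (rule ccontr)
    assume "\<not> ?thesis"
    then have "\<forall>k::nat. \<exists>z\<in>A. \<exists>s\<in>slopes z. \<bar>s\<bar> > real k" by (meson not_le)
    then obtain z s where zs: "\<And>k. z k \<in> A" "\<And>k. s k \<in> slopes (z k)" "\<And>k. \<bar>s k\<bar> > real k" by metis
    obtain r :: "nat \<Rightarrow> nat" and m z0 where r: "strict_mono r" "z0 \<in> A" "(\<lambda>k. shift (m k) (z (r k))) \<longlonglongrightarrow> z0"
      using zs(1) by (rule compactness)
    define w where "w k = (1 :: real, s (r k)) /\<^sub>R norm (1 :: real, s (r k))" for k
    have pos: "norm (1 :: real, s (r k)) > 0" for k using norm_slope_vector(1)[of "s (r k)"] by linarith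
    have "w k \<in> sphere 0 1" for k using pos[of k] by (simp add: w_def del: scaleR_Pair)
    then obtain v q where v: "v \<in> sphere 0 1" "strict_mono (q :: nat \<Rightarrow> nat)" "(w \<circ> q) \<longlonglongrightarrow> v"
      using compact_sphere[of "0 :: real \<times> real" 1] unfolding compact_def by blast
    have "w k \<in> ptg_cone A (shift (m k) (z (r k)))" for k
      unfolding w_def ptg_cone_shift using zs(2)[of "r k"] by (intro ptg_cone_scaleR) (simp add: slopes_def)
    then have "v \<in> ptg_cone A z0"
      by (intro ptg_cone_closed_graph[OF _ LIMSEQ_subseq_LIMSEQ[OF r(3) v(2)] v(3)]) simp
    moreover have "fst v = 0"
    proof -
      have w_le: "\<bar>fst (w k)\<bar> \<le> 2 / real (Suc k)" for k
      proof -
        have "\<bar>s (r k)\<bar> \<le> norm (1 :: real, s (r k))" using norm_snd_le[of "s (r k)" "1::real"] by simp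
        then have "real k \<le> norm (1 :: real, s (r k))"
          using zs(3)[of "r k"] seq_suble[OF r(1), of k] by linarith
        moreover note norm_slope_vector(1)[of "s (r k)"]
        ultimately have "real (Suc k) / 2 \<le> norm (1 :: real, s (r k))" by simp
        then have "inverse (norm (1 :: real, s (r k))) \<le> inverse (real (Suc k) / 2)"
          by (rule le_imp_inverse_le) simp
        moreover have "\<bar>fst (w k)\<bar> = inverse (norm (1 :: real, s (r k)))"
          using pos[of k] by (simp add: w_def)
        ultimately show ?thesis by (simp only: inverse_divide)
      qed
      have "(\<lambda>k. \<bar>fst (w k)\<bar>) \<longlonglongrightarrow> 0"
        by (rule tendsto_sandwich[OF _ _ tendsto_const LIMSEQ_Suc[OF lim_const_over_n[of 2]]])
          (intro always_eventually allI abs_ge_zero w_le)+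
      then have "(\<lambda>k. fst (w k)) \<longlonglongrightarrow> 0" by (simp add: tendsto_rabs_zero_iff)
      from LIMSEQ_subseq_LIMSEQ[OF this v(2)] have "(\<lambda>k. fst ((w \<circ> q) k)) \<longlonglongrightarrow> 0" by (simp add: o_def)
      with tendsto_fst[OF v(3)] show ?thesis using LIMSEQ_unique by blast
    qed
    ultimately have "v = 0" by (rule cone_not_vertical)
    with v(1) show False by simp
  qed
  then obtain S where S: "\<And>z s. z \<in> A \<Longrightarrow> s \<in> slopes z \<Longrightarrow> \<bar>s\<bar> \<le> S" by blast
  show thesis by (rule that[of "max S 1"]) (use S in fastforce)+
qed

lemma two_slopes:
  assumes "z \<in> A" obtains s t where "s \<in> slopes z" "t \<in> slopes z" "s \<noteq> t"
proof -
  have *: "\<exists>t\<in>slopes z. t \<noteq> s" for s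
  proof -
    have "dim (span {(1 :: real, s)}) = 1" by (simp add: dim_singleton zero_prod_def)
    then obtain v where v: "v \<in> ptg_cone A z" "v \<notin> span {(1, s)}"
      using irregular[OF assms subspace_span] by blast
    then have "v \<noteq> 0" by (metis span_zero)
    with cone_slope[OF v(1)] have t: "fst v \<noteq> 0" "snd v / fst v \<in> slopes z" by auto
    have "snd v / fst v \<noteq> s"
    proof
      assume "snd v / fst v = s"
      then have "v = fst v *\<^sub>R (1, s)" using t(1) by (auto simp: prod_eq_iff)
      then have "v \<in> span {(1, s)}" by (metis span_base span_scale singletonI)
      with v(2) show False by simp
    qed
    with t(2) show ?thesis by blast
  qed
  \<comment> \<open>Irregularity is applied twice: against the horizontal line to find one slope at
    all, then against the line of that slope to find another.\<close>
  from *[of 0] obtain s where "s \<in> slopes z" by blast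
  with *[of s] that show thesis by blast
qed

definition smax :: "real \<times> real \<Rightarrow> real" where "smax z = Sup (slopes z)"
definition smin :: "real \<times> real \<Rightarrow> real" where "smin z = Inf (slopes z)"

lemma smax_smin:
  assumes "z \<in> A"
  shows "smax z \<in> slopes z" "smin z \<in> slopes z" "s \<in> slopes z \<Longrightarrow> smin z \<le> s \<and> s \<le> smax z" "smin z < smax z"
proof -
  obtain S where S: "\<And>s. s \<in> slopes z \<Longrightarrow> \<bar>s\<bar> \<le> S" using slopes_bounded assms by metis
  obtain s1 s2 where s12: "s1 \<in> slopes z" "s2 \<in> slopes z" "s1 \<noteq> s2" using two_slopes[OF assms] by blast
  have cl: "closed (slopes z)"
    unfolding closed_sequential_limits
    by (intro allI impI; elim conjE; rule slopes_limit[of _ "\<lambda>k. z"]) auto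
  have b: "bdd_above (slopes z)" "bdd_below (slopes z)"
    using S by (auto intro!: bdd_aboveI[of _ S] bdd_belowI[of _ "-S"] dest: S simp: abs_le_iff)
  show "smax z \<in> slopes z" "smin z \<in> slopes z"
    unfolding smax_def smin_def using s12 b cl by (auto intro: closed_contains_Sup closed_contains_Inf)
  show le: "smin z \<le> s \<and> s \<le> smax z" if "s \<in> slopes z" for s
    unfolding smax_def smin_def using that b by (auto intro: cSup_upper cInf_lower)
  show "smin z < smax z" using le[OF s12(1)] le[OF s12(2)] s12(3) by linarith
qed

lemma smax_shift: "smax (shift m z) = smax z" and smin_shift: "smin (shift m z) = smin z"
  by (simp_all add: smax_def smin_def slopes_shift)

end

section \<open>Extreme slopes, growth factors and the width\<close>

context irregular_twist_set
begin

text \<open>The derivative acts on \<open>(1, s)\<close> through this factor and the projective map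
  \<open>slope_map\<close>.\<close>

definition growth :: "real \<times> real \<Rightarrow> real \<Rightarrow> real" where
  "growth z s = fst (F' z (1, s))"

definition slope_map :: "real \<times> real \<Rightarrow> real \<Rightarrow> real" where
  "slope_map z s = snd (F' z (1, s)) / fst (F' z (1, s))"

lemma slopes_image:
  assumes "s \<in> slopes z"
  shows "growth z s > 0" "slope_map z s \<in> slopes (F z)" "F' z (1, s) = growth z s *\<^sub>R (1, slope_map z s)"
proof -
  have c: "(1, s) \<in> ptg_cone A z" using assms by (simp add: slopes_def)
  then show g: "growth z s > 0" unfolding growth_def by (rule cone_orientation) simp
  show "slope_map z s \<in> slopes (F z)"
    using cone_slope[OF ptg_cone_image[OF c]] g unfolding slope_map_def growth_def by force
  show "F' z (1, s) = growth z s *\<^sub>R (1, slope_map z s)"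
    using g by (simp add: prod_eq_iff growth_def slope_map_def)
qed

text \<open>Preservation of area in slope coordinates: the vectors \<open>(1, s)\<close> and
  \<open>(1, t)\<close> span the area \<open>t - s\<close>.\<close>

lemma area_slopes:
  assumes "s \<in> slopes z" "t \<in> slopes z"
  shows "growth z s * growth z t * (slope_map z t - slope_map z s) = t - s"
proof -
  have "area (F' z (1, s)) (F' z (1, t)) = area (1, s) (1, t)" by (rule area_preserving)
  then show ?thesis
    unfolding slopes_image(3)[OF assms(1)] slopes_image(3)[OF assms(2)] area_scaleR
    by (simp add: area_def)
qed

lemma slope_map_mono:
  assumes "s \<in> slopes z" "t \<in> slopes z" "s \<le> t"
  shows "slope_map z s \<le> slope_map z t"
proof -
  have "0 \<le> growth z s * growth z t * (slope_map z t - slope_map z s)"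
    using area_slopes[OF assms(1,2)] assms(3) by simp
  moreover have "growth z s * growth z t > 0"
    using slopes_image(1) assms by simp
  ultimately show ?thesis by (simp add: zero_le_mult_iff)
qed

text \<open>The inverse derivative maps the cone at \<open>F z\<close> into the cone at
  \<open>z\<close>. Being monotone and onto, \<open>slope_map\<close> sends extreme slopes to
  extreme slopes.\<close>

lemma slope_map_surj:
  assumes "t \<in> slopes (F z)"
  obtains s where "s \<in> slopes z" "slope_map z s = t"
proof -
  have "G' (F z) (1, t) \<in> ptg_cone A (G (F z))"
    using assms by (intro inv.ptg_cone_image) (simp add: slopes_def)
  then have c: "G' (F z) (1, t) \<in> ptg_cone A z" by simp
  have F: "F' z (G' (F z) (1, t)) = (1, t)" using F'_G'[of "F z"] by simp
  then have "G' (F z) (1, t) \<noteq> 0" by (metis blinfun.zero_right fst_conv fst_zero zero_neq_one)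
  with cone_slope[OF c] have s: "fst (G' (F z) (1, t)) \<noteq> 0"
    "snd (G' (F z) (1, t)) / fst (G' (F z) (1, t)) \<in> slopes z" by auto
  define c where "c = fst (G' (F z) (1, t))"
  have "(1, snd (G' (F z) (1, t)) / c) = (1 / c) *\<^sub>R G' (F z) (1, t)"
    using s(1) by (simp add: prod_eq_iff c_def)
  then have "F' z (1, snd (G' (F z) (1, t)) / c) = (1 / c) *\<^sub>R (1, t)"
    by (simp only: blinfun.scaleR_right F)
  then have "slope_map z (snd (G' (F z) (1, t)) / c) = t"
    using s(1) by (simp add: slope_map_def c_def)
  with s(2)[folded c_def] show thesis by (rule that)
qed

lemma slope_map_smax:
  assumes "z \<in> A" shows "slope_map z (smax z) = smax (F z)"
proof (rule antisym)
  note z = smax_smin[OF assms] and Fz = smax_smin[OF F_mem[OF assms]]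
  show "slope_map z (smax z) \<le> smax (F z)" using Fz(3) slopes_image(2)[OF z(1)] by blast
  obtain s where "s \<in> slopes z" "slope_map z s = smax (F z)" using Fz(1) by (rule slope_map_surj)
  with slope_map_mono[of s z "smax z"] z show "smax (F z) \<le> slope_map z (smax z)" by metis
qed

lemma slope_map_smin:
  assumes "z \<in> A" shows "slope_map z (smin z) = smin (F z)"
proof (rule antisym)
  note z = smax_smin[OF assms] and Fz = smax_smin[OF F_mem[OF assms]]
  show "smin (F z) \<le> slope_map z (smin z)" using Fz(3) slopes_image(2)[OF z(2)] by blast
  obtain s where "s \<in> slopes z" "slope_map z s = smin (F z)" using Fz(2) by (rule slope_map_surj)
  with slope_map_mono[of "smin z" z s] z show "slope_map z (smin z) \<le> smin (F z)" by metis
qed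

definition width :: "real \<times> real \<Rightarrow> real" where "width z = smax z - smin z"

lemma width_pos: "z \<in> A \<Longrightarrow> width z > 0"
  using smax_smin(4) by (simp add: width_def)

lemma width_shift: "width (shift m z) = width z"
  by (simp add: width_def smax_shift smin_shift)

lemma width_F:
  assumes "z \<in> A" shows "growth z (smin z) * growth z (smax z) * width (F z) = width z"
  using area_slopes[OF smax_smin(2)[OF assms] smax_smin(1)[OF assms]] assms
  by (simp add: slope_map_smax slope_map_smin width_def)

lemma growth_bounded:
  obtains \<Lambda> where "\<Lambda> > 0" "\<And>z s. z \<in> A \<Longrightarrow> s \<in> slopes z \<Longrightarrow> growth z s \<le> \<Lambda>"
proof -
  obtain S where S: "S > 0" "\<And>z s. z \<in> A \<Longrightarrow> s \<in> slopes z \<Longrightarrow> \<bar>s\<bar> \<le> S" by (rule slopes_bounded) blast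
  obtain L where L: "L > 0" "\<And>z v. z \<in> A \<Longrightarrow> norm (F' z v) \<le> L * norm v" by (rule F'_bound) blast
  show thesis
  proof (rule that[of "L * (1 + S)"])
    fix z s assume z: "z \<in> A" "s \<in> slopes z"
    have "growth z s \<le> norm (F' z (1, s))"
      using norm_fst_le[of "fst (F' z (1, s))" "snd (F' z (1, s))"] by (simp add: growth_def)
    also have "\<dots> \<le> L * norm (1 :: real, s)" using L z by blast
    also have "\<dots> \<le> L * (1 + S)"
      using norm_slope_vector(2)[of s] S(2)[OF z] L(1) by (intro mult_left_mono) auto
    finally show "growth z s \<le> L * (1 + S)" .
  qed (use L S in simp)
qed

text \<open>
  Since \<open>smax\<close> is upper and \<open>smin\<close> lower semicontinuous, the sets \<open>width \<ge> \<epsilon>\<close> are closed, so by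
  the Baire property one of them has interior, and minimality carries its bound everywhere.
\<close>

lemma width_ge_closed: "closed {z \<in> A. width z \<ge> e}"
  unfolding closed_sequential_limits
proof (intro allI impI; elim conjE)
  fix z z0 assume z: "\<forall>n::nat. z n \<in> {z \<in> A. width z \<ge> e}" and lim: "z \<longlonglongrightarrow> z0"
  have z0: "z0 \<in> A" using z by (intro closed_sequentially[OF A_closed _ lim]) simp
  obtain S where S: "\<And>z s. z \<in> A \<Longrightarrow> s \<in> slopes z \<Longrightarrow> \<bar>s\<bar> \<le> S" by (rule slopes_bounded) blast
  define p where "p n = (smax (z n), smin (z n))" for n
  have "p n \<in> cbox (-S, -S) (S, S)" for n
    using S[OF _ smax_smin(1), of "z n"] S[OF _ smax_smin(2), of "z n"] z
    by (auto simp: p_def cbox_Pair_eq abs_le_iff minus_le_iff)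
  then obtain l r where r: "strict_mono (r :: nat \<Rightarrow> nat)" "(p \<circ> r) \<longlonglongrightarrow> l"
    using compact_cbox[of "(-S, -S)" "(S, S)"] unfolding compact_def by blast
  have zr: "(\<lambda>n. z (r n)) \<longlonglongrightarrow> z0" using LIMSEQ_subseq_LIMSEQ[OF lim r(1)] by (simp add: o_def)
  have 1: "(\<lambda>n. smax (z (r n))) \<longlonglongrightarrow> fst l" and 2: "(\<lambda>n. smin (z (r n))) \<longlonglongrightarrow> snd l"
    using tendsto_fst[OF r(2)] tendsto_snd[OF r(2)] by (simp_all add: o_def p_def)
  have "fst l \<in> slopes z0" "snd l \<in> slopes z0"
    by (rule slopes_limit[OF _ zr 1] slopes_limit[OF _ zr 2]; use smax_smin(1,2) z in blast)+
  then have "fst l - snd l \<le> width z0"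
    using smax_smin(3)[OF z0, of "fst l"] smax_smin(3)[OF z0, of "snd l"] by (simp add: width_def)
  moreover have "e \<le> fst l - snd l"
    by (rule LIMSEQ_le_const[OF tendsto_diff[OF 1 2]]) (use z in \<open>auto simp: width_def\<close>)
  ultimately show "z0 \<in> {z \<in> A. width z \<ge> e}" using z0 by simp
qed

lemma width_locally_bounded_below:
  obtains a U e where "a \<in> A" "a \<in> U" "open U" "e > 0" "\<And>z. z \<in> A \<Longrightarrow> z \<in> U \<Longrightarrow> width z \<ge> e"
proof -
  define W where "W n = {z \<in> A. width z \<ge> inverse (real (Suc n))}" for n
  \<comment> \<open>If every \<open>A - W n\<close> were dense in \<open>A\<close>, so would be
    their intersection, which is empty because every width is positive.\<close>
  have "\<exists>n. \<not> A \<subseteq> closure (A - W n)"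
  proof (rule ccontr)
    assume "\<not> ?thesis"
    then have "A \<subseteq> closure (\<Inter> (range (\<lambda>n. A - W n)))"
    proof (intro Baire[OF A_closed] conjI)
      fix T assume "T \<in> range (\<lambda>n. A - W n)"
      then obtain n where "T = A - W n" by blast
      moreover have "openin (top_of_set A) (A - W n)"
        using width_ge_closed by (auto simp: openin_open W_def intro!: exI[of _ "- {z \<in> A. inverse (real (Suc n)) \<le> width z}"])
      ultimately show "openin (top_of_set A) T" by simp
    qed auto
    moreover have "\<Inter> (range (\<lambda>n. A - W n)) = {}"
    proof -
      have "\<exists>n. z \<in> W n" if z: "z \<in> A" for z
      proof -
        obtain n where "inverse (real (Suc n)) < width z"
          using reals_Archimedean[OF width_pos[OF z]] by blast
        with z show ?thesis by (auto simp: W_def intro: less_imp_le)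
      qed
      then show ?thesis by blast
    qed
    ultimately show False using A_nonempty by (metis closure_empty subset_empty)
  qed
  then obtain n a where a: "a \<in> A" "a \<notin> closure (A - W n)" by blast
  show thesis
  proof (rule that[of a "- closure (A - W n)" "inverse (real (Suc n))"])
    show "inverse (real (Suc n)) \<le> width z" if "z \<in> A" "z \<in> - closure (A - W n)" for z
      using that closure_subset[of "A - W n"] by (auto simp: W_def)
  qed (use a in auto)
qed

text \<open>Along a forward orbit the width shrinks at most by the factor
  \<open>\<Lambda>\<^sup>2\<close> per step, so a point reached in \<open>j\<close> steps from the
  good open set keeps a definite width. Near a limit of points with vanishing width a single
  \<open>j\<close> serves all of them.\<close>

lemma width_bounded_below:
  obtains d where "d > 0" "\<And>z. z \<in> A \<Longrightarrow> width z \<ge> d"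
proof -
  obtain \<Lambda> where \<Lambda>: "\<Lambda> > 0" "\<And>z s. z \<in> A \<Longrightarrow> s \<in> slopes z \<Longrightarrow> growth z s \<le> \<Lambda>" by (rule growth_bounded) blast
  obtain a U e where U: "a \<in> A" "a \<in> U" "open U" "e > 0" "\<And>z. z \<in> A \<Longrightarrow> z \<in> U \<Longrightarrow> width z \<ge> e"
    by (rule width_locally_bounded_below) blast
  have iter: "width y \<le> (\<Lambda>\<^sup>2) ^ j * width ((F ^^ j) y)" if "y \<in> A" for y j
  proof (induction j)
    case (Suc j)
    let ?y = "(F ^^ j) y"
    have y: "?y \<in> A" using that by (rule iter_mem)
    have "growth ?y (smin ?y) > 0" "growth ?y (smax ?y) > 0"
      using slopes_image(1) smax_smin(1,2)[OF y] by blast+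
    then have "growth ?y (smin ?y) * growth ?y (smax ?y) \<le> \<Lambda> * \<Lambda>"
      using \<Lambda> smax_smin(1,2)[OF y] y by (intro mult_mono) auto
    then have "width ?y \<le> \<Lambda>\<^sup>2 * width (F ?y)"
      unfolding width_F[OF y, symmetric] power2_eq_square
      by (rule mult_right_mono) (use width_pos[OF F_mem[OF y]] in simp)
    then have "(\<Lambda>\<^sup>2) ^ j * width ?y \<le> (\<Lambda>\<^sup>2) ^ j * (\<Lambda>\<^sup>2 * width (F ?y))" by (rule mult_left_mono) simp
    with Suc show ?case by (simp add: mult_ac)
  qed simp
  have "\<exists>d>0. \<forall>z\<in>A. width z \<ge> d"
  proof (rule ccontr)
    assume neg: "\<not> ?thesis"
    have "\<forall>k. \<exists>z\<in>A. width z < inverse (real (Suc k))"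
    proof
      fix k
      have "inverse (real (Suc k)) > 0" by simp
      with neg show "\<exists>z\<in>A. width z < inverse (real (Suc k))" by (meson not_le)
    qed
    then obtain z where z: "\<And>k. z k \<in> A" "\<And>k. width (z k) < inverse (real (Suc k))" by metis
    obtain r :: "nat \<Rightarrow> nat" and m z0 where r: "strict_mono r" "z0 \<in> A" "(\<lambda>k. shift (m k) (z (r k))) \<longlonglongrightarrow> z0"
      using z(1) by (rule compactness)
    obtain h where h: "h > 0" "ball a h \<subseteq> U" using U(2,3) openE by blast
    \<comment> \<open>The backward orbit of \<open>z0\<close> enters the open set, and by continuity
      the same number of steps brings nearby points there as well.\<close>
    obtain j n where j: "dist (shift n ((G ^^ j) z0)) a < h"
      using inv.orbit_dense[OF r(2) U(1) h(1)] by metis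
    have "(\<lambda>k. shift n ((G ^^ j) (shift (m k) (z (r k))))) \<longlonglongrightarrow> shift n ((G ^^ j) z0)"
      by (intro tendsto_shift inv.iter_tendsto r)
    moreover have "shift n ((G ^^ j) z0) \<in> U" using j h(2) by (auto simp: dist_commute)
    ultimately have ev: "\<forall>\<^sub>F k in sequentially. shift n ((G ^^ j) (shift (m k) (z (r k)))) \<in> U"
      using U(3) topological_tendstoD by blast
    have "\<forall>\<^sub>F k in sequentially. e \<le> (\<Lambda>\<^sup>2) ^ j * inverse (real (Suc k))"
      using ev
    proof eventually_elim
      case (elim k)
      have "shift n ((G ^^ j) (shift (m k) (z (r k)))) \<in> A" using z(1) A_shift inv.iter_mem by blast
      from U(5)[OF this elim] have "e \<le> width ((G ^^ j) (z (r k)))"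
        by (simp add: inv.iter_shift width_shift)
      also have "\<dots> \<le> (\<Lambda>\<^sup>2) ^ j * width (z (r k))"
        using iter[OF inv.iter_mem[OF z(1)[of "r k"], of j], of j] by simp
      also have "\<dots> \<le> (\<Lambda>\<^sup>2) ^ j * inverse (real (Suc k))"
      proof (rule mult_left_mono)
        have "inverse (real (Suc (r k))) \<le> inverse (real (Suc k))"
          using seq_suble[OF r(1), of k] by (intro le_imp_inverse_le) auto
        with z(2)[of "r k"] show "width (z (r k)) \<le> inverse (real (Suc k))" by linarith
      qed simp
      finally show ?case .
    qed
    moreover have "(\<lambda>k. (\<Lambda>\<^sup>2) ^ j * inverse (real (Suc k))) \<longlonglongrightarrow> (\<Lambda>\<^sup>2) ^ j * 0"
      by (intro tendsto_intros LIMSEQ_inverse_real_of_nat)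
    ultimately have "e \<le> (\<Lambda>\<^sup>2) ^ j * 0" by (intro tendsto_lowerbound[of _ _ sequentially]) auto
    with U(4) show False by simp
  qed
  then show thesis using that by blast
qed

lemma twist_bounded_below:
  obtains b where "b > 0" "\<And>z. z \<in> A \<Longrightarrow> fst (F' z (0, 1)) \<ge> b"
proof -
  have "\<exists>b>0. \<forall>z\<in>A. fst (F' z (0, 1)) \<ge> b"
  proof (rule ccontr)
    assume neg: "\<not> ?thesis"
    have "\<forall>k. \<exists>z\<in>A. fst (F' z (0, 1)) < inverse (real (Suc k))"
    proof
      fix k
      have "inverse (real (Suc k)) > 0" by simp
      with neg show "\<exists>z\<in>A. fst (F' z (0, 1)) < inverse (real (Suc k))" by (meson not_le)
    qed
    then obtain z where z: "\<And>k. z k \<in> A" "\<And>k. fst (F' (z k) (0, 1)) < inverse (real (Suc k))" by metis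
    obtain r :: "nat \<Rightarrow> nat" and m z0 where r: "strict_mono r" "z0 \<in> A" "(\<lambda>k. shift (m k) (z (r k))) \<longlonglongrightarrow> z0"
      using z(1) by (rule compactness)
    have "(\<lambda>k. F' (shift (m k) (z (r k)))) \<longlonglongrightarrow> F' z0"
      using continuous_on_tendsto_compose[OF F'_cont r(3)] by simp
    then have "(\<lambda>k. fst (F' (z (r k)) (0, 1))) \<longlonglongrightarrow> fst (F' z0 (0, 1))"
      unfolding F'_shift by (intro tendsto_intros)
    moreover have "(\<lambda>k. inverse (real (Suc (r k)))) \<longlonglongrightarrow> 0"
      using LIMSEQ_subseq_LIMSEQ[OF LIMSEQ_inverse_real_of_nat r(1)] by (simp add: o_def)
    ultimately have "fst (F' z0 (0, 1)) \<le> 0"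
      by (rule LIMSEQ_le) (use z(2) less_imp_le in blast)
    with twist(1)[of z0] show False by simp
  qed
  then show thesis using that by blast
qed

text \<open>\<open>growth z s\<close> is affine in \<open>s\<close> with slope
  \<open>fst (F' z (0, 1))\<close>, so the two factors differ by at least \<open>b * d\<close>;
  division by the upper bound \<Lambda> of the smaller one gives
  \<open>\<kappa> = 1 + b * d / \<Lambda>\<close>.\<close>

lemma growth_ratio:
  obtains \<kappa> where "\<kappa> > 1" "\<And>z. z \<in> A \<Longrightarrow> \<kappa> * growth z (smin z) \<le> growth z (smax z)"
proof -
  obtain \<Lambda> where \<Lambda>: "\<Lambda> > 0" "\<And>z s. z \<in> A \<Longrightarrow> s \<in> slopes z \<Longrightarrow> growth z s \<le> \<Lambda>" by (rule growth_bounded) blast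
  obtain d where d: "d > 0" "\<And>z. z \<in> A \<Longrightarrow> width z \<ge> d" by (rule width_bounded_below) blast
  obtain b where b: "b > 0" "\<And>z. z \<in> A \<Longrightarrow> fst (F' z (0, 1)) \<ge> b" by (rule twist_bounded_below) blast
  show thesis
  proof (rule that[of "1 + b * d / \<Lambda>"])
    fix z assume z: "z \<in> A"
    have eq: "(1, smax z) = (1, smin z) + width z *\<^sub>R (0, 1)" by (simp add: width_def)
    have "growth z (smax z) = growth z (smin z) + width z * fst (F' z (0, 1))"
      unfolding growth_def by (subst eq) (simp add: blinfun.add_right blinfun.scaleR_right del: scaleR_Pair add_Pair)
    moreover have "b * d / \<Lambda> * growth z (smin z) \<le> b * d / \<Lambda> * \<Lambda>"
      using \<Lambda> b(1) d(1) smax_smin(2) z by (intro mult_left_mono) auto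
    moreover have "d * b \<le> width z * fst (F' z (0, 1))"
      using b d z width_pos[OF z] by (intro mult_mono) auto
    ultimately show "(1 + b * d / \<Lambda>) * growth z (smin z) \<le> growth z (smax z)"
      using \<Lambda>(1) by (simp add: algebra_simps)
  qed (use b d \<Lambda> in simp)
qed

lemma area_cocycle: "area (cocycle F F' n z v) (cocycle F F' n z w) = area v w"
  by (induction n) (simp_all add: area_preserving)

lemma area_cocycle_inverse: "area (cocycle G G' n z v) (cocycle G G' n z w) = area v w"
proof -
  have "area (G' z v) (G' z w) = area v w" for z v w
    using area_preserving[of "G z" "G' z v" "G' z w"] by simp
  then show ?thesis by (induction n) simp_all
qed

text \<open>\<open>p\<close> and \<open>q\<close> are the products of the growth factors along the
  orbit: \<kappa> controls their ratio, preservation of area their product.\<close>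

lemma cocycle_smax_smin:
  assumes \<kappa>: "\<kappa> > 1" "\<And>z. z \<in> A \<Longrightarrow> \<kappa> * growth z (smin z) \<le> growth z (smax z)" and z: "z \<in> A"
  obtains p q where "cocycle F F' n z (1, smax z) = p *\<^sub>R (1, smax ((F ^^ n) z))"
    "cocycle F F' n z (1, smin z) = q *\<^sub>R (1, smin ((F ^^ n) z))"
    "q > 0" "\<kappa> ^ n * q \<le> p" "p * q * width ((F ^^ n) z) = width z"
proof -
  have "\<exists>p q. cocycle F F' n z (1, smax z) = p *\<^sub>R (1, smax ((F ^^ n) z)) \<and>
    cocycle F F' n z (1, smin z) = q *\<^sub>R (1, smin ((F ^^ n) z)) \<and> q > 0 \<and> \<kappa> ^ n * q \<le> p"
  proof (induction n)
    case 0
    show ?case by (intro exI[of _ 1]) simp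
  next
    case (Suc n)
    let ?y = "(F ^^ n) z"
    have y: "?y \<in> A" using z by (rule iter_mem)
    obtain p q where pq: "cocycle F F' n z (1, smax z) = p *\<^sub>R (1, smax ?y)"
      "cocycle F F' n z (1, smin z) = q *\<^sub>R (1, smin ?y)" "q > 0" "\<kappa> ^ n * q \<le> p"
      using Suc by blast
    have g: "growth ?y (smin ?y) > 0" using slopes_image(1) smax_smin(2)[OF y] by blast
    show ?case
    proof (intro exI conjI)
      show "cocycle F F' (Suc n) z (1, smax z) = (p * growth ?y (smax ?y)) *\<^sub>R (1, smax ((F ^^ Suc n) z))"
        using slopes_image(3)[OF smax_smin(1)[OF y]] slope_map_smax[OF y]
        by (simp add: pq(1) blinfun.scaleR_right del: scaleR_Pair)
      show "cocycle F F' (Suc n) z (1, smin z) = (q * growth ?y (smin ?y)) *\<^sub>R (1, smin ((F ^^ Suc n) z))"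
        using slopes_image(3)[OF smax_smin(2)[OF y]] slope_map_smin[OF y]
        by (simp add: pq(2) blinfun.scaleR_right del: scaleR_Pair)
      show "q * growth ?y (smin ?y) > 0" using pq(3) g by simp
      have "(\<kappa> ^ n * q) * (\<kappa> * growth ?y (smin ?y)) \<le> p * growth ?y (smax ?y)"
        using pq(3,4) \<kappa> g y
        by (intro mult_mono) (auto intro: order_trans[OF _ pq(4)] less_imp_le)
      then show "\<kappa> ^ Suc n * (q * growth ?y (smin ?y)) \<le> p * growth ?y (smax ?y)" by (simp add: mult_ac)
    qed
  qed
  then obtain p q where pq: "cocycle F F' n z (1, smax z) = p *\<^sub>R (1, smax ((F ^^ n) z))"
    "cocycle F F' n z (1, smin z) = q *\<^sub>R (1, smin ((F ^^ n) z))" "q > 0" "\<kappa> ^ n * q \<le> p" by blast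
  have "area (cocycle F F' n z (1, smin z)) (cocycle F F' n z (1, smax z)) = area (1, smin z) (1, smax z)"
    by (rule area_cocycle)
  then have "p * q * width ((F ^^ n) z) = width z"
    unfolding pq(1,2) area_scaleR by (simp add: area_def width_def mult_ac)
  with pq show thesis by (rule that)
qed

text \<open>Two contracted vectors span an area that tends to 0, yet the area does not change. Hence
  at each point there is at most one contracted slope.\<close>

lemma contracted_slope_unique:
  assumes "\<And>n. area (X n) (Y n) = t - s" and "\<And>n. norm (X n) \<le> C * \<mu> ^ n" "\<And>n. norm (Y n) \<le> C * \<mu> ^ n"
    and \<mu>: "0 < \<mu>" "\<mu> < 1"
  shows "t = s"
proof -
  have "\<bar>t - s\<bar> \<le> 2 * C\<^sup>2 * (\<mu>\<^sup>2) ^ n" for n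
  proof -
    have "\<bar>t - s\<bar> \<le> 2 * norm (X n) * norm (Y n)" using abs_area_le[of "X n" "Y n"] assms(1) by simp
    also have "\<dots> \<le> 2 * (C * \<mu> ^ n) * (C * \<mu> ^ n)"
      using assms(2,3)[of n] by (intro mult_mono) (auto intro: order_trans[OF norm_ge_zero])
    also have "\<dots> = 2 * C\<^sup>2 * (\<mu>\<^sup>2) ^ n" by (simp add: power2_eq_square power_mult_distrib)
    finally show ?thesis .
  qed
  moreover have "(\<lambda>n. 2 * C\<^sup>2 * (\<mu>\<^sup>2) ^ n) \<longlonglongrightarrow> 2 * C\<^sup>2 * 0"
    using \<mu> by (intro tendsto_intros LIMSEQ_power_zero) (simp add: abs_square_less_1)
  ultimately have "\<bar>t - s\<bar> \<le> 2 * C\<^sup>2 * 0" by (intro LIMSEQ_le_const) auto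
  then show ?thesis by simp
qed

lemma hyperbolic_slopes_exist:
  obtains s u C \<mu> where "hyperbolic_slopes F G F' G' A s u C \<mu>"
proof -
  obtain S where S: "S > 0" "\<And>z s. z \<in> A \<Longrightarrow> s \<in> slopes z \<Longrightarrow> \<bar>s\<bar> \<le> S" by (rule slopes_bounded) blast
  obtain d where d: "d > 0" "\<And>z. z \<in> A \<Longrightarrow> width z \<ge> d" by (rule width_bounded_below) blast
  obtain \<kappa> where \<kappa>: "\<kappa> > 1" "\<And>z. z \<in> A \<Longrightarrow> \<kappa> * growth z (smin z) \<le> growth z (smax z)"
    by (rule growth_ratio) blast
  \<comment> \<open>From \<open>p * q \<le> 2 * S / d\<close> and
    \<open>\<kappa> ^ n * q \<le> p\<close> follows
    \<open>q\<^sup>2 \<le> 2 * S / d / \<kappa> ^ n\<close>; the square root yields \<mu>, and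
    \<open>1 + S\<close> bounds the norm of \<open>(1, s)\<close>.\<close>
  define C where "C = (1 + S) * sqrt (2 * S / d)"
  define \<mu> where "\<mu> = sqrt (1 / \<kappa>)"
  have \<mu>: "0 < \<mu>" "\<mu> < 1" using \<kappa>(1) by (auto simp: \<mu>_def)
  have "C > 0" using S(1) d(1) by (simp add: C_def)
  have norm_le: "norm (1 :: real, s) \<le> 1 + S" if "z \<in> A" "s \<in> slopes z" for s z
    using norm_slope_vector(2)[of s] S(2)[OF that] by linarith
  have ratio: "width z / width y \<le> 2 * S / d" if "z \<in> A" "y \<in> A" for z y
    using S(2)[OF that(1) smax_smin(1)[OF that(1)]] S(2)[OF that(1) smax_smin(2)[OF that(1)]]
      d that S(1) width_pos[OF that(1)]
    by (intro frac_le) (auto simp: width_def)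
  have root: "a * norm (1 :: real, s) \<le> C * \<mu> ^ n"
    if "a\<^sup>2 \<le> 2 * S / d / \<kappa> ^ n" "a \<ge> 0" "norm (1 :: real, s) \<le> 1 + S" for a s n
  proof -
    have "a \<le> sqrt (2 * S / d * (1 / \<kappa>) ^ n)"
      using that(1) by (intro real_le_rsqrt) (simp add: power_one_over field_simps)
    also have "\<dots> = sqrt (2 * S / d) * \<mu> ^ n" by (simp only: \<mu>_def real_sqrt_mult real_sqrt_power)
    finally have "a * norm (1 :: real, s) \<le> (sqrt (2 * S / d) * \<mu> ^ n) * (1 + S)"
      using that \<mu> S(1) d(1) by (intro mult_mono) auto
    then show ?thesis by (simp add: C_def mult_ac)
  qed
  have divide: "a \<le> X / \<kappa> ^ n" if "\<kappa> ^ n * a \<le> X" for a X n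
    using that \<kappa>(1) by (simp add: pos_le_divide_eq mult.commute)
  have stable: "norm (cocycle F F' n z (1, smin z)) \<le> C * \<mu> ^ n" if z: "z \<in> A" for z n
  proof -
    obtain p q where pq: "cocycle F F' n z (1, smin z) = q *\<^sub>R (1, smin ((F ^^ n) z))"
      "q > 0" "\<kappa> ^ n * q \<le> p" "p * q * width ((F ^^ n) z) = width z"
      using cocycle_smax_smin[OF \<kappa> z] by metis
    have y: "(F ^^ n) z \<in> A" using z by (rule iter_mem)
    have "\<kappa> ^ n * q\<^sup>2 \<le> p * q"
      using mult_right_mono[OF pq(3), of q] pq(2) by (simp add: power2_eq_square mult_ac)
    also have "p * q = width z / width ((F ^^ n) z)"
      using pq(4) width_pos[OF y] by (simp add: field_simps)
    also have "\<dots> \<le> 2 * S / d" using z y by (rule ratio)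
    finally have "q\<^sup>2 \<le> 2 * S / d / \<kappa> ^ n" by (rule divide)
    from root[OF this _ norm_le[OF y smax_smin(2)[OF y]]] pq(2) show ?thesis
      by (simp add: pq(1) del: scaleR_Pair)
  qed
  \<comment> \<open>The inverse cocycle acts on the upper slope by \<open>1 / p\<close>, whose
    square is at most \<open>1 / (p * q)\<close> divided by \<open>\<kappa> ^ n\<close>.\<close>
  have unstable: "norm (cocycle G G' n z (1, smax z)) \<le> C * \<mu> ^ n" if z: "z \<in> A" for z n
  proof -
    define y where "y = (G ^^ n) z"
    have y: "y \<in> A" "(F ^^ n) y = z" using z inv.iter_mem by (auto simp: y_def)
    obtain p q where pq: "cocycle F F' n y (1, smax y) = p *\<^sub>R (1, smax z)"
      "q > 0" "\<kappa> ^ n * q \<le> p" "p * q * width z = width y"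
      using cocycle_smax_smin[OF \<kappa> y(1), of n] unfolding y(2) by metis
    have "\<kappa> ^ n * q > 0" using \<kappa>(1) pq(2) by simp
    with pq(3) have p: "p > 0" by linarith
    have "(1, smax y) = cocycle G G' n z (p *\<^sub>R (1, smax z))"
      using cocycle_inverse[of n y "(1, smax y)"] by (simp add: pq(1) y(2) del: scaleR_Pair)
    then have c: "cocycle G G' n z (1, smax z) = (1 / p) *\<^sub>R (1, smax y)"
      using p by (simp add: cocycle_scaleR del: scaleR_Pair)
    have "\<kappa> ^ n * (1 / p)\<^sup>2 \<le> 1 / (p * q)"
      using pq(2,3) p by (simp add: power2_eq_square field_simps)
    also have "1 / (p * q) = width z / width y"
    proof -
      have "p * q = width y / width z" using pq(4) width_pos[OF z] by (simp add: field_simps)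
      then show ?thesis by simp
    qed
    also have "\<dots> \<le> 2 * S / d" using z y(1) by (rule ratio)
    finally have "(1 / p)\<^sup>2 \<le> 2 * S / d / \<kappa> ^ n" by (rule divide)
    from root[OF this _ norm_le[OF y(1) smax_smin(1)[OF y(1)]]] p show ?thesis
      by (simp add: c del: scaleR_Pair)
  qed
  \<comment> \<open>A limit of stable slopes is contracted with the same constants, so it equals the
    stable slope at the limit point.\<close>
  have cont_min: "continuous_on A smin"
  proof (rule closed_graph_bounded_imp_continuous_on[of A smin S])
    fix x z t assume x: "\<And>k::nat. x k \<in> A" "z \<in> A" "x \<longlonglongrightarrow> z" "(\<lambda>k. smin (x k)) \<longlonglongrightarrow> t"
    have v: "(\<lambda>k. (1, smin (x k))) \<longlonglongrightarrow> (1, t)" by (intro tendsto_intros x)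
    have t: "norm (cocycle F F' n z (1, t)) \<le> C * \<mu> ^ n" for n
      by (rule LIMSEQ_le_const2[OF tendsto_norm[OF cocycle_tendsto[OF F_cont F'_cont x(3) v]]])
        (use stable x(1) in blast)
    show "t = smin z"
      by (rule contracted_slope_unique[OF _ stable[OF x(2)] t \<mu>]) (simp only: area_cocycle, simp add: area_def)
  qed (use S smax_smin(2) in blast)
  have cont_max: "continuous_on A smax"
  proof (rule closed_graph_bounded_imp_continuous_on[of A smax S])
    fix x z t assume x: "\<And>k::nat. x k \<in> A" "z \<in> A" "x \<longlonglongrightarrow> z" "(\<lambda>k. smax (x k)) \<longlonglongrightarrow> t"
    have v: "(\<lambda>k. (1, smax (x k))) \<longlonglongrightarrow> (1, t)" by (intro tendsto_intros x)
    have t: "norm (cocycle G G' n z (1, t)) \<le> C * \<mu> ^ n" for n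
      by (rule LIMSEQ_le_const2[OF tendsto_norm[OF cocycle_tendsto[OF inv.F_cont G'_cont x(3) v]]])
        (use unstable x(1) in blast)
    show "t = smax z"
      by (rule contracted_slope_unique[OF _ unstable[OF x(2)] t \<mu>]) (simp only: area_cocycle_inverse, simp add: area_def)
  qed (use S smax_smin(1) in blast)
  have min: "F' z (1, smin z) = growth z (smin z) *\<^sub>R (1, smin (F z))" if "z \<in> A" for z
    using slopes_image(3)[OF smax_smin(2)[OF that]] slope_map_smin[OF that] by simp
  have max: "F' z (1, smax z) = growth z (smax z) *\<^sub>R (1, smax (F z))" if "z \<in> A" for z
    using slopes_image(3)[OF smax_smin(1)[OF that]] slope_map_smax[OF that] by simp
  have inverse: "G' z (1, t) = (1 / c) *\<^sub>R (1, t')" if "F' (G z) (1, t') = c *\<^sub>R (1, t)" "c > 0" for z t t' c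
  proof -
    have "(1, t) = (1 / c) *\<^sub>R F' (G z) (1, t')" using that by simp
    then have "G' z (1, t) = (1 / c) *\<^sub>R G' z (F' (G z) (1, t'))" by (simp only: blinfun.scaleR_right)
    also have "G' z (F' (G z) (1, t')) = (1, t')" using G'_F'[of "G z"] by simp
    finally show ?thesis .
  qed
  have "hyperbolic_slopes F G F' G' A smin smax C \<mu>"
    unfolding hyperbolic_slopes_def
  proof (intro conjI ballI allI)
    fix z assume z: "z \<in> A"
    then have Gz: "G z \<in> A" by (rule G_mem)
    show "smin z \<noteq> smax z" using smax_smin(4)[OF z] by simp
    show "smin (shift m z) = smin z" "smax (shift m z) = smax z" for m by (rule smin_shift smax_shift)+
    show "\<exists>c. F' z (1, smin z) = c *\<^sub>R (1, smin (F z))" using min[OF z] by blast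
    show "\<exists>c. F' z (1, smax z) = c *\<^sub>R (1, smax (F z))" using max[OF z] by blast
    show "\<exists>c. G' z (1, smin z) = c *\<^sub>R (1, smin (G z))"
      using inverse[OF min[OF Gz, unfolded FG]] slopes_image(1)[OF smax_smin(2)[OF Gz]] by blast
    show "\<exists>c. G' z (1, smax z) = c *\<^sub>R (1, smax (G z))"
      using inverse[OF max[OF Gz, unfolded FG]] slopes_image(1)[OF smax_smin(1)[OF Gz]] by blast
  qed (use \<mu> \<open>C > 0\<close> cont_min cont_max stable unstable in auto)
  then show thesis by (rule that)
qed

end

section \<open>From the annulus to the plane\<close>

lemma continuous_on_circle_proj: "continuous_on S circle_proj"
proof (rule continuous_on_iff[THEN iffD2], intro ballI allI impI)
  fix x and e :: real assume "e > 0"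
  have "dist (circle_proj y) (circle_proj x) < e" if "dist y x < e" for y
    using dist_circle_le[of y x] that by (simp add: dist_real_def)
  with \<open>e > 0\<close> show "\<exists>d>0. \<forall>y\<in>S. dist y x < d \<longrightarrow> dist (circle_proj y) (circle_proj x) < e" by blast
qed

lemma continuous_on_ann_proj: "continuous_on S ann_proj"
proof -
  have "continuous_on S (\<lambda>z. (circle_proj (fst z), snd z))"
    by (intro continuous_intros continuous_on_compose2[OF continuous_on_circle_proj[of UNIV]]) auto
  then show ?thesis by (simp add: ann_proj_def[abs_def])
qed

lemma ann_proj_surj: obtains z where "ann_proj z = x"
proof -
  obtain t where "circle_proj t = fst x" by (rule circle_proj_surj)
  then have "ann_proj (t, snd x) = x" by (simp add: ann_proj_def)
  then show thesis by (rule that)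
qed

text \<open>The representative of \<open>x\<close> nearest to \<open>z\<close>; with it, convergence
  in the annulus lifts to convergence in the plane.\<close>

lemma ann_proj_near:
  obtains w where "ann_proj w = x" "dist w z = dist x (ann_proj z)"
proof -
  obtain t where t: "circle_proj t = fst x" by (rule circle_proj_surj)
  obtain t' where t': "circle_proj t' = fst x" "dist (circle_proj (fst z)) (fst x) = \<bar>fst z - t'\<bar>"
    using dist_circle_attained[where x = "fst z" and y = t] unfolding t by blast
  have "ann_proj (t', snd x) = x" using t' by (simp add: ann_proj_def)
  moreover have "dist (t', snd x) z = dist x (ann_proj z)"
    using t'(2) by (cases x; cases z)
      (simp add: dist_Pair_Pair ann_proj_def dist_commute[of "fst x"] dist_real_def abs_minus_commute dist_commute)
  ultimately show thesis by (rule that)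
qed

lemma is_lift_comp:
  assumes "is_lift f F" "is_lift g G" shows "is_lift (f \<circ> g) (F \<circ> G)"
  using assms unfolding is_lift_def by (auto intro: continuous_on_compose2[of UNIV])

lemma is_lift_id: "is_lift id id"
  by (simp add: is_lift_def)

lemma is_lift_funpow: "is_lift f F \<Longrightarrow> is_lift (f ^^ n) (F ^^ n)"
  by (induction n) (simp_all add: is_lift_id is_lift_comp)

lemma is_lift_id_eq_shift:
  assumes "is_lift id F" obtains k where "\<And>z. F z = shift k z"
  using is_lift_unique[OF is_lift_id assms] by (auto simp: shift_def)

lemma is_lift_shift: "is_lift f F \<Longrightarrow> is_lift f (\<lambda>z. shift k (F z))"
  unfolding is_lift_def by (auto simp: shift_def[abs_def] intro!: continuous_intros) (simp flip: shift_def)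

lemma is_lift_of_shift: "is_lift f F \<Longrightarrow> is_lift f (\<lambda>z. F (shift k z))"
  using is_lift_comp[of f F id "shift k"]
  by (simp add: is_lift_def shift_def[abs_def] o_def continuous_intros) (simp flip: shift_def)

text \<open>\<open>F\<close> after \<open>shift 1\<close> is another lift of \<open>f\<close>, so it
  differs from \<open>F\<close> by a constant translation; \<open>k\<close> is the degree of
  \<open>f\<close> on the fundamental group.\<close>

lemma lift_degree:
  assumes F: "is_lift f F"
  obtains k where "\<And>m z. F (shift m z) = shift (m * k) (F z)"
proof -
  obtain k where k: "\<And>z. F (shift 1 z) = shift k (F z)"
    using is_lift_unique[OF F is_lift_of_shift[OF F, of 1]] unfolding shift_def by metis
  have "F (shift m z) = shift (m * k) (F z)" for m z
  proof (induction m arbitrary: z rule: int_induct[of _ 0])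
    case (step1 i)
    have "F (shift (i + 1) z) = F (shift 1 (shift i z))" by (simp add: add.commute)
    also have "\<dots> = shift k (shift (i * k) (F z))" by (simp only: k step1)
    finally show ?case by (simp add: algebra_simps)
  next
    case (step2 i)
    have "shift k (F (shift (i - 1) z)) = F (shift 1 (shift (i - 1) z))" by (simp only: k)
    also have "\<dots> = shift (i * k) (F z)" using step2 by simp
    finally have "shift (- k) (shift k (F (shift (i - 1) z))) = shift (- k) (shift (i * k) (F z))" by simp
    then show ?case by (simp add: algebra_simps)
  qed simp
  then show thesis by (rule that)
qed

lemma diffeo_lifts:
  assumes f: "ann_C1_diffeo f"
  obtains F G F' G' where "is_lift f F" "is_lift (inv f) G" "\<And>z. F (G z) = z" "\<And>z. G (F z) = z"
    "\<And>z. (F has_derivative blinfun_apply (F' z)) (at z)" "continuous_on UNIV F'"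
    "\<And>z. (G has_derivative blinfun_apply (G' z)) (at z)" "continuous_on UNIV G'"
proof -
  have bij: "bij f" using f by (simp add: ann_C1_diffeo_def)
  obtain F F' where F: "is_lift f F" "\<And>z. (F has_derivative blinfun_apply (F' z)) (at z)" "continuous_on UNIV F'"
    using f unfolding ann_C1_diffeo_def ann_C1_map_def C1_map_def by blast
  obtain G0 G' where G0: "is_lift (inv f) G0" "\<And>z. (G0 has_derivative blinfun_apply (G' z)) (at z)" "continuous_on UNIV G'"
    using f unfolding ann_C1_diffeo_def ann_C1_map_def C1_map_def by blast
  have "inv f \<circ> f = id" "f \<circ> inv f = id"
    using bij by (simp add: bij_is_inj, intro surj_iff[THEN iffD1] bij_is_surj)
  then obtain k where k: "\<And>z. G0 (F z) = shift k z"
    using is_lift_comp[OF G0(1) F(1)] is_lift_id_eq_shift[of "G0 \<circ> F"] by (auto simp: o_def)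
  \<comment> \<open>A lift of the inverse inverts \<open>F\<close> only up to a translation.
    Correcting it makes \<open>G\<close> a left inverse, and evaluation at \<open>F 0\<close> shows
    that it is a right inverse too.\<close>
  define G where "G z = shift (- k) (G0 z)" for z
  have G: "is_lift (inv f) G" unfolding G_def using G0(1) by (rule is_lift_shift)
  have GF: "G (F z) = z" for z by (simp add: G_def k)
  obtain l where l: "\<And>z. F (G z) = shift l z"
    using is_lift_comp[OF F(1) G] is_lift_id_eq_shift[of "F \<circ> G"] \<open>f \<circ> inv f = id\<close> by (auto simp: o_def)
  have "F (G (F 0)) = F 0" by (simp add: GF)
  then have "l = 0" by (simp add: l prod_eq_iff)
  then have FG: "F (G z) = z" for z by (simp add: l)
  have "(G has_derivative blinfun_apply (G' z)) (at z)" for z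
    unfolding G_def shift_def by (auto intro!: derivative_eq_intros G0)
  with F G GF FG G0 that show thesis by blast
qed

locale annulus_lift =
  fixes f :: "annulus \<Rightarrow> annulus" and F G F' G'
  assumes bij: "bij f" and lift: "is_lift f F" and lift_inv: "is_lift (inv f) G"
    and FG: "F (G z) = z" and GF: "G (F z) = z"
    and F_deriv: "(F has_derivative blinfun_apply (F' z)) (at z)" and F'_cont: "continuous_on UNIV F'"
    and G_deriv: "(G has_derivative blinfun_apply (G' z)) (at z)" and G'_cont: "continuous_on UNIV G'"
begin

lemma ann_proj_F: "ann_proj (F z) = f (ann_proj z)"
  and ann_proj_G: "ann_proj (G z) = inv f (ann_proj z)"
  using lift lift_inv by (auto simp: is_lift_def)

lemma annulus_lift_inverse: "annulus_lift (inv f) G F G' F'"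
proof
  show "is_lift (inv (inv f)) F" using lift bij by (simp add: inv_inv_eq)
qed (use lift_inv FG GF F_deriv F'_cont G_deriv G'_cont bij in \<open>auto simp: bij_imp_bij_inv\<close>)

lemma inv_F: "inv F = G"
  by (rule inv_equality) (simp_all add: FG GF)

lemma tangent_map_iter: "tangent_map (f ^^ n) (ann_proj z) = cocycle F F' n z"
  by (rule tangent_map_eq[OF is_lift_funpow[OF lift] cocycle_has_derivative[OF F_deriv]])

lemma tangent_map_lift: "tangent_map f (ann_proj z) = F' z"
  by (rule tangent_map_eq[OF lift F_deriv])

text \<open>The degrees of \<open>f\<close> and of its inverse multiply to 1, so the degree is 1 or
  -1; preserving the order of a point and its translate rules out -1.\<close>

lemma F_shift_ordered:
  assumes "f_ordered f M"
  shows "F (shift m z) = shift m (F z)"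
proof -
  obtain k where k: "\<And>m z. F (shift m z) = shift (m * k) (F z)" using lift by (rule lift_degree) blast
  obtain l where l: "\<And>m z. G (shift m z) = shift (m * l) (G z)" using lift_inv by (rule lift_degree) blast
  have "shift 1 z = G (F (shift 1 z))" for z by (simp add: GF)
  also have "G (F (shift 1 z)) = shift (k * l) z" for z using k[of 1 z] l[of k "F z"] by (simp add: GF)
  finally have "shift 1 0 = shift (k * l) 0" by blast
  from arg_cong[OF this, of fst] have "of_int 1 = (of_int (k * l) :: real)" by (simp del: of_int_mult)
  then have "k * l = 1" by (simp only: of_int_eq_iff)
  obtain x where "x \<in> M" using assms by (auto simp: f_ordered_def)
  obtain z0 where z0: "ann_proj z0 = x" by (rule ann_proj_surj)
  then have "z0 \<in> ann_proj -` M" "shift 1 z0 \<in> ann_proj -` M" using \<open>x \<in> M\<close> by auto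
  then have "fst z0 < fst (shift 1 z0) \<longleftrightarrow> fst (F z0) < fst (F (shift 1 z0))"
    using assms lift unfolding f_ordered_def by blast
  then have "k > 0" using k[of 1 z0] by simp
  with \<open>k * l = 1\<close> have "k = 1" by (simp add: zmult_eq_1_iff)
  then show ?thesis using k by simp
qed

lemma lifted_ordered_set:
  assumes AM: "Aubry_Mather_set f M"
    and graph: "\<And>z w. z \<in> ann_proj -` M \<Longrightarrow> w \<in> ann_proj -` M \<Longrightarrow> fst z = fst w \<Longrightarrow> z = w"
  shows "lifted_ordered_set F G F' G' (ann_proj -` M)"
proof -
  let ?A = "ann_proj -` M"
  have ord: "f_ordered f M" and min: "\<And>N. f_ordered f N \<Longrightarrow> N \<subseteq> M \<Longrightarrow> N = M"
    using AM by (auto simp: Aubry_Mather_set_def)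
  have M: "M \<noteq> {}" "compact M" "f ` M = M" using ord by (auto simp: f_ordered_def)
  have "bounded (snd ` M)" using M(2) by (intro compact_imp_bounded compact_continuous_image continuous_intros)
  then obtain R where "\<forall>x\<in>snd ` M. norm x \<le> R" by (auto simp: bounded_iff)
  then have R: "\<forall>z\<in>?A. \<bar>snd z\<bar> \<le> R" by (force simp: ann_proj_def)
  have FA: "F z \<in> ?A" if "z \<in> ?A" for z using that M(3) by (auto simp: ann_proj_F)
  have GA: "G z \<in> ?A" if "z \<in> ?A" for z
  proof -
    from that M(3) have "ann_proj z \<in> f ` M" by simp
    then obtain y where "y \<in> M" "ann_proj z = f y" by blast
    then show ?thesis using bij by (simp add: ann_proj_G bij_is_inj)
  qed
  \<comment> \<open>A translation invariant \<open>B\<close> is the full preimage of its projection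
    \<open>N\<close>, and \<open>N\<close> is compact as the image of a bounded strip of
    \<open>B\<close>. The order is inherited from \<open>M\<close>, so minimality of
    \<open>M\<close> applies to \<open>N\<close>.\<close>
  have min': "B = ?A" if B: "B \<subseteq> ?A" "closed B" "B \<noteq> {}" "\<And>z m. z \<in> B \<Longrightarrow> shift m z \<in> B" "F ` B = B" for B
  proof -
    define N where "N = ann_proj ` B"
    have vim: "z \<in> B" if "ann_proj z \<in> N" for z
    proof -
      from that obtain b where "b \<in> B" "ann_proj z = ann_proj b" by (auto simp: N_def)
      then show ?thesis using B(4) by (metis ann_proj_eqE)
    qed
    have "N = ann_proj ` (B \<inter> cbox (0, -R) (1, R))"
    proof (intro equalityI subsetI)
      fix x assume "x \<in> N"
      then obtain b where b: "b \<in> B" "x = ann_proj b" by (auto simp: N_def)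
      let ?b = "shift (- \<lfloor>fst b\<rfloor>) b"
      have "?b \<in> B" "x = ann_proj ?b" using b B(4) by auto
      moreover have "?b \<in> cbox (0, -R) (1, R)"
      proof -
        have "\<bar>snd b\<bar> \<le> R" using R b B(1) by blast
        moreover have "0 \<le> fst b - of_int \<lfloor>fst b\<rfloor>" "fst b - of_int \<lfloor>fst b\<rfloor> \<le> 1" by linarith+
        moreover have "?b = (fst b - of_int \<lfloor>fst b\<rfloor>, snd b)" by (simp add: prod_eq_iff)
        ultimately show ?thesis by (simp add: cbox_Pair_eq abs_le_iff)
      qed
      ultimately show "x \<in> ann_proj ` (B \<inter> cbox (0, -R) (1, R))" by blast
    qed (auto simp: N_def)
    moreover have "compact (B \<inter> cbox (0, -R) (1, R))" using B(2) by (intro closed_Int_compact compact_cbox)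
    ultimately have "compact N" using compact_continuous_image[OF continuous_on_ann_proj] by metis
    moreover have "f ` N = N"
    proof -
      have "f ` N = ann_proj ` F ` B" by (auto simp: N_def image_image ann_proj_F)
      then show ?thesis by (simp add: B(5) N_def)
    qed
    moreover have "N \<subseteq> M" using B(1) by (auto simp: N_def)
    moreover have "N \<noteq> {}" using B(3) by (auto simp: N_def)
    ultimately have "f_ordered f N" using ord unfolding f_ordered_def by blast
    then have "N = M" using \<open>N \<subseteq> M\<close> by (rule min)
    then show ?thesis using vim B(1) by blast
  qed
  show ?thesis
  proof
    show "closed ?A"
    proof -
      have "closed M" using M(2) by (rule compact_imp_closed)
      then show ?thesis using continuous_on_ann_proj[of UNIV] by (simp add: continuous_on_closed_vimage)
    qed
    show "?A \<noteq> {}"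
    proof -
      obtain x where "x \<in> M" using M(1) by blast
      moreover obtain z where "ann_proj z = x" by (rule ann_proj_surj)
      ultimately show ?thesis by blast
    qed
    show "F ` ?A = ?A"
    proof (intro equalityI subsetI)
      fix z assume "z \<in> ?A"
      then show "z \<in> F ` ?A" using GA by (intro image_eqI[of _ _ "G z"]) (simp_all only: FG)
    qed (use FA in blast)
    show "fst (F z) < fst (F w) \<longleftrightarrow> fst z < fst w" if "z \<in> ?A" "w \<in> ?A" for z w
      using ord lift that unfolding f_ordered_def by blast
  qed (use FG GF F_deriv G_deriv F'_cont G'_cont F_shift_ordered[OF ord] R graph min' in auto)
qed

end

section \<open>Paratingent cones, area and twist on the cover\<close>

lemma ann_diff_ann_proj:
  assumes "- 1 / 2 \<le> fst z - fst w" "fst z - fst w < 1 / 2"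
  shows "ann_diff (ann_proj z) (ann_proj w) = z - w"
  unfolding ann_diff_def
proof (rule the_equality)
  show "fst (z - w) \<in> {- 1 / 2..<1 / 2} \<and>
    (\<exists>z' w'. ann_proj z' = ann_proj z \<and> ann_proj w' = ann_proj w \<and> z - w = z' - w')"
    using assms by auto
next
  fix v assume v: "fst v \<in> {- 1 / 2..<1 / 2} \<and>
    (\<exists>z' w'. ann_proj z' = ann_proj z \<and> ann_proj w' = ann_proj w \<and> v = z' - w')"
  then obtain z' w' where zw: "ann_proj z' = ann_proj z" "ann_proj w' = ann_proj w" "v = z' - w'" by blast
  obtain m where m: "z' = shift m z" using zw(1) by (rule ann_proj_eqE)
  obtain n where n: "w' = shift n w" using zw(2) by (rule ann_proj_eqE)
  have "fst v = fst z - fst w + of_int (m - n)" by (simp add: zw m n)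
  with v assms have "\<bar>real_of_int (m - n)\<bar> < 1" by auto
  then have "m = n" by linarith
  then show "v = z - w" by (simp add: zw m n)
qed

text \<open>Lifts converging to the same \<open>z\<close> eventually differ by a vector in the
  window of \<open>ann_diff\<close>, so both kinds of difference quotients agree from some index
  on.\<close>

lemma paratingent_cone_ann_proj:
  "paratingent_cone M (ann_proj z) = ptg_cone (ann_proj -` M) z"
proof (intro equalityI subsetI)
  have diff: "\<forall>\<^sub>F n in sequentially. ann_diff (ann_proj (a n)) (ann_proj (b n)) = a n - b n"
    if "a \<longlonglongrightarrow> z" "b \<longlonglongrightarrow> z" for a b
  proof -
    have "(\<lambda>n. fst (a n) - fst (b n)) \<longlonglongrightarrow> fst z - fst z" by (intro tendsto_intros that)
    then have lim: "(\<lambda>n. fst (a n) - fst (b n)) \<longlonglongrightarrow> 0" by simp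
    have "\<forall>\<^sub>F n in sequentially. - 1 / 2 < fst (a n) - fst (b n)" by (rule order_tendstoD(1)[OF lim]) simp
    moreover have "\<forall>\<^sub>F n in sequentially. fst (a n) - fst (b n) < 1 / 2" by (rule order_tendstoD(2)[OF lim]) simp
    ultimately show ?thesis by eventually_elim (intro ann_diff_ann_proj, auto)
  qed
  {
    fix v assume "v \<in> paratingent_cone M (ann_proj z)"
    then obtain a b t where s: "\<And>n::nat. a n \<in> M" "\<And>n. b n \<in> M" "a \<longlonglongrightarrow> ann_proj z" "b \<longlonglongrightarrow> ann_proj z"
      "\<And>n. (t n :: real) > 0" "t \<longlonglongrightarrow> 0" "(\<lambda>n. ann_diff (a n) (b n) /\<^sub>R t n) \<longlonglongrightarrow> v"
      unfolding paratingent_cone_def by blast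
    have "\<exists>w. ann_proj w = x \<and> dist w z = dist x (ann_proj z)" for x using ann_proj_near by metis
    then obtain l where l: "\<And>x. ann_proj (l x) = x" "\<And>x. dist (l x) z = dist x (ann_proj z)" by metis
    have lim: "(\<lambda>n. l (a n)) \<longlonglongrightarrow> z" "(\<lambda>n. l (b n)) \<longlonglongrightarrow> z"
      using s(3,4) by (simp_all add: tendsto_dist_iff[of _ z] l flip: tendsto_dist_iff)
    show "v \<in> ptg_cone (ann_proj -` M) z"
    proof (rule ptg_cone_limitI[OF _ _ s(5) lim s(6)])
      show "(\<lambda>n. (l (a n) - l (b n)) /\<^sub>R t n) \<longlonglongrightarrow> v"
      proof (rule Lim_transform_eventually[OF s(7)])
        show "\<forall>\<^sub>F n in sequentially. ann_diff (a n) (b n) /\<^sub>R t n = (l (a n) - l (b n)) /\<^sub>R t n"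
          using diff[OF lim] by eventually_elim (simp add: l)
      qed
    qed (use s l in auto)
  next
    fix v assume v: "v \<in> ptg_cone (ann_proj -` M) z"
    obtain a b t where s: "\<And>n::nat. a n \<in> ann_proj -` M" "\<And>n. b n \<in> ann_proj -` M" "\<And>n. (t n :: real) > 0"
      "a \<longlonglongrightarrow> z" "b \<longlonglongrightarrow> z" "t \<longlonglongrightarrow> 0" "(\<lambda>n. (a n - b n) /\<^sub>R t n) \<longlonglongrightarrow> v"
      using v by (rule ptg_cone_sequentially) blast
    have lim: "(\<lambda>n. ann_proj (a n)) \<longlonglongrightarrow> ann_proj z" "(\<lambda>n. ann_proj (b n)) \<longlonglongrightarrow> ann_proj z"
      by (rule continuous_on_tendsto_compose[OF continuous_on_ann_proj[of UNIV]]; simp add: s)+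
    have "(\<lambda>n. ann_diff (ann_proj (a n)) (ann_proj (b n)) /\<^sub>R t n) \<longlonglongrightarrow> v"
    proof (rule Lim_transform_eventually[OF s(7)])
      show "\<forall>\<^sub>F n in sequentially. (a n - b n) /\<^sub>R t n = ann_diff (ann_proj (a n)) (ann_proj (b n)) /\<^sub>R t n"
        using diff[OF s(4,5)] by eventually_elim simp
    qed
    then show "v \<in> paratingent_cone M (ann_proj z)"
      unfolding paratingent_cone_def
      by (intro CollectI exI[of _ "\<lambda>n. ann_proj (a n)"] exI[of _ "\<lambda>n. ann_proj (b n)"] exI[of _ t])
        (use s lim in auto)
  }
qed

lemma abs_fst_le_norm: "\<bar>fst v\<bar> \<le> norm v" and abs_snd_le_norm: "\<bar>snd v\<bar> \<le> norm v"
  for v :: "real \<times> real"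
  using norm_fst_le[of "fst v" "snd v"] norm_snd_le[of "snd v" "fst v"] by simp_all

text \<open>The claim is the symmetry of the linear part at \<open>z\<close> of a form with a
  primitive, namely the pulled back Liouville form minus the Liouville form, modified by exact forms
  so that its coefficients vanish at \<open>z\<close>.\<close>

lemma (in annulus_lift) area_preserving:
  assumes "exact_symplectic f"
  shows "area (F' z u) (F' z v) = area u v"
proof -
  obtain S where S: "\<And>w. ((\<lambda>w. S (ann_proj w)) has_derivative
      (\<lambda>v. pullback_form f liouville_form (ann_proj w) v - liouville_form (ann_proj w) v)) (at w)"
    using assms unfolding exact_symplectic_def exact_form_def by blast
  have S': "((\<lambda>w. S (ann_proj w)) has_derivative (\<lambda>v. snd (F w) * fst (F' w v) - snd w * fst v)) (at w)" for w
    using S[of w] unfolding pullback_form_def liouville_form_def tangent_map_lift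
    by (simp add: ann_proj_F[symmetric]) (simp add: ann_proj_def)
  \<comment> \<open>Subtracting the values at \<open>z\<close> from the coefficients
    \<open>snd (F w)\<close> and \<open>snd w\<close> leaves \<open>F' w\<close> multiplied by a
    small factor, so its continuity suffices for a first order expansion.\<close>
  define T where "T w = S (ann_proj w) - snd (F z) * fst (F w) + snd z * fst w" for w
  define \<tau> where "\<tau> w v = (snd (F w) - snd (F z)) * fst (F' w v) - (snd w - snd z) * fst v" for w v
  define B where "B x v = snd (F' z x) * fst (F' z v) - snd x * fst v" for x v
  have "B u v = B v u"
  proof (rule exact_form_linear_part_symmetric[of T \<tau> B z])
    show "(T has_derivative \<tau> w) (at w)" for w
      unfolding T_def \<tau>_def by (auto intro!: derivative_eq_intros S' F_deriv simp: algebra_simps)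
    show "bilinear B"
      unfolding bilinear_def B_def
      by (intro conjI allI linearI) (simp_all add: blinfun.add_right blinfun.scaleR_right algebra_simps)
    fix e :: real assume "e > 0"
    define K where "K = norm (F' z)"
    \<comment> \<open>The two error terms contribute \<open>c * (K + 1)\<close> and
      \<open>K * c\<close>, hence the requirement \<open>c * (2 * K + 1) \<le> e\<close>;
      \<open>c \<le> 1\<close> gives \<open>norm (F' w) \<le> K + 1\<close>.\<close>
    define c where "c = min 1 (e / (2 * K + 2))"
    have "K \<ge> 0" by (simp add: K_def)
    have "c > 0" "c \<le> 1" using \<open>e > 0\<close> \<open>K \<ge> 0\<close> by (auto simp: c_def)
    have "c \<le> e / (2 * K + 2)" by (simp add: c_def)
    then have "c * (2 * K + 2) \<le> e" using \<open>K \<ge> 0\<close> by (subst (asm) pos_le_divide_eq) auto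
    then have ce: "c * (2 * K + 1) \<le> e" using \<open>K \<ge> 0\<close> \<open>c > 0\<close> by (simp add: algebra_simps)
    obtain d1 where d1: "d1 > 0" "\<And>w. norm (w - z) < d1 \<Longrightarrow> norm (F w - F z - F' z (w - z)) \<le> c * norm (w - z)"
      using F_deriv[of z] \<open>c > 0\<close> unfolding has_derivative_at_alt by blast
    have "isCont F' z" using F'_cont by (simp add: continuous_on_eq_continuous_at)
    then obtain d2 where d2: "d2 > 0" "\<And>w. dist w z < d2 \<Longrightarrow> dist (F' w) (F' z) < c"
      using \<open>c > 0\<close> unfolding continuous_at_eps_delta by metis
    show "\<exists>d>0. \<forall>w. norm (w - z) < d \<longrightarrow> (\<forall>v. \<bar>\<tau> w v - B (w - z) v\<bar> \<le> e * norm (w - z) * norm v)"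
    proof (intro exI[of _ "min d1 d2"] conjI allI impI)
      fix w v assume w: "norm (w - z) < min d1 d2"
      let ?h = "w - z"
      have 1: "\<bar>snd (F w - F z - F' z ?h)\<bar> \<le> c * norm ?h"
        by (rule order_trans[OF abs_snd_le_norm d1(2)]) (use w in simp)
      have cc: "norm (F' w - F' z) \<le> c" using d2(2)[of w] w by (simp add: dist_norm)
      then have "norm ((F' w - F' z) v) \<le> c * norm v"
        by (meson norm_blinfun order_trans mult_right_mono norm_ge_zero)
      then have 2: "\<bar>fst (F' w v) - fst (F' z v)\<bar> \<le> c * norm v"
        using abs_fst_le_norm[of "(F' w - F' z) v"] by (simp add: blinfun.diff_left)
      have "norm (F' w) \<le> K + 1"
        using cc \<open>c \<le> 1\<close> norm_triangle_sub[of "F' w" "F' z"] by (simp add: K_def)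
      then have "norm (F' w v) \<le> (K + 1) * norm v"
        by (meson norm_blinfun order_trans mult_right_mono norm_ge_zero)
      then have 3: "\<bar>fst (F' w v)\<bar> \<le> (K + 1) * norm v"
        by (rule order_trans[OF abs_fst_le_norm])
      have 4: "\<bar>snd (F' z ?h)\<bar> \<le> K * norm ?h"
        unfolding K_def by (rule order_trans[OF abs_snd_le_norm norm_blinfun])
      have "\<tau> w v - B ?h v = snd (F w - F z - F' z ?h) * fst (F' w v) + snd (F' z ?h) * (fst (F' w v) - fst (F' z v))"
        by (simp add: \<tau>_def B_def algebra_simps)
      then have "\<bar>\<tau> w v - B ?h v\<bar> \<le> \<bar>snd (F w - F z - F' z ?h)\<bar> * \<bar>fst (F' w v)\<bar>
          + \<bar>snd (F' z ?h)\<bar> * \<bar>fst (F' w v) - fst (F' z v)\<bar>"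
        by (simp only: abs_mult[symmetric] abs_triangle_ineq)
      also have "\<dots> \<le> (c * norm ?h) * ((K + 1) * norm v) + (K * norm ?h) * (c * norm v)"
        using 1 2 3 4 \<open>K \<ge> 0\<close> \<open>c > 0\<close> by (intro add_mono mult_mono) auto
      also have "\<dots> = (c * (2 * K + 1)) * (norm ?h * norm v)" by (simp add: algebra_simps)
      also have "\<dots> \<le> e * (norm ?h * norm v)" using ce by (rule mult_right_mono) simp
      finally show "\<bar>\<tau> w v - B ?h v\<bar> \<le> e * norm ?h * norm v" by (simp add: mult.assoc)
    qed (use d1 d2 in simp)
  qed
  then show ?thesis by (simp add: B_def area_def algebra_simps)
qed

lemma C1_diffeo_deriv_nonzero:
  fixes \<phi> :: "real \<Rightarrow> real"
  assumes "C1_diffeo \<phi>" and D: "(\<phi> has_real_derivative D) (at r)"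
  shows "D \<noteq> 0"
proof
  assume "D = 0"
  obtain \<psi>' where \<psi>: "\<And>x. (inv \<phi> has_derivative blinfun_apply (\<psi>' x)) (at x)" and "bij \<phi>"
    using assms(1) unfolding C1_diffeo_def C1_map_def by blast
  have "(\<phi> has_derivative (\<lambda>h. D * h)) (at r)" using D by (rule has_field_derivative_imp_has_derivative)
  then have "((\<lambda>x. inv \<phi> (\<phi> x)) has_derivative (\<lambda>h. \<psi>' (\<phi> r) (D * h))) (at r)"
    by (rule has_derivative_compose[OF _ \<psi>])
  then have "((\<lambda>x. x) has_derivative (\<lambda>h. 0)) (at r)"
    using \<open>bij \<phi>\<close> \<open>D = 0\<close> by (simp add: bij_is_inj blinfun.zero_right)
  from has_derivative_unique[OF this has_derivative_ident] show False by (metis zero_neq_one)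
qed

text \<open>Monotonicity gives the derivative in \<open>r\<close> a weak sign, and the
  differentiable inverse excludes zero.\<close>

lemma (in annulus_lift) positive_twist:
  assumes twist: "positive_twist_map f"
  shows "fst (F' z (0, 1)) > 0" "fst (G' z (0, 1)) < 0"
    "r < r' \<Longrightarrow> fst (F (\<theta>, r)) < fst (F (\<theta>, r'))"
proof -
  have *: "C1_diffeo (\<lambda>r. fst (F (\<theta>, r)))" "monotone (<) (<) (\<lambda>r. fst (F (\<theta>, r)))"
    "C1_diffeo (\<lambda>r. fst (G (\<theta>, r)))" "monotone (<) (>) (\<lambda>r. fst (G (\<theta>, r)))" for \<theta>
    using twist[unfolded positive_twist_map_def, THEN conjunct2, THEN conjunct2, rule_format, OF lift, of \<theta>]
    unfolding inv_F by simp_all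
  have mono: "fst (F (\<theta>, r)) < fst (F (\<theta>, r'))" "fst (G (\<theta>, r')) < fst (G (\<theta>, r))" if "r < r'" for \<theta> r r'
    by (rule monotoneD[OF *(2) that] monotoneD[OF *(4) that])+
  show "r < r' \<Longrightarrow> fst (F (\<theta>, r)) < fst (F (\<theta>, r'))" by (rule mono)
  have der: "((\<lambda>r. fst (H (fst z, r))) has_real_derivative fst (H' z (0, 1))) (at (snd z))"
    if "\<And>z. (H has_derivative blinfun_apply (H' z)) (at z)"
    for H and H' :: "real \<times> real \<Rightarrow> (real \<times> real) \<Rightarrow>\<^sub>L (real \<times> real)"
  proof -
    have "((\<lambda>r. H (fst z, r)) has_derivative (\<lambda>h. H' (fst z, snd z) (0, h))) (at (snd z))"
      by (rule has_derivative_compose[OF _ that]) (auto intro!: derivative_eq_intros)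
    then have "((\<lambda>r. fst (H (fst z, r))) has_derivative (\<lambda>h. fst (H' z (0, h)))) (at (snd z))"
      using has_derivative_fst by fastforce
    moreover have "(\<lambda>h. fst (H' z (0, h))) = (*) (fst (H' z (0, 1)))"
    proof
      fix h :: real
      have "(0, h) = h *\<^sub>R (0 :: real, 1 :: real)" by simp
      then show "fst (H' z (0, h)) = fst (H' z (0, 1)) * h"
        by (simp add: blinfun.scaleR_right del: scaleR_Pair)
    qed
    ultimately show ?thesis by (simp only: has_field_derivative_def)
  qed
  show "fst (F' z (0, 1)) > 0"
  proof (rule ccontr)
    assume "\<not> fst (F' z (0, 1)) > 0"
    with C1_diffeo_deriv_nonzero[OF *(1) der[OF F_deriv]] have "fst (F' z (0, 1)) < 0" by linarith
    from DERIV_neg_dec_right[OF der[OF F_deriv] this]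
    obtain d where "d > 0" "\<forall>h>0. h < d \<longrightarrow> fst (F (fst z, snd z + h)) < fst (F (fst z, snd z))" by blast
    then have "fst (F (fst z, snd z + d / 2)) < fst (F (fst z, snd z))" by simp
    with mono(1)[of "snd z" "snd z + d / 2" "fst z"] \<open>d > 0\<close> show False by simp
  qed
  show "fst (G' z (0, 1)) < 0"
  proof (rule ccontr)
    assume "\<not> fst (G' z (0, 1)) < 0"
    with C1_diffeo_deriv_nonzero[OF *(3) der[OF G_deriv]] have "fst (G' z (0, 1)) > 0" by linarith
    from DERIV_pos_inc_right[OF der[OF G_deriv] this]
    obtain d where "d > 0" "\<forall>h>0. h < d \<longrightarrow> fst (G (fst z, snd z)) < fst (G (fst z, snd z + h))" by blast
    then have "fst (G (fst z, snd z)) < fst (G (fst z, snd z + d / 2))" by simp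
    with mono(2)[of "snd z" "snd z + d / 2" "fst z"] \<open>d > 0\<close> show False by simp
  qed
qed

section \<open>Hyperbolic splittings in the annulus and on the cover\<close>

text \<open>In \<open>v = p + q\<close> the images of \<open>q\<close> stay bounded, since those of
  \<open>v\<close> and \<open>p\<close> do. Pulling the \<open>n\<close>-th image back contracts it
  by \<open>C * \<mu> ^ n\<close>, so \<open>q\<close> is arbitrarily small.\<close>

lemma (in lifted_ordered_set) bounded_orbit_in_stable:
  assumes \<mu>: "0 < \<mu>" "\<mu> < 1" and z: "z \<in> A"
    and split: "\<exists>p q. p \<in> Es z \<and> q \<in> Eu z \<and> v = p + q"
    and invariant: "\<And>z q. z \<in> A \<Longrightarrow> q \<in> Eu z \<Longrightarrow> F' z q \<in> Eu (F z)"
    and stable: "\<And>n p. p \<in> Es z \<Longrightarrow> norm (cocycle F F' n z p) \<le> C * \<mu> ^ n * norm p"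
    and unstable: "\<And>z n q. z \<in> A \<Longrightarrow> q \<in> Eu z \<Longrightarrow> norm (cocycle G G' n z q) \<le> C * \<mu> ^ n * norm q"
    and C: "C > 0" and v: "v \<in> bounded_orbit F F' z"
  shows "v \<in> Es z"
proof -
  obtain p q where pq: "p \<in> Es z" "q \<in> Eu z" "v = p + q" using split by blast
  obtain B where B: "\<And>n. norm (cocycle F F' n z v) \<le> B" using v unfolding bounded_orbit_def by blast
  have "norm (cocycle F F' n z q) \<le> B + C * norm p" for n
  proof -
    have "cocycle F F' n z q = cocycle F F' n z v - cocycle F F' n z p"
      by (simp add: pq(3) cocycle_plus)
    then have "norm (cocycle F F' n z q) \<le> norm (cocycle F F' n z v) + norm (cocycle F F' n z p)"
      by (simp add: norm_triangle_ineq4)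
    also have "\<dots> \<le> B + C * \<mu> ^ n * norm p" using B stable[OF pq(1)] by (rule add_mono)
    also have "C * \<mu> ^ n * norm p \<le> C * 1 * norm p"
      using C \<mu> by (intro mult_right_mono mult_left_mono power_le_one) auto
    finally show ?thesis by simp
  qed
  note bound = this
  have q_le: "norm q \<le> (C * (B + C * norm p)) * \<mu> ^ n" for n
  proof -
    have "cocycle F F' n z q \<in> Eu ((F ^^ n) z)" for n
      by (induction n) (auto intro: invariant iter_mem z pq(2))
    from unstable[OF iter_mem[OF z] this, of n n]
    have "norm q \<le> C * \<mu> ^ n * norm (cocycle F F' n z q)" by (simp add: cocycle_inverse)
    also have "\<dots> \<le> C * \<mu> ^ n * (B + C * norm p)" using bound C \<mu> by (intro mult_left_mono) auto
    finally show ?thesis by (simp add: mult_ac)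
  qed
  have "(\<lambda>n. (C * (B + C * norm p)) * \<mu> ^ n) \<longlonglongrightarrow> (C * (B + C * norm p)) * 0"
    using \<mu> by (intro tendsto_intros LIMSEQ_power_zero) simp
  then have "norm q \<le> (C * (B + C * norm p)) * 0" by (rule LIMSEQ_le_const) (use q_le in blast)
  with pq show ?thesis by simp
qed

text \<open>Forward and backward bounded vectors lie in the stable and unstable space; there
  \<open>\<mu> ^ n \<le> 1\<close> provides the uniform constant, and the trivial intersection the
  transversality.\<close>

lemma (in annulus_lift) quasi_hyperbolic_set:
  assumes set: "lifted_ordered_set F G F' G' (ann_proj -` M)" and hyp: "uniformly_hyperbolic f M"
    and aperiodic: "\<And>z j m. z \<in> ann_proj -` M \<Longrightarrow> j > 0 \<Longrightarrow> (F ^^ j) z \<noteq> shift m z"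
  obtains C where "quasi_hyperbolic_set F G F' G' (ann_proj -` M) C"
proof -
  interpret lifted_ordered_set F G F' G' "ann_proj -` M" by (rule set)
  interpret inv: lifted_ordered_set G F G' F' "ann_proj -` M" by (rule lifted_ordered_set_inverse)
  interpret inv: annulus_lift "inv f" G F G' F' by (rule annulus_lift_inverse)
  let ?A = "ann_proj -` M"
  obtain Es Eu C \<mu> where C: "C > 0" and \<mu>: "0 < \<mu>" "\<mu> < 1" and E: "\<forall>x \<in> M.
           subspace (Es x) \<and> subspace (Eu x) \<and>
           Es x \<inter> Eu x = {0} \<and> {u + v |u v. u \<in> Es x \<and> v \<in> Eu x} = UNIV \<and>
           tangent_map f x ` Es x = Es (f x) \<and> tangent_map f x ` Eu x = Eu (f x) \<and>
           (\<forall>n. \<forall>v \<in> Es x. norm (tangent_map (f ^^ n) x v) \<le> C * \<mu> ^ n * norm v) \<and>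
           (\<forall>n. \<forall>v \<in> Eu x. norm (tangent_map (inv f ^^ n) x v) \<le> C * \<mu> ^ n * norm v)"
    using hyp unfolding uniformly_hyperbolic_def by (elim conjE exE) blast
  define S where "S z = Es (ann_proj z)" for z
  define U where "U z = Eu (ann_proj z)" for z
  have inter: "S z \<inter> U z = {0}" if "z \<in> ?A" for z
    using E that by (simp add: S_def U_def)
  have split: "\<exists>p q. p \<in> S z \<and> q \<in> U z \<and> v = p + q" if "z \<in> ?A" for z v
  proof -
    have "v \<in> {u + v |u v. u \<in> Es (ann_proj z) \<and> v \<in> Eu (ann_proj z)}" using E that by simp
    then show ?thesis by (auto simp: S_def U_def)
  qed
  have F_image: "F' z ` S z = S (F z)" "F' z ` U z = U (F z)" if "z \<in> ?A" for z
    using E that by (simp_all add: S_def U_def ann_proj_F flip: tangent_map_lift)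
  have stable: "norm (cocycle F F' n z v) \<le> C * \<mu> ^ n * norm v" if "z \<in> ?A" "v \<in> S z" for z n v
    using E that by (simp add: S_def flip: tangent_map_iter)
  have unstable: "norm (cocycle G G' n z v) \<le> C * \<mu> ^ n * norm v" if "z \<in> ?A" "v \<in> U z" for z n v
    using E that by (simp add: U_def flip: inv.tangent_map_iter)
  have G_invariant: "G' z p \<in> S (G z)" if "z \<in> ?A" "p \<in> S z" for z p
  proof -
    have "p \<in> F' (G z) ` S (G z)" using F_image(1)[OF G_mem[OF that(1)]] that(2) by simp
    then obtain p' where p': "p' \<in> S (G z)" "p = F' (G z) p'" by blast
    have "G' z (F' (G z) p') = p'" using G'_F'[of "G z"] by simp
    with p' show ?thesis by simp
  qed
  have S: "v \<in> S z" if "z \<in> ?A" "v \<in> bounded_orbit F F' z" for z v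
    by (rule bounded_orbit_in_stable[of \<mu> z S U v C])
      (use \<mu> that split F_image stable unstable C in blast)+
  have U: "v \<in> U z" if "z \<in> ?A" "v \<in> bounded_orbit G G' z" for z v
  proof (rule inv.bounded_orbit_in_stable[of \<mu> z U S v C])
    show "\<exists>p q. p \<in> U z \<and> q \<in> S z \<and> v = p + q" using split[OF that(1), of v] add.commute by metis
  qed (use \<mu> that G_invariant stable unstable C in blast)+
  have le: "C * \<mu> ^ n * norm v \<le> C * norm v" for n v
    using C \<mu> mult_right_mono[OF mult_left_mono[OF power_le_one[of \<mu> n], of C], of "norm v"] by simp
  have "quasi_hyperbolic_set F G F' G' ?A C"
  proof
    show "norm (cocycle F F' n z v) \<le> C * norm v" if "z \<in> ?A" "v \<in> bounded_orbit F F' z" for z v n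
      using stable[OF that(1) S[OF that]] le by (rule order_trans)
    show "norm (cocycle G G' n z v) \<le> C * norm v" if "z \<in> ?A" "v \<in> bounded_orbit G G' z" for z v n
      using unstable[OF that(1) U[OF that]] le by (rule order_trans)
    show "v = 0" if "z \<in> ?A" "v \<in> bounded_orbit F F' z" "v \<in> bounded_orbit G G' z" for z v
      using S[OF that(1,2)] U[OF that(1,3)] inter[OF that(1)] by blast
  qed (rule aperiodic)
  then show thesis by (rule that)
qed

lemma continuous_on_ann_projI:
  fixes \<sigma> :: "annulus \<Rightarrow> 'a::topological_space"
  assumes "continuous_on (ann_proj -` M) (\<lambda>z. \<sigma> (ann_proj z))"
  shows "continuous_on M \<sigma>"
proof (rule continuous_on_sequentiallyI)
  fix x a assume x: "\<forall>n::nat. x n \<in> M" "a \<in> M" "x \<longlonglongrightarrow> a"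
  obtain z where z: "ann_proj z = a" by (rule ann_proj_surj)
  have "\<exists>w. ann_proj w = y \<and> dist w z = dist y (ann_proj z)" for y using ann_proj_near by metis
  then obtain l where l: "\<And>y. ann_proj (l y) = y" "\<And>y. dist (l y) z = dist y (ann_proj z)" by metis
  have lim: "(\<lambda>n. l (x n)) \<longlonglongrightarrow> z"
    using x(3) by (simp add: tendsto_dist_iff[of _ z] l z flip: tendsto_dist_iff)
  have "(\<lambda>n. \<sigma> (ann_proj (l (x n)))) \<longlonglongrightarrow> \<sigma> (ann_proj z)"
    by (rule continuous_on_tendsto_compose[OF assms lim]) (use x z l in auto)
  then show "(\<lambda>n. \<sigma> (x n)) \<longlonglongrightarrow> \<sigma> a" by (simp add: l z)
qed

lemma continuous_subbundle_slope:
  fixes \<sigma> :: "'a::topological_space \<Rightarrow> real"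
  assumes "continuous_on M \<sigma>"
  shows "continuous_subbundle M (\<lambda>x. span {(1 :: real, \<sigma> x)})"
  unfolding continuous_subbundle_def
proof
  fix x assume "x \<in> M"
  define b :: "nat \<Rightarrow> 'a \<Rightarrow> real \<times> real" where "b i y = (1, \<sigma> y)" for i y
  have b: "(\<lambda>i. b i y) ` {..<1} = {(1, \<sigma> y)}" for y by (auto simp: b_def)
  show "\<exists>U k. \<exists>b :: nat \<Rightarrow> 'a \<Rightarrow> real \<times> real. open U \<and> x \<in> U \<and> (\<forall>i<k. continuous_on (M \<inter> U) (b i)) \<and>
     (\<forall>y \<in> M \<inter> U. inj_on (\<lambda>i. b i y) {..<k} \<and> independent ((\<lambda>i. b i y) ` {..<k}) \<and>
        span {(1, \<sigma> y)} = span ((\<lambda>i. b i y) ` {..<k}))"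
  proof (intro exI[of _ UNIV] exI[of _ 1] exI[of _ b] conjI allI impI ballI)
    show "continuous_on (M \<inter> UNIV) (b i)" for i
      unfolding b_def[abs_def] using assms by (simp add: continuous_intros)
    show "independent ((\<lambda>i. b i y) ` {..<1})" for y unfolding b by (simp add: zero_prod_def)
  qed (simp_all only: b, simp_all add: inj_on_def)
qed

lemma slope_lines_split:
  assumes "s \<noteq> u"
  shows "span {(1 :: real, s :: real)} \<inter> span {(1, u)} = {0}"
    "{v + w |v w. v \<in> span {(1 :: real, s)} \<and> w \<in> span {(1, u)}} = UNIV"
proof -
  have "v = 0" if v: "v \<in> span {(1, s)}" "v \<in> span {(1, u)}" for v :: "real \<times> real"
  proof -
    obtain a b where "v = a *\<^sub>R (1, s)" "v = b *\<^sub>R (1, u)" using v unfolding span_singleton by blast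
    then show ?thesis using assms by (auto simp: prod_eq_iff)
  qed
  then show "span {(1 :: real, s)} \<inter> span {(1, u)} = {0}"
    by (intro equalityI subsetI) (simp_all add: span_zero)
  have "x \<in> {v + w |v w. v \<in> span {(1, s)} \<and> w \<in> span {(1, u)}}" for x :: "real \<times> real"
  proof -
    \<comment> \<open>The coordinate of \<open>x\<close> along \<open>(1, s)\<close> in the basis
      \<open>(1, s)\<close>, \<open>(1, u)\<close>, by Cramer's rule.\<close>
    define a where "a = (snd x - u * fst x) / (s - u)"
    have "a * (s - u) = snd x - u * fst x" using assms by (simp add: a_def)
    then have "x = a *\<^sub>R (1, s) + (fst x - a) *\<^sub>R (1, u)" by (simp add: prod_eq_iff algebra_simps)
    moreover have "a *\<^sub>R (1, s) \<in> span {(1, s)}" "(fst x - a) *\<^sub>R (1, u) \<in> span {(1, u)}"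
      by (intro span_scale span_base, simp)+
    ultimately show ?thesis by blast
  qed
  then show "{v + w |v w. v \<in> span {(1 :: real, s)} \<and> w \<in> span {(1, u)}} = UNIV" by blast
qed

lemma (in annulus_lift) uniformly_hyperbolicI:
  assumes set: "lifted_ordered_set F G F' G' (ann_proj -` M)" and M: "compact M" "f ` M = M"
    and hyp: "hyperbolic_slopes F G F' G' (ann_proj -` M) s u C \<mu>"
  shows "uniformly_hyperbolic f M"
proof -
  interpret lifted_ordered_set F G F' G' "ann_proj -` M" by (rule set)
  interpret inv: annulus_lift "inv f" G F G' F' by (rule annulus_lift_inverse)
  let ?A = "ann_proj -` M"
  have C: "C > 0" and \<mu>: "0 < \<mu>" "\<mu> < 1" and cont: "continuous_on ?A s" "continuous_on ?A u"
    and H: "\<And>z. z \<in> ?A \<Longrightarrow> s z \<noteq> u z" "\<And>z m. z \<in> ?A \<Longrightarrow> s (shift m z) = s z" "\<And>z m. z \<in> ?A \<Longrightarrow> u (shift m z) = u z"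
      "\<And>z. z \<in> ?A \<Longrightarrow> \<exists>c. F' z (1, s z) = c *\<^sub>R (1, s (F z))" "\<And>z. z \<in> ?A \<Longrightarrow> \<exists>c. F' z (1, u z) = c *\<^sub>R (1, u (F z))"
      "\<And>z n. z \<in> ?A \<Longrightarrow> norm (cocycle F F' n z (1, s z)) \<le> C * \<mu> ^ n"
      "\<And>z n. z \<in> ?A \<Longrightarrow> norm (cocycle G G' n z (1, u z)) \<le> C * \<mu> ^ n"
    using hyp unfolding hyperbolic_slopes_def by blast+
  \<comment> \<open>An arbitrary section without any continuity; since \<open>s\<close> and
    \<open>u\<close> are invariant under translations, their values on it do not depend on the
    choice.\<close>
  define rep where "rep x = (SOME z. ann_proj z = x)" for x
  have rep: "ann_proj (rep x) = x" for x
    unfolding rep_def by (rule someI_ex) (metis ann_proj_surj)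
  have s_rep: "s (rep (ann_proj z)) = s z" and u_rep: "u (rep (ann_proj z)) = u z" if "z \<in> ?A" for z
    using H(2,3)[OF that] rep[of "ann_proj z"] by (metis ann_proj_eqE)+
  have contM: "continuous_on M (\<lambda>x. s (rep x))" "continuous_on M (\<lambda>x. u (rep x))"
    by (rule continuous_on_ann_projI, rule continuous_on_eq[OF cont(1)] continuous_on_eq[OF cont(2)],
        simp only: s_rep u_rep)+
  have image: "F' z ` span {(1, t)} = span {(1, t')}" if "F' z (1, t) = c *\<^sub>R (1, t')" for z t t' c
  proof -
    have "c \<noteq> 0"
    proof
      assume "c = 0"
      then have "F' z (1, t) = 0" using that by (simp add: zero_prod_def)
      then have "(1 :: real, t) = 0" using G'_F'[of z "(1, t)"] by (simp add: blinfun.zero_right)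
      then show False by (simp add: zero_prod_def)
    qed
    have "F' z ` span {(1, t)} = span (F' z ` {(1, t)})"
      by (rule linear_span_image[symmetric, OF bounded_linear.linear[OF blinfun.bounded_linear_right]])
    also have "\<dots> = span {c *\<^sub>R (1, t')}" by (simp add: that)
    also have "\<dots> = span {(1, t')}"
    proof (rule span_eq[THEN iffD2], intro conjI)
      show "{c *\<^sub>R (1, t')} \<subseteq> span {(1, t')}" by (simp add: span_scale span_base del: scaleR_Pair)
      have "(1, t') = (1 / c) *\<^sub>R (c *\<^sub>R (1, t'))" using \<open>c \<noteq> 0\<close> by simp
      then show "{(1, t')} \<subseteq> span {c *\<^sub>R (1, t')}" by (metis empty_subsetI insert_subset singletonI span_base span_scale)
    qed
    finally show ?thesis .
  qed
  have decay: "norm (cocycle K K' n z v) \<le> C * \<mu> ^ n * norm v"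
    if le: "norm (cocycle K K' n z (1 :: real, t :: real)) \<le> C * \<mu> ^ n" and v: "v \<in> span {(1, t)}"
    for K K' n z v t
  proof -
    obtain a where a: "v = a *\<^sub>R (1, t)" using v unfolding span_singleton by blast
    have "norm (cocycle K K' n z v) = \<bar>a\<bar> * norm (cocycle K K' n z (1, t))"
      unfolding a cocycle_scaleR by simp
    also have "\<dots> \<le> \<bar>a\<bar> * (C * \<mu> ^ n)" using le by (rule mult_left_mono) simp
    also have "\<dots> \<le> (C * \<mu> ^ n) * norm v"
    proof -
      have "\<bar>a\<bar> * 1 \<le> \<bar>a\<bar> * norm (1 :: real, t)" by (intro mult_left_mono norm_slope_vector(1)) simp
      then have "\<bar>a\<bar> \<le> norm v" by (simp add: a del: scaleR_Pair)
      then show ?thesis using C \<mu> mult_right_mono[of "\<bar>a\<bar>" "norm v" "C * \<mu> ^ n"] by (simp add: mult.commute)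
    qed
    finally show ?thesis .
  qed
  let ?Es = "\<lambda>x. span {(1 :: real, s (rep x))}" and ?Eu = "\<lambda>x. span {(1 :: real, u (rep x))}"
  have point: "subspace (?Es x) \<and> subspace (?Eu x) \<and>
      ?Es x \<inter> ?Eu x = {0} \<and> {u + v |u v. u \<in> ?Es x \<and> v \<in> ?Eu x} = UNIV \<and>
      tangent_map f x ` ?Es x = ?Es (f x) \<and> tangent_map f x ` ?Eu x = ?Eu (f x) \<and>
      (\<forall>n. \<forall>v \<in> ?Es x. norm (tangent_map (f ^^ n) x v) \<le> C * \<mu> ^ n * norm v) \<and>
      (\<forall>n. \<forall>v \<in> ?Eu x. norm (tangent_map (inv f ^^ n) x v) \<le> C * \<mu> ^ n * norm v)" if "x \<in> M" for x
  proof -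
    obtain z where z: "ann_proj z = x" by (rule ann_proj_surj)
    with that have zA: "z \<in> ?A" by simp
    have FzA: "F z \<in> ?A" using zA by (rule F_mem)
    have x: "s (rep x) = s z" "u (rep x) = u z" "s (rep (f x)) = s (F z)" "u (rep (f x)) = u (F z)"
      using s_rep[OF zA] u_rep[OF zA] s_rep[OF FzA] u_rep[OF FzA] by (simp_all add: z ann_proj_F)
    obtain c d where "F' z (1, s z) = c *\<^sub>R (1, s (F z))" "F' z (1, u z) = d *\<^sub>R (1, u (F z))"
      using H(4,5)[OF zA] by blast
    then have im: "F' z ` span {(1, s z)} = span {(1, s (F z))}" "F' z ` span {(1, u z)} = span {(1, u (F z))}"
      using image by blast+
    have tm: "tangent_map f x = F' z" "tangent_map (f ^^ n) x = cocycle F F' n z"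
      "tangent_map (inv f ^^ n) x = cocycle G G' n z" for n
      using tangent_map_lift[of z] tangent_map_iter[of n z] inv.tangent_map_iter[of n z] by (simp_all add: z)
    show ?thesis
      unfolding x tm
      by (intro conjI allI ballI subspace_span slope_lines_split H(1) zA im
          decay[OF H(6)[OF zA]] decay[OF H(7)[OF zA]])
  qed
  show ?thesis
    unfolding uniformly_hyperbolic_def
    by (intro conjI M exI[of _ ?Es] exI[of _ ?Eu] exI[of _ C] exI[of _ \<mu>] C \<mu>
        continuous_subbundle_slope contM ballI point)
qed

section \<open>Periodic orbits and rational rotation numbers\<close>

text \<open>
  The extension is the lower envelope of the broken lines through the data with slope \<open>L\<close> to
  the right and \<open>l\<close> to the left; it commutes with integer translations if the data do.
\<close>

lemma bilipschitz_extension: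
  fixes x y :: "'a \<Rightarrow> real"
  assumes A: "A \<noteq> {}" and l: "0 < l" "l \<le> L"
    and data: "\<And>a b. a \<in> A \<Longrightarrow> b \<in> A \<Longrightarrow> x a \<le> x b \<Longrightarrow> l * (x b - x a) \<le> y b - y a \<and> y b - y a \<le> L * (x b - x a)"
    and shift: "\<And>a. a \<in> A \<Longrightarrow> \<exists>b\<in>A. x b = x a + 1 \<and> y b = y a + 1"
      "\<And>a. a \<in> A \<Longrightarrow> \<exists>b\<in>A. x b = x a - 1 \<and> y b = y a - 1"
  obtains H where "\<And>a. a \<in> A \<Longrightarrow> H (x a) = y a" "\<And>t. H (t + 1) = H t + 1"
    "\<And>t t'. t \<le> t' \<Longrightarrow> l * (t' - t) \<le> H t' - H t \<and> H t' - H t \<le> L * (t' - t)"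
proof -
  define \<phi> where "\<phi> s = (if s \<ge> 0 then L * s else l * s)" for s
  have \<phi>: "\<phi> s + l * h \<le> \<phi> (s + h)" "\<phi> (s + h) \<le> \<phi> s + L * h" if "h \<ge> 0" for s h
  proof -
    have "0 \<le> (L - l) * h" "s < 0 \<Longrightarrow> s + h \<ge> 0 \<Longrightarrow> 0 \<le> (L - l) * (s + h)"
      "s < 0 \<Longrightarrow> s + h \<ge> 0 \<Longrightarrow> 0 \<le> (L - l) * (- s)"
      by (rule mult_nonneg_nonneg; use l(2) that in simp)+
    then show "\<phi> s + l * h \<le> \<phi> (s + h)" "\<phi> (s + h) \<le> \<phi> s + L * h"
      using that unfolding \<phi>_def by (auto simp: algebra_simps)
  qed
  define V where "V t a = y a + \<phi> (t - x a)" for t a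
  define H where "H t = (INF a\<in>A. V t a)" for t
  \<comment> \<open>No broken line passes below the data: to the right of its corner this is the
    upper slope bound of the data, to the left the lower one.\<close>
  have at_data: "y b \<le> V (x b) a" if "a \<in> A" "b \<in> A" for a b
    using data[OF that] data[OF that(2,1)] by (cases "x a \<le> x b") (auto simp: V_def \<phi>_def algebra_simps)
  have V_mono: "V t a + l * (t' - t) \<le> V t' a" "V t' a \<le> V t a + L * (t' - t)" if "t \<le> t'" for t t' a
    using \<phi>[of "t' - t" "t - x a"] that by (simp_all add: V_def)
  \<comment> \<open>Comparison with the value at one datum bounds all broken lines at
    \<open>t\<close> from below, so the infimum is finite.\<close>
  have bdd: "bdd_below (V t ` A)" for t
  proof -
    obtain b where b: "b \<in> A" using A by blast
    have "min (y b) (y b - L * (x b - t)) \<le> V t a" if "a \<in> A" for a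
    proof (cases "x b \<le> t")
      case True
      have "y b \<le> V (x b) a" using at_data that b by blast
      also have "\<dots> \<le> V (x b) a + l * (t - x b)" using l True by simp
      also have "\<dots> \<le> V t a" using True by (rule V_mono)
      finally show ?thesis by simp
    next
      case False
      then have "V (x b) a \<le> V t a + L * (x b - t)" by (intro V_mono) simp
      with at_data[OF that b] show ?thesis by simp
    qed
    then show ?thesis by (intro bdd_belowI2)
  qed
  have H_le: "H t \<le> V t a" if "a \<in> A" for t a
    unfolding H_def using bdd that by (rule cINF_lower)
  have H_ge: "c \<le> H t" if "\<And>a. a \<in> A \<Longrightarrow> c \<le> V t a" for c t
    unfolding H_def using A that by (intro cINF_greatest)
  have H_data: "H (x b) = y b" if "b \<in> A" for b
  proof (rule antisym)
    show "H (x b) \<le> y b" using H_le[OF that, of "x b"] by (simp add: V_def \<phi>_def)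
    show "y b \<le> H (x b)" using that by (intro H_ge at_data)
  qed
  have slopes: "l * (t' - t) \<le> H t' - H t \<and> H t' - H t \<le> L * (t' - t)" if t: "t \<le> t'" for t t'
  proof
    have "H t + l * (t' - t) \<le> V t' a" if "a \<in> A" for a
      using H_le[OF that, of t] V_mono(1)[OF t, of a] by linarith
    then have "H t + l * (t' - t) \<le> H t'" by (rule H_ge)
    then show "l * (t' - t) \<le> H t' - H t" by simp
    have "H t' - L * (t' - t) \<le> V t a" if "a \<in> A" for a
      using H_le[OF that, of t'] V_mono(2)[OF t, of a] by linarith
    then have "H t' - L * (t' - t) \<le> H t" by (rule H_ge)
    then show "H t' - H t \<le> L * (t' - t)" by simp
  qed
  have "H (t + 1) = H t + 1" for t
  proof (rule antisym)
    have "H (t + 1) - 1 \<le> V t a" if a: "a \<in> A" for a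
    proof -
      obtain b where "b \<in> A" "x b = x a + 1" "y b = y a + 1" using shift(1)[OF a] by blast
      then show ?thesis using H_le[of b "t + 1"] by (simp add: V_def)
    qed
    then have "H (t + 1) - 1 \<le> H t" by (rule H_ge)
    then show "H (t + 1) \<le> H t + 1" by simp
    show "H t + 1 \<le> H (t + 1)"
    proof (rule H_ge)
      fix a assume a: "a \<in> A"
      obtain b where b: "b \<in> A" "x b = x a - 1" "y b = y a - 1" using shift(2)[OF a] by blast
      then have eq: "t - x b = t + 1 - x a" by linarith
      have "V t b = V (t + 1) a - 1" unfolding V_def eq b(3) by simp
      with H_le[OF b(1), of t] show "H t + 1 \<le> V (t + 1) a" by simp
    qed
  qed
  with H_data slopes show thesis by (intro that)
qed

lemma add_int_of_add_one:
  fixes H :: "real \<Rightarrow> real"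
  assumes "\<And>t. H (t + 1) = H t + 1"
  shows "H (t + of_int k) = H t + of_int k"
proof (induction k arbitrary: t rule: int_induct[of _ 0])
  case (step1 i)
  then show ?case using assms[of "t + of_int i"] by (simp add: add.assoc)
next
  case (step2 i)
  then show ?case using assms[of "t + of_int (i - 1)"] by (simp add: algebra_simps)
qed simp

lemma circle_lift_lipschitz:
  assumes H: "\<And>s t. \<bar>H s - H t\<bar> \<le> L * \<bar>s - t\<bar>" and h: "\<And>t. h (circle_proj t) = circle_proj (H t)"
    and "L \<ge> 0"
  shows "L-lipschitz_on UNIV h"
proof (rule lipschitz_onI)
  fix a b :: circle
  obtain s where s: "circle_proj s = a" by (rule circle_proj_surj)
  obtain t where t: "circle_proj t = b" by (rule circle_proj_surj)
  obtain t' where t': "circle_proj t' = b" "dist a b = \<bar>s - t'\<bar>"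
    using dist_circle_attained[where x = s and y = t] unfolding s t by blast
  have "dist (h a) (h b) = dist (circle_proj (H s)) (circle_proj (H t'))"
    by (simp only: s[symmetric] t'(1)[symmetric] h)
  also have "\<dots> \<le> \<bar>H s - H t'\<bar>" by (rule dist_circle_le)
  also have "\<dots> \<le> L * dist a b" using H t'(2) by simp
  finally show "dist (h a) (h b) \<le> L * dist a b" .
qed fact

text \<open>The lower slope bound makes \<open>H\<close> strictly increasing with Lipschitz inverse;
  commuting with the translation by 1 lets \<open>H\<close> and its inverse descend to mutually
  inverse circle maps.\<close>

lemma bi_lipschitz_circle_homeo:
  fixes H :: "real \<Rightarrow> real"
  assumes l: "0 < l" "l \<le> L" and H1: "\<And>t. H (t + 1) = H t + 1"
    and slopes: "\<And>t t'. t \<le> t' \<Longrightarrow> l * (t' - t) \<le> H t' - H t \<and> H t' - H t \<le> L * (t' - t)"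
  obtains h where "bi_lipschitz_homeo h" "is_circle_lift h H" "strict_mono H"
proof -
  note Hk = add_int_of_add_one[of H, OF H1]
  have mono: "strict_mono H"
  proof (rule strict_monoI)
    fix s t :: real assume st: "s < t"
    then have "0 < l * (t - s)" using l by simp
    also have "\<dots> \<le> H t - H s" using slopes[of s t] st by simp
    finally show "H s < H t" by simp
  qed
  have lip: "\<bar>H s - H t\<bar> \<le> L * \<bar>s - t\<bar>" for s t
  proof -
    have "\<bar>H s - H t\<bar> \<le> L * \<bar>s - t\<bar>" if "s \<le> t" for s t
    proof -
      have "0 \<le> l * (t - s)" using l that by simp
      with slopes[OF that] that show ?thesis by simp
    qed
    from this[of s t] this[of t s] show ?thesis by (cases "s \<le> t") (simp_all add: abs_minus_commute)
  qed
  have "L-lipschitz_on UNIV H"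
    using lip l by (intro lipschitz_onI) (simp_all add: dist_real_def)
  then have cont: "continuous_on UNIV H" by (rule lipschitz_on_continuous_on)
  have "\<exists>t. H t = y" for y
  proof -
    \<comment> \<open>\<open>H\<close> maps \<open>of_int n\<close> to
      \<open>H 0 + of_int n\<close>, so \<open>n\<close> and \<open>n + 1\<close> bracket
      \<open>y\<close> for the intermediate value theorem.\<close>
    define n where "n = \<lfloor>y - H 0\<rfloor>"
    have "H (of_int n) \<le> y" "y \<le> H (of_int (n + 1))"
      using Hk[of 0 n] Hk[of 0 "n + 1"] unfolding n_def by (simp_all, linarith+)
    then have "\<exists>t\<ge>of_int n. t \<le> of_int (n + 1) \<and> H t = y"
      using cont by (intro IVT') (auto intro: continuous_on_subset)
    then show ?thesis by blast
  qed
  then have bijH: "bij H" using mono by (metis bijI strict_mono_imp_inj_on surjI surj_def)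
  define K where "K = inv H"
  have HK: "H (K t) = t" and KH: "K (H t) = t" for t
    using bijH by (auto simp: K_def bij_is_inj bij_is_surj surj_f_inv_f)
  have K1: "K (t + 1) = K t + 1" for t using H1[of "K t"] by (metis HK KH)
  note Kk = add_int_of_add_one[of K, OF K1]
  have K_lip: "\<bar>K s - K t\<bar> \<le> (1 / l) * \<bar>s - t\<bar>" for s t
  proof -
    have "l * \<bar>u - v\<bar> \<le> \<bar>H u - H v\<bar>" for u v
      using slopes[of u v] slopes[of v u] by (cases "u \<le> v") auto
    from this[of "K s" "K t"] l show ?thesis by (simp add: HK field_simps)
  qed
  have lift_fun: "\<exists>h. \<forall>t. h (circle_proj t) = circle_proj (J t)" if J: "\<And>t k. J (t + of_int k) = J t + of_int k" for J
  proof (intro exI allI)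
    fix t
    have "circle_proj (rep_circle (circle_proj t)) = circle_proj t"
      by (rule Quotient3_abs_rep[OF Quotient3_circle])
    then have "rep_circle (circle_proj t) - t \<in> \<int>" by (simp add: circle_proj_eq_iff)
    then obtain k :: int where "rep_circle (circle_proj t) - t = of_int k" by (rule Ints_cases)
    then have "rep_circle (circle_proj t) = t + of_int k" by simp
    then show "(\<lambda>a. circle_proj (J (rep_circle a))) (circle_proj t) = circle_proj (J t)"
      by (simp add: J circle_proj_eq_iff)
  qed
  obtain h where h: "\<And>t. h (circle_proj t) = circle_proj (H t)" using lift_fun[of H, OF Hk] by blast
  obtain k where k: "\<And>t. k (circle_proj t) = circle_proj (K t)" using lift_fun[of K, OF Kk] by blast
  have hk: "h (k a) = a" and kh: "k (h a) = a" for a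
  proof -
    obtain t where t: "circle_proj t = a" by (rule circle_proj_surj)
    show "h (k a) = a" "k (h a) = a" unfolding t[symmetric] h k HK KH by simp_all
  qed
  have "bij h" by (rule bij_betw_byWitness[where f' = k]) (auto simp: hk kh)
  moreover have "inv h = k" by (rule inv_equality) (simp_all add: hk kh)
  moreover have "L-lipschitz_on UNIV h" using lip h by (rule circle_lift_lipschitz) (use l in simp)
  moreover have "(1 / l)-lipschitz_on UNIV k" using K_lip k by (rule circle_lift_lipschitz) (use l in simp)
  ultimately have "bi_lipschitz_homeo h" unfolding bi_lipschitz_homeo_def by auto
  moreover have "is_circle_lift h H" unfolding is_circle_lift_def using cont h by simp
  ultimately show thesis using mono by (rule that)
qed

text \<open>\<open>H (t + 1) - H t\<close> is continuous with integer values, so one point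
  determines it everywhere.\<close>

lemma circle_lift_add_one:
  assumes H: "is_circle_lift h H" and t0: "H (t0 + 1) = H t0 + 1"
  shows "H (t + 1) = H t + 1"
proof -
  define d where "d t = H (t + 1) - H t" for t
  have H_cont: "continuous_on UNIV H" using H by (simp add: is_circle_lift_def)
  have "continuous_on UNIV (\<lambda>t. t + 1 :: real)" by (intro continuous_intros)
  then have "continuous_on UNIV (\<lambda>t. H (t + 1))" by (rule continuous_on_compose2[OF H_cont]) simp
  then have cont: "continuous_on UNIV d"
    unfolding d_def using H_cont by (rule continuous_on_diff)
  have int: "d t \<in> \<int>" for t
  proof -
    have "circle_proj (t + 1) = circle_proj t" by (simp add: circle_proj_eq_iff)
    then have "circle_proj (H (t + 1)) = circle_proj (H t)" using H by (simp add: is_circle_lift_def)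
    then show ?thesis by (simp add: circle_proj_eq_iff d_def)
  qed
  have "d constant_on UNIV"
  proof (rule continuous_discrete_range_constant[OF _ cont])
    fix z
    have "1 \<le> norm (d y - d z)" if "d y \<noteq> d z" for y
      using int[of y] int[of z] that
      by (metis Ints_diff Ints_nonzero_abs_ge1 eq_iff_diff_eq_0 real_norm_def)
    then show "\<exists>e>0. \<forall>y. y \<in> UNIV \<and> d y \<noteq> d z \<longrightarrow> e \<le> norm (d y - d z)"
      by (auto intro!: exI[of _ 1])
  qed auto
  then obtain c where "\<And>z. d z = c" by (auto simp: constant_on_def)
  then have "d t = d t0" by metis
  with t0 show ?thesis by (simp add: d_def)
qed

text \<open>The deviation of \<open>(H ^^ n) 0\<close> from \<open>n p / j\<close> is bounded: for
  the orbit of \<open>t0\<close> it depends only on \<open>n\<close> modulo \<open>j\<close>, and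
  monotonicity together with integer translations compares the orbits of \<open>0\<close> and
  \<open>t0\<close>.\<close>

lemma lift_rotation_number_periodic:
  assumes mono: "strict_mono H" and H1: "\<And>t. H (t + 1) = H t + 1"
    and j: "j > 0" and periodic: "(H ^^ j) t0 = t0 + of_int p"
  shows "lift_rotation_number H = of_int p / real j"
proof -
  have Hn1: "(H ^^ n) (t + 1) = (H ^^ n) t + 1" for n t
    by (induction n) (simp_all add: H1)
  note Hnk = add_int_of_add_one[of "H ^^ _", OF Hn1]
  have Hn_mono: "(H ^^ n) s \<le> (H ^^ n) t" if "s \<le> t" for n s t
    using that by (induction n) (simp_all add: strict_mono_less_eq[OF mono])
  have per: "(H ^^ (j * q)) t0 = t0 + of_int p * real q" for q
  proof (induction q)
    case (Suc q)
    have "j * Suc q = j * q + j" by simp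
    then have "(H ^^ (j * Suc q)) t0 = (H ^^ (j * q)) ((H ^^ j) t0)"
      by (simp only: funpow_add comp_apply)
    also have "\<dots> = (H ^^ (j * q)) t0 + of_int p" unfolding periodic by (rule Hnk)
    finally show ?case using Suc by (simp add: algebra_simps)
  qed simp
  obtain k :: int where k: "\<bar>t0\<bar> \<le> of_int k" using ex_le_of_int by blast
  \<comment> \<open>\<open>of_int k\<close> accounts for starting at \<open>0\<close> instead of
    \<open>t0\<close>, the other terms for the finitely many residues of \<open>n\<close> modulo
    \<open>j\<close>.\<close>
  define B where "B = of_int k + \<bar>t0\<bar> + Max ((\<lambda>i. \<bar>(H ^^ i) t0 - t0\<bar> + \<bar>of_int p / real j * real i\<bar>) ` {..<j})"
  have bound: "\<bar>(H ^^ n) 0 - of_int p / real j * real n\<bar> \<le> B" for n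
  proof -
    define i where "i = n mod j"
    define q where "q = n div j"
    have n: "n = i + j * q" by (simp add: i_def q_def)
    have "i < j" using j by (simp add: i_def)
    have rn: "real n = real i + real j * real q" by (simp add: n)
    have "(H ^^ n) t0 = (H ^^ i) (t0 + of_int (p * int q))"
      by (simp add: n funpow_add per)
    also have "\<dots> = (H ^^ i) t0 + of_int (p * int q)" by (rule Hnk)
    finally have Hn: "(H ^^ n) t0 - of_int p / real j * real n = (H ^^ i) t0 - of_int p / real j * real i"
      using j by (simp add: rn field_simps)
    have max: "\<bar>(H ^^ i) t0 - t0\<bar> + \<bar>of_int p / real j * real i\<bar>
        \<le> Max ((\<lambda>i. \<bar>(H ^^ i) t0 - t0\<bar> + \<bar>of_int p / real j * real i\<bar>) ` {..<j})"
      using \<open>i < j\<close> by (intro Max_ge) auto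
    have "(H ^^ n) 0 \<le> (H ^^ n) (t0 + of_int k)" "(H ^^ n) (t0 + of_int (- k)) \<le> (H ^^ n) 0"
      using k by (intro Hn_mono, simp)+
    then have "\<bar>(H ^^ n) 0 - (H ^^ n) t0\<bar> \<le> of_int k" unfolding Hnk by (simp add: abs_le_iff)
    with max Hn show ?thesis unfolding B_def by (simp add: abs_if split: if_splits)
  qed
  have "(\<lambda>n. (H ^^ n) 0 / real n - of_int p / real j) \<longlonglongrightarrow> 0"
  proof (rule Lim_null_comparison)
    show "\<forall>\<^sub>F n in sequentially. norm ((H ^^ n) 0 / real n - of_int p / real j) \<le> B / real n"
      using eventually_gt_at_top[of 0]
    proof eventually_elim
      case (elim n)
      have "(H ^^ n) 0 / real n - of_int p / real j = ((H ^^ n) 0 - of_int p / real j * real n) / real n"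
        using elim by (simp add: field_simps)
      then have "norm ((H ^^ n) 0 / real n - of_int p / real j) = \<bar>(H ^^ n) 0 - of_int p / real j * real n\<bar> / real n"
        by simp
      also have "\<dots> \<le> B / real n" using bound by (rule divide_right_mono) simp
      finally show ?case .
    qed
    show "(\<lambda>n. B / real n) \<longlonglongrightarrow> 0" by (rule lim_const_over_n)
  qed
  then have "(\<lambda>n. (H ^^ n) 0 / real n) \<longlonglongrightarrow> of_int p / real j" by (rule LIM_zero_cancel)
  then show ?thesis unfolding lift_rotation_number_def by (rule limI)
qed

text \<open>The translates of a periodic orbit form a closed invariant set, so minimality leaves
  nothing else.\<close>

lemma (in lifted_ordered_set) periodic_orbit_eq:
  assumes z: "z \<in> A" and j: "j > 0" and periodic: "(F ^^ j) z = shift p z"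
  shows "A = (\<Union>i<j. range (\<lambda>m. shift m ((F ^^ i) z)))" (is "_ = ?B")
proof (rule minimal'[symmetric])
  show "?B \<subseteq> A" using z iter_mem A_shift by blast
  show "closed ?B"
  proof (intro closed_UN ballI)
    have "range (\<lambda>m. shift m c) = {w. fst w - fst c \<in> \<int>} \<inter> {w. snd w = snd c}" for c
    proof (intro equalityI subsetI)
      fix w assume w: "w \<in> {w. fst w - fst c \<in> \<int>} \<inter> {w. snd w = snd c}"
      then obtain m :: int where "fst w - fst c = of_int m" by (auto elim: Ints_cases)
      with w have "w = shift m c" by (simp add: prod_eq_iff)
      then show "w \<in> range (\<lambda>m. shift m c)" by blast
    qed auto
    moreover have "closed ({w. fst w - fst c \<in> \<int>} \<inter> {w. snd w = snd c})" for c :: "real \<times> real"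
    proof (intro closed_Int closed_Collect_eq continuous_intros)
      have "closed ((\<lambda>w :: real \<times> real. fst w - fst c) -` \<int>)"
        by (intro continuous_closed_vimage closed_Ints continuous_intros)
      then show "closed {w :: real \<times> real. fst w - fst c \<in> \<int>}" by (simp add: vimage_def)
    qed
    ultimately show "closed (range (\<lambda>m. shift m ((F ^^ i) z)))" for i by simp
  qed simp
  show "?B \<noteq> {}" using j by auto
  show "shift m w \<in> ?B" if wB: "w \<in> ?B" for w m
  proof -
    obtain i n where "i < j" "w = shift n ((F ^^ i) z)" using wB by blast
    then have "shift m w = shift (m + n) ((F ^^ i) z)" by simp
    with \<open>i < j\<close> show ?thesis by blast
  qed
  show "F w \<in> ?B" if wB: "w \<in> ?B" for w
  proof -
    obtain i m where w: "i < j" "w = shift m ((F ^^ i) z)" using wB by blast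
    show ?thesis
    proof (cases "Suc i < j")
      case True
      have "F w = shift m ((F ^^ Suc i) z)" by (simp add: w F_shift)
      with True show ?thesis by blast
    next
      case False
      with w have "Suc i = j" by simp
      then have "F w = shift m ((F ^^ j) z)" using w by (auto simp: F_shift)
      also have "\<dots> = shift (m + p) ((F ^^ 0) z)" by (simp add: periodic)
      finally show ?thesis using j by blast
    qed
  qed
  show "G w \<in> ?B" if wB: "w \<in> ?B" for w
  proof -
    obtain i m where w: "i < j" "w = shift m ((F ^^ i) z)" using wB by blast
    show ?thesis
    proof (cases i)
      case (Suc k)
      then have "G w = shift m ((F ^^ k) z)" by (simp add: w G_shift)
      with Suc w(1) show ?thesis by (metis (no_types, lifting) UN_iff Suc_lessD lessThan_iff rangeI)
    next
      \<comment> \<open>One step back from the starting point is, by periodicity, the last point of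
        the orbit up to the translation by \<open>- p\<close>.\<close>
      case 0
      obtain k where k: "j = Suc k" using j by (cases j) auto
      have "shift p (G z) = G ((F ^^ j) z)" by (simp add: periodic G_shift)
      also have "\<dots> = (F ^^ k) z" by (simp add: k)
      finally have "shift (- p) (shift p (G z)) = shift (- p) ((F ^^ k) z)" by simp
      then have "G w = shift (m - p) ((F ^^ k) z)" using 0 by (simp add: w G_shift)
      then show ?thesis using k by blast
    qed
  qed
qed

text \<open>\<open>A\<close> is finite modulo translations, so up to a common translation only
  finitely many pairs at horizontal distance at most 1 occur, and their ratios have a positive
  minimum and a maximum.\<close>

lemma (in lifted_ordered_set) periodic_bi_lipschitz:
  assumes z: "z \<in> A" and j: "j > 0" and periodic: "(F ^^ j) z = shift p z"
  obtains l L where "0 < l" "l \<le> L"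
    "\<And>a b. a \<in> A \<Longrightarrow> b \<in> A \<Longrightarrow> fst a \<le> fst b \<Longrightarrow>
       l * (fst b - fst a) \<le> fst (F b) - fst (F a) \<and> fst (F b) - fst (F a) \<le> L * (fst b - fst a)"
proof -
  define P where "P = (\<lambda>i. (F ^^ i) z) ` {..<j}"
  have finP: "finite P" by (simp add: P_def)
  have PA: "P \<subseteq> A" using iter_mem[OF z] by (auto simp: P_def)
  have A: "\<exists>m c. c \<in> P \<and> a = shift m c" if "a \<in> A" for a
    using that periodic_orbit_eq[OF assms] unfolding P_def by blast
  obtain R where R: "\<And>c. c \<in> P \<Longrightarrow> \<bar>fst c\<bar> \<le> R"
  proof -
    have "bounded (fst ` P)" using finP by (intro finite_imp_bounded finite_imageI)
    then show thesis using that by (auto simp: bounded_iff)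
  qed
  \<comment> \<open>A translate of a point of \<open>P\<close> at horizontal distance at most 1 from
    a point of \<open>P\<close> uses a translation of size at most \<open>2 * R + 1\<close>.\<close>
  define N where "N = \<lceil>2 * R + 1\<rceil>"
  define Q where "Q = {q \<in> P \<times> (\<lambda>(m, c). shift m c) ` ({- N..N} \<times> P). fst (fst q) < fst (snd q)}"
  \<comment> \<open>The ratio 1 is added because splitting off \<open>k\<close> whole turns
    contributes \<open>k\<close> to both differences, which is harmless when
    \<open>Min X \<le> 1 \<le> Max X\<close>.\<close>
  define X where "X = insert 1 ((\<lambda>(a, b). (fst (F b) - fst (F a)) / (fst b - fst a)) ` Q)"
  have finX: "finite X"
  proof -
    have "finite (P \<times> (\<lambda>(m, c). shift m c) ` ({- N..N} \<times> P))" using finP by simp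
    then have "finite Q" by (rule rev_finite_subset) (simp add: Q_def)
    then show ?thesis by (simp add: X_def)
  qed
  have QA: "a \<in> A" "b \<in> A" "fst a < fst b" if "(a, b) \<in> Q" for a b
    using that PA A_shift unfolding Q_def by auto
  have Xpos: "x > 0" if "x \<in> X" for x
  proof -
    have "(fst (F b) - fst (F a)) / (fst b - fst a) > 0" if "(a, b) \<in> Q" for a b
      using QA[OF that] order[of a b] by simp
    with that show ?thesis unfolding X_def by auto
  qed
  have "1 \<in> X" by (simp add: X_def)
  have l1: "Min X \<le> 1" and L1: "1 \<le> Max X" using finX \<open>1 \<in> X\<close> by simp_all
  have lpos: "Min X > 0" using Xpos Min_in[OF finX] \<open>1 \<in> X\<close> by blast
  have main: "Min X * (fst b - fst a) \<le> fst (F b) - fst (F a) \<and> fst (F b) - fst (F a) \<le> Max X * (fst b - fst a)"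
    if ab: "a \<in> A" "b \<in> A" "fst a < fst b" for a b
  proof -
    obtain m a0 where a: "a0 \<in> P" "a = shift m a0" using A[OF ab(1)] by blast
    obtain n c where c: "c \<in> P" "b = shift n c" using A[OF ab(2)] by blast
    \<comment> \<open>The number of whole turns that leaves a remainder in the interval from 0
      (excluded) to 1 (included), so that the reduced pair is still strictly ordered.\<close>
    define k where "k = \<lceil>fst b - fst a\<rceil> - 1"
    define b0 where "b0 = shift (n - m - k) c"
    have k: "of_int k < fst b - fst a" "fst b - fst a \<le> of_int k + 1" unfolding k_def by linarith+
    have "k \<ge> 0" using ab(3) unfolding k_def by simp
    have b: "b = shift (m + k) b0" by (simp add: b0_def c)
    have d0: "fst b - fst a = (fst b0 - fst a0) + of_int k" by (simp add: a b)
    have e0: "fst (F b) - fst (F a) = (fst (F b0) - fst (F a0)) + of_int k" by (simp add: a b F_shift)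
    have "n - m - k \<in> {- N..N}"
    proof -
      have "fst b0 = fst c + of_int (n - m - k)" by (simp add: b0_def)
      with R[OF a(1)] R[OF c(1)] k d0 have "\<bar>real_of_int (n - m - k)\<bar> \<le> 2 * R + 1" by linarith
      then show ?thesis unfolding N_def by (simp add: abs_le_iff) linarith
    qed
    then have "b0 \<in> (\<lambda>(m, c). shift m c) ` ({- N..N} \<times> P)"
      unfolding b0_def using c(1) by (intro image_eqI[of _ _ "(n - m - k, c)"]) simp_all
    moreover have pos: "fst a0 < fst b0" using k d0 by linarith
    ultimately have "(a0, b0) \<in> Q" using a(1) by (simp add: Q_def)
    then have X: "(fst (F b0) - fst (F a0)) / (fst b0 - fst a0) \<in> X"
      unfolding X_def by (intro insertI2 image_eqI[of _ _ "(a0, b0)"]) simp_all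
    have "Min X * (fst b0 - fst a0) \<le> fst (F b0) - fst (F a0)"
      using Min_le[OF finX X] pos by (simp add: pos_le_divide_eq)
    moreover have "fst (F b0) - fst (F a0) \<le> Max X * (fst b0 - fst a0)"
      using Max_ge[OF finX X] pos by (simp add: pos_divide_le_eq)
    moreover have "Min X * of_int k \<le> of_int k" "of_int k \<le> Max X * of_int k"
      using mult_right_mono[OF l1, of "of_int k"] mult_right_mono[OF L1, of "of_int k"] \<open>k \<ge> 0\<close> by simp_all
    ultimately show ?thesis unfolding d0 e0 by (simp add: algebra_simps)
  qed
  show thesis
  proof (rule that[OF lpos])
    show "Min X \<le> Max X" using l1 L1 by simp
    fix a b assume ab: "a \<in> A" "b \<in> A" "fst a \<le> fst b"
    show "Min X * (fst b - fst a) \<le> fst (F b) - fst (F a) \<and> fst (F b) - fst (F a) \<le> Max X * (fst b - fst a)"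
    proof (cases "fst a = fst b")
      case True
      then show ?thesis using graph[OF ab(1,2)] by simp
    qed (use main ab in simp)
  qed
qed

text \<open>The definite description requires existence and uniqueness. Existence is the
  bi-Lipschitz extension of the action on first coordinates; uniqueness holds because every
  admissible lift has the periodic point \<open>fst z\<close> modulo translations, which fixes its
  rotation number.\<close>

lemma (in annulus_lift) rotation_number_periodic:
  assumes set: "lifted_ordered_set F G F' G' (ann_proj -` M)"
    and z: "z \<in> ann_proj -` M" and j: "j > 0" and periodic: "(F ^^ j) z = shift p z"
  shows "rotation_number f M F = of_int p / real j"
proof -
  interpret lifted_ordered_set F G F' G' "ann_proj -` M" by (rule set)
  let ?A = "ann_proj -` M"
  obtain l L where lL: "0 < l" "l \<le> L"
    "\<And>a b. a \<in> ?A \<Longrightarrow> b \<in> ?A \<Longrightarrow> fst a \<le> fst b \<Longrightarrow>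
       l * (fst b - fst a) \<le> fst (F b) - fst (F a) \<and> fst (F b) - fst (F a) \<le> L * (fst b - fst a)"
    using z j periodic by (rule periodic_bi_lipschitz) blast
  have shift_ex: "\<exists>b\<in>?A. fst b = fst a + 1 \<and> fst (F b) = fst (F a) + 1"
    "\<exists>b\<in>?A. fst b = fst a - 1 \<and> fst (F b) = fst (F a) - 1" if "a \<in> ?A" for a
    using A_shift[OF that, of 1] A_shift[OF that, of "-1"]
    by (intro bexI[of _ "shift 1 a"] bexI[of _ "shift (-1) a"]; simp add: F_shift)+
  obtain H where H: "\<And>a. a \<in> ?A \<Longrightarrow> H (fst a) = fst (F a)" "\<And>t. H (t + 1) = H t + 1"
    "\<And>t t'. t \<le> t' \<Longrightarrow> l * (t' - t) \<le> H t' - H t \<and> H t' - H t \<le> L * (t' - t)"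
  proof (rule bilipschitz_extension[where x = fst and y = "\<lambda>a. fst (F a)", OF A_nonempty lL shift_ex])
    fix H assume "\<And>a. a \<in> ?A \<Longrightarrow> H (fst a) = fst (F a)" "\<And>t. H (t + 1) = H t + 1"
      "\<And>t t'. t \<le> t' \<Longrightarrow> l * (t' - t) \<le> H t' - H t \<and> H t' - H t \<le> L * (t' - t)"
    then show thesis by (rule that[of H])
  qed
  obtain h where h: "bi_lipschitz_homeo h" "is_circle_lift h H" "strict_mono H"
    using lL(1,2) H(2,3) by (rule bi_lipschitz_circle_homeo)
  have hM: "fst (f x) = h (fst x)" if "x \<in> M" for x
  proof -
    obtain w where w: "ann_proj w = x" by (rule ann_proj_surj)
    have "f x = ann_proj (F w)" by (simp add: ann_proj_F w)
    then have "fst (f x) = circle_proj (fst (F w))" by (simp add: ann_proj_def)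
    also have "\<dots> = circle_proj (H (fst w))" using H(1)[of w] w that by simp
    also have "\<dots> = h (fst x)" using h(2) w by (auto simp: is_circle_lift_def ann_proj_def)
    finally show ?thesis .
  qed
  have rot: "lift_rotation_number K = of_int p / real j"
    if "is_circle_lift k K" "strict_mono K" and K: "\<forall>z \<in> ?A. K (fst z) = fst (F z)" for k K
  proof (rule lift_rotation_number_periodic[OF that(2) _ j])
    have "K (fst z + 1) = K (fst z) + 1"
      using K[rule_format, OF z] K[rule_format, OF A_shift[OF z, of 1]] by (simp add: F_shift)
    then show "K (t + 1) = K t + 1" for t by (rule circle_lift_add_one[OF that(1)])
    have "(K ^^ n) (fst z) = fst ((F ^^ n) z)" for n
      by (induction n) (use K iter_mem[OF z] in auto)
    then show "(K ^^ j) (fst z) = fst z + of_int p" by (simp add: periodic)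
  qed
  show ?thesis
    unfolding rotation_number_def
  proof (rule the_equality)
    show "\<exists>h H. bi_lipschitz_homeo h \<and> is_circle_lift h H \<and> strict_mono H \<and>
      (\<forall>x\<in>M. fst (f x) = h (fst x)) \<and> (\<forall>z\<in>?A. H (fst z) = fst (F z)) \<and>
      of_int p / real j = lift_rotation_number H"
      using h hM H(1) rot[OF h(2,3)] by (intro exI[of _ h] exI[of _ H]) simp
  qed (use rot in blast)
qed

lemma (in annulus_lift) irrational_aperiodic:
  assumes "lifted_ordered_set F G F' G' (ann_proj -` M)" and irrational: "irrational_set f M"
    and "z \<in> ann_proj -` M" "j > 0"
  shows "(F ^^ j) z \<noteq> shift p z"
proof
  assume "(F ^^ j) z = shift p z"
  then have "rotation_number f M F = of_int p / real j" using assms by (intro rotation_number_periodic)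
  then have "rotation_number f M F \<in> \<rat>" by simp
  with irrational lift show False by (simp add: irrational_set_def)
qed

text \<open>The twist would strictly order the images of two points above each other, whereas the
  order condition forbids this for equal first coordinates.\<close>

lemma (in annulus_lift) twist_graph:
  assumes mono: "\<And>\<theta> r r'. r < r' \<Longrightarrow> fst (F (\<theta>, r)) < fst (F (\<theta>, r'))"
    and order: "\<And>z w. z \<in> A \<Longrightarrow> w \<in> A \<Longrightarrow> fst (F z) < fst (F w) \<longleftrightarrow> fst z < fst w"
    and zw: "z \<in> A" "w \<in> A" "fst z = fst w"
  shows "z = w"
proof -
  have "\<not> snd z < snd w" if "z \<in> A" "w \<in> A" "fst z = fst w" for z w
    using mono[of "snd z" "snd w" "fst z"] order[OF that(1,2)] that(3) by (metis less_irrefl prod.collapse)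
  from this[OF zw] this[OF zw(2,1) zw(3)[symmetric]] zw(3) show ?thesis
    by (simp add: prod_eq_iff)
qed

theorem proposition4:
  fixes f :: "annulus \<Rightarrow> annulus" and M :: "annulus set"
  assumes "twist_map f" and "exact_symplectic f"
    and "Aubry_Mather_set f M" and "irrational_set f M"
  shows "(\<forall>x \<in> M. \<not> C1_regular_at M x) \<longleftrightarrow> uniformly_hyperbolic f M"
proof -
  let ?A = "ann_proj -` M"
  have diffeo: "ann_C1_diffeo f"
  proof -
    have "ann_C1_diffeo g" "ann_C1_diffeo (inv g)" if "positive_twist_map g" for g
      using that by (auto simp: positive_twist_map_def ann_C1_diffeo_def bij_imp_bij_inv inv_inv_eq)
    then show ?thesis using assms(1) unfolding twist_map_def negative_twist_map_def by blast
  qed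
  obtain F G F' G' where "is_lift f F" "is_lift (inv f) G" "\<And>z. F (G z) = z" "\<And>z. G (F z) = z"
    "\<And>z. (F has_derivative blinfun_apply (F' z)) (at z)" "continuous_on UNIV F'"
    "\<And>z. (G has_derivative blinfun_apply (G' z)) (at z)" "continuous_on UNIV G'"
    using diffeo by (rule diffeo_lifts) blast
  then interpret annulus_lift f F G F' G'
    using diffeo by unfold_locales (auto simp: ann_C1_diffeo_def)
  interpret inv: annulus_lift "inv f" G F G' F' by (rule annulus_lift_inverse)
  have M: "f_ordered f M" "compact M" "f ` M = M"
    using assms(3) by (auto simp: Aubry_Mather_set_def f_ordered_def)
  have order: "fst (F z) < fst (F w) \<longleftrightarrow> fst z < fst w" if "z \<in> ?A" "w \<in> ?A" for z w
    using M(1) lift that unfolding f_ordered_def by blast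
  have order': "fst (G z) < fst (G w) \<longleftrightarrow> fst z < fst w" if "z \<in> ?A" "w \<in> ?A" for z w
  proof -
    have "G z \<in> ?A" if "z \<in> ?A" for z
    proof -
      have "ann_proj z \<in> f ` M" using that M(3) by simp
      then obtain y where "y \<in> M" "ann_proj z = f y" by blast
      then show ?thesis using bij by (simp add: ann_proj_G bij_is_inj)
    qed
    then show ?thesis using order[of "G z" "G w"] that by (simp add: FG)
  qed
  \<comment> \<open>A negative twist map satisfies the sign conditions with \<open>F\<close> and
    \<open>G\<close> exchanged; the graph property then comes from the order condition for the
    inverse.\<close>
  have signs: "((\<forall>z. fst (F' z (0, 1)) > 0 \<and> fst (G' z (0, 1)) < 0) \<or>
      (\<forall>z. fst (G' z (0, 1)) > 0 \<and> fst (F' z (0, 1)) < 0)) \<and>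
    (\<forall>z\<in>?A. \<forall>w\<in>?A. fst z = fst w \<longrightarrow> z = w)"
    using assms(1) unfolding twist_map_def
  proof
    assume "positive_twist_map f"
    from positive_twist[OF this] show ?thesis using twist_graph[of ?A, OF _ order] by blast
  next
    assume "negative_twist_map f"
    then have "positive_twist_map (inv f)"
      by (auto simp: negative_twist_map_def positive_twist_map_def ann_C1_diffeo_def inv_inv_eq)
    from inv.positive_twist[OF this] show ?thesis using inv.twist_graph[of ?A, OF _ order'] by blast
  qed
  then have set: "lifted_ordered_set F G F' G' ?A"
    by (intro lifted_ordered_set assms(3)) blast
  then interpret lifted_ordered_set F G F' G' ?A .
  have regular: "C1_regular_at M (ann_proj z) \<longleftrightarrow> (\<exists>D. subspace D \<and> dim D = 1 \<and> ptg_cone ?A z \<subseteq> D)" for z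
    by (simp add: C1_regular_at_def paratingent_cone_ann_proj)
  have area: "area (F' z v) (F' z w) = area v w" for z v w
    using assms(2) by (rule area_preserving)
  have area': "area (G' z v) (G' z w) = area v w" for z v w
    using area[of "G z" "G' z v" "G' z w"] by simp
  show ?thesis
  proof
    assume irregular: "\<forall>x\<in>M. \<not> C1_regular_at M x"
    then have cone: "\<not> ptg_cone ?A z \<subseteq> D" if "z \<in> ?A" "subspace D" "dim D = 1" for z D
      using that regular by blast
    have "\<exists>s u C \<mu>. hyperbolic_slopes F G F' G' ?A s u C \<mu>"
      using signs[THEN conjunct1]
    proof
      assume "\<forall>z. fst (F' z (0, 1)) > 0 \<and> fst (G' z (0, 1)) < 0"
      then interpret irregular_twist_set F G F' G' ?A
        by unfold_locales (use area cone in auto)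
      show ?thesis by (rule hyperbolic_slopes_exist) blast
    next
      assume "\<forall>z. fst (G' z (0, 1)) > 0 \<and> fst (F' z (0, 1)) < 0"
      \<comment> \<open>The stable slope found here belongs to the inverse, so it is the unstable
        slope for \<open>f\<close>; \<open>hyperbolic_slopes_inverse\<close> swaps the two
        back.\<close>
      then interpret irregular_twist_set G F G' F' ?A
        by (intro irregular_twist_set.intro lifted_ordered_set_inverse irregular_twist_set_axioms.intro)
          (use area' cone in auto)
      obtain s u C \<mu> where "hyperbolic_slopes G F G' F' ?A s u C \<mu>" by (rule hyperbolic_slopes_exist)
      from hyperbolic_slopes_inverse[OF this] show ?thesis by blast
    qed
    then show "uniformly_hyperbolic f M" using uniformly_hyperbolicI[OF set M(2,3)] by blast
  next
    assume "uniformly_hyperbolic f M"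
    then obtain C where "quasi_hyperbolic_set F G F' G' ?A C"
      using quasi_hyperbolic_set[OF set] irrational_aperiodic[OF set assms(4)] by blast
    then interpret quasi_hyperbolic_set F G F' G' ?A C .
    show "\<forall>x\<in>M. \<not> C1_regular_at M x"
    proof
      fix x assume "x \<in> M"
      obtain z where z: "ann_proj z = x" by (rule ann_proj_surj)
      with \<open>x \<in> M\<close> have "z \<in> ?A" by simp
      then show "\<not> C1_regular_at M x" using ptg_cone_not_in_line regular z by blast
    qed
  qed
qed

end
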